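(* Let $G$ be a finite group, $s\in G$, $\mathcal{O}$ the conjugacy class of $s$ in $G$, and $\rho$ an irreducible complex representation of the centralizer $G^s$. Assume that there exists an integer $j$ such that $s$, $s^j$ and $s^{j^2}$ are distinct elements and $s^j\in\mathcal{O}$. If $\dim\mathfrak{B}(\mathcal{O},\rho)<\infty$, then $s$ has even order and $q_{ss}=-1$.
   Context: Let $G$ be a finite group, $s\in G$, $\mathcal{O}$ the conjugacy class of $s$ in $G$, $G^s$ the centralizer of $s$ in $G$, and $\rho:G^s\to GL(V)$ an irreducible complex representation. Since $s$ is central in $G^s$, by Schur's Lemma $\rho(s)$ is a scalar, denoted $q_{ss}$. List $\mathcal{O}=\{t_1=s,\dots,t_M\}$ and choose $g_i\in G$ with $g_isg_i^{-1}=t_i$. The irreducible Yetter-Drinfeld module $M(\mathcal{O},\rho)=\bigoplus_{i=1}^M g_i\otimes V$ over $\mathbb{C}G$ has, writing $g_iv:=g_i\otimes v$, coaction $\delta(g_iv)=t_i\otimes g_iv$ and action $g\cdot(g_iv)=g_j(\gamma\cdot v)$, where $gg_i=g_j\gamma$ with $\gamma\in G^s$. It is a braided vector space with braiding $c(g_iv\otimes g_jw)=t_i\cdot(g_jw)\otimes g_iv$. $\mathfrak{B}(\mathcal{O},\rho)$ denotes the Nichols algebra of this braided vector space. *)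

theory Defs
  imports "HOL-Analysis.Analysis" "HOL-Algebra.Embedded_Algebras" "HOL-Algebra.QuotRing"
    "HOL-Algebra.Multiplicative_Group"
begin

section \<open>The Nichols algebra of a braided vector space\<close>

text \<open>
  A finite-dimensional complex braided vector space is given by a finite set \<open>B\<close> (a basis of
  the vector space \<open>V\<close>) and the matrix \<open>C\<close> of the braiding:
  \<open>c (a \<otimes> b) = (\<Sum>p\<in>B \<times> B. C (a, b) p \<cdot> (fst p \<otimes> snd p))\<close>.
  The tensor algebra \<open>T(V)\<close> is realised on finitely supported complex functions on the words
  over \<open>B\<close>; the word \<open>[b\<^sub>1, \<dots>, b\<^sub>n]\<close> stands for \<open>b\<^sub>1 \<otimes> \<dots> \<otimes> b\<^sub>n\<close>.
\<close>

type_synonym 'b tensor = "'b list \<Rightarrow> complex"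

type_synonym 'b braiding = "'b \<times> 'b \<Rightarrow> 'b \<times> 'b \<Rightarrow> complex"

definition tensor_scalar :: "complex \<Rightarrow> 'b tensor" where
  "tensor_scalar a = (\<lambda>w. if w = [] then a else 0)"

definition tensor_algebra :: "'b set \<Rightarrow> 'b tensor ring" where
  "tensor_algebra B =
    \<lparr>carrier = {x. finite {w. x w \<noteq> 0} \<and> {w. x w \<noteq> 0} \<subseteq> lists B},
     mult = (\<lambda>x y w. \<Sum>k\<le>length w. x (take k w) * y (drop k w)),
     one = tensor_scalar 1,
     ring.zero = (\<lambda>w. 0),
     add = (\<lambda>x y w. x w + y w)\<rparr>"

text \<open>
  The braiding in the tensor positions \<open>i\<close>, \<open>i + 1\<close> (counted from \<open>0\<close>). On words too short to
  have these positions it is the identity, a case that is never used below.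
\<close>

definition braid_at :: "'b set \<Rightarrow> 'b braiding \<Rightarrow> nat \<Rightarrow> 'b tensor \<Rightarrow> 'b tensor" where
  "braid_at B C i x = (\<lambda>w. if Suc i < length w
     then \<Sum>(a, b)\<in>B \<times> B. x (w[i := a, Suc i := b]) * C (a, b) (w ! i, w ! Suc i)
     else x w)"

text \<open>
  The quantum symmetrizer \<open>\<SS>\<^sub>n = (\<Sum>\<sigma>. T\<^sub>\<sigma>)\<close>, where \<open>\<sigma>\<close> ranges over the symmetric group on
  \<open>n\<close> letters and \<open>T\<^sub>\<sigma>\<close> is the product of the operators \<open>c\<^sub>i\<close> along a reduced expression of
  \<open>\<sigma>\<close>. Every permutation of \<open>n + 1\<close> letters is \<open>s\<^sub>k s\<^sub>k\<^sub>+\<^sub>1 \<dots> s\<^sub>n\<^sub>-\<^sub>1 \<tau>\<close>, lengths adding up,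
  for exactly one \<open>k \<le> n\<close> and one permutation \<open>\<tau>\<close> of the first \<open>n\<close> letters, whence
  \<open>\<SS>\<^sub>n\<^sub>+\<^sub>1 = (\<Sum>k\<le>n. c\<^sub>k c\<^sub>k\<^sub>+\<^sub>1 \<dots> c\<^sub>n\<^sub>-\<^sub>1) (\<SS>\<^sub>n \<otimes> id)\<close>. Since \<^term>\<open>braid_at\<close> acts on words of any
  length, \<open>\<SS>\<^sub>n \<otimes> id\<close> is again given by the operator \<open>\<SS>\<^sub>n\<close>.
\<close>

primrec quantum_symmetrizer :: "'b set \<Rightarrow> 'b braiding \<Rightarrow> nat \<Rightarrow> 'b tensor \<Rightarrow> 'b tensor" where
  "quantum_symmetrizer B C 0 x = x"
| "quantum_symmetrizer B C (Suc n) x =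
     (\<lambda>w. \<Sum>k\<le>n. foldr (braid_at B C) [k..<n] (quantum_symmetrizer B C n x) w)"

definition homogeneous_part :: "nat \<Rightarrow> 'b tensor \<Rightarrow> 'b tensor" where
  "homogeneous_part n x = (\<lambda>w. if length w = n then x w else 0)"

text \<open>
  The Nichols algebra is \<open>T(V) / J\<close>, where \<open>J = \<Oplus>\<^sub>n ker \<SS>\<^sub>n\<close>; \<open>J\<close> is a two-sided ideal
  because \<open>c\<close> satisfies the braid equation.
\<close>

definition nichols_ideal :: "'b set \<Rightarrow> 'b braiding \<Rightarrow> 'b tensor set" where
  "nichols_ideal B C = {x \<in> carrier (tensor_algebra B).
     \<forall>n. quantum_symmetrizer B C n (homogeneous_part n x) = (\<lambda>w. 0)}"

definition nichols_algebra :: "'b set \<Rightarrow> 'b braiding \<Rightarrow> 'b tensor set ring" where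
  "nichols_algebra B C = tensor_algebra B Quot nichols_ideal B C"

text \<open>
  The dimension over \<open>\<complex>\<close> is taken over the image of \<open>\<complex> = T\<^sup>0(V)\<close> in the Nichols algebra.
\<close>

definition nichols_scalars :: "'b set \<Rightarrow> 'b braiding \<Rightarrow> 'b tensor set set" where
  "nichols_scalars B C =
     range (\<lambda>a. nichols_ideal B C +>\<^bsub>tensor_algebra B\<^esub> tensor_scalar a)"

definition nichols_finite_dim :: "'b set \<Rightarrow> 'b braiding \<Rightarrow> bool" where
  "nichols_finite_dim B C \<longleftrightarrow>
     ring.finite_dimension (nichols_algebra B C) (nichols_scalars B C)
       (carrier (nichols_algebra B C))"


section \<open>Representations of centralizers and Yetter-Drinfeld modules\<close>

definition conj_class :: "('g, 'm) monoid_scheme \<Rightarrow> 'g \<Rightarrow> 'g set" where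
  "conj_class G s = {g \<otimes>\<^bsub>G\<^esub> s \<otimes>\<^bsub>G\<^esub> inv\<^bsub>G\<^esub> g | g. g \<in> carrier G}"

definition centralizer :: "('g, 'm) monoid_scheme \<Rightarrow> 'g \<Rightarrow> 'g set" where
  "centralizer G s = {g \<in> carrier G. g \<otimes>\<^bsub>G\<^esub> s = s \<otimes>\<^bsub>G\<^esub> g}"

definition general_linear :: "(complex^'n^'n) monoid" where
  "general_linear = \<lparr>carrier = {A. invertible A}, mult = (**), one = mat 1\<rparr>"

text \<open>
  The space \<^typ>\<open>complex^'n\<close> is never zero, so this need not be required.
\<close>

definition irreducible_rep :: "('g, 'm) monoid_scheme \<Rightarrow> ('g \<Rightarrow> complex^'n^'n) \<Rightarrow> bool" where
  "irreducible_rep H \<rho> \<longleftrightarrow> \<rho> \<in> hom H general_linear \<and>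
     (\<forall>W. vec.subspace W \<and> (\<forall>h\<in>carrier H. \<forall>w\<in>W. \<rho> h *v w \<in> W) \<longrightarrow> W = {0} \<or> W = UNIV)"

text \<open>
  This is \<open>q\<^sub>s\<^sub>s\<close>; by Schur's Lemma \<open>\<rho>(s)\<close> is scalar for irreducible \<open>\<rho>\<close>, so it is well defined.
\<close>

definition q_scalar :: "('g \<Rightarrow> complex^'n^'n) \<Rightarrow> 'g \<Rightarrow> complex" where
  "q_scalar \<rho> s = (THE q. \<rho> s = mat q)"

text \<open>
  A choice of elements \<open>g\<^sub>t\<close> with \<open>g\<^sub>t s g\<^sub>t\<^sup>-\<^sup>1 = t\<close> for \<open>t \<in> \<O>\<close>; the class is indexed by itself.
\<close>

definition conj_choice :: "('g, 'm) monoid_scheme \<Rightarrow> 'g \<Rightarrow> ('g \<Rightarrow> 'g) \<Rightarrow> bool" where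
  "conj_choice G s g \<longleftrightarrow> (\<forall>t\<in>conj_class G s.
     g t \<in> carrier G \<and> g t \<otimes>\<^bsub>G\<^esub> s \<otimes>\<^bsub>G\<^esub> inv\<^bsub>G\<^esub> (g t) = t)"

text \<open>
  Elements of \<open>M(\<O>, \<rho>)\<close> are functions assigning to \<open>t \<in> \<O>\<close> the component in \<open>g\<^sub>t \<otimes> V\<close>;
  \<open>yd_elem t v\<close> is \<open>g\<^sub>t \<otimes> v\<close>, whose coaction is \<open>t \<otimes> (g\<^sub>t \<otimes> v)\<close>. The equation
  \<open>h g\<^sub>t = g\<^sub>u \<gamma>\<close> with \<open>\<gamma> \<in> G\<^sup>s\<close> forces \<open>u = h t h\<^sup>-\<^sup>1\<close> and \<open>\<gamma> = g\<^sub>u\<^sup>-\<^sup>1 h g\<^sub>t\<close>.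
\<close>

definition yd_elem :: "'g \<Rightarrow> complex^'n \<Rightarrow> 'g \<Rightarrow> complex^'n" where
  "yd_elem t v = (\<lambda>u. if u = t then v else 0)"

definition yd_target :: "('g, 'm) monoid_scheme \<Rightarrow> 'g \<Rightarrow> 'g \<Rightarrow> 'g" where
  "yd_target G h t = h \<otimes>\<^bsub>G\<^esub> t \<otimes>\<^bsub>G\<^esub> inv\<^bsub>G\<^esub> h"

definition yd_cocycle :: "('g, 'm) monoid_scheme \<Rightarrow> ('g \<Rightarrow> 'g) \<Rightarrow> 'g \<Rightarrow> 'g \<Rightarrow> 'g" where
  "yd_cocycle G g h t = inv\<^bsub>G\<^esub> (g (yd_target G h t)) \<otimes>\<^bsub>G\<^esub> h \<otimes>\<^bsub>G\<^esub> g t"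

lemma yd_cocycle:
  assumes "group G" "s \<in> carrier G" "conj_choice G s g" "h \<in> carrier G" "t \<in> conj_class G s"
  shows "yd_target G h t \<in> conj_class G s"
    and "yd_cocycle G g h t \<in> centralizer G s"
    and "h \<otimes>\<^bsub>G\<^esub> g t = g (yd_target G h t) \<otimes>\<^bsub>G\<^esub> yd_cocycle G g h t"
    and "u \<in> conj_class G s \<Longrightarrow> \<gamma> \<in> centralizer G s \<Longrightarrow> h \<otimes>\<^bsub>G\<^esub> g t = g u \<otimes>\<^bsub>G\<^esub> \<gamma> \<Longrightarrow>
      u = yd_target G h t \<and> \<gamma> = yd_cocycle G g h t"
proof -
  interpret group G by fact
  let ?u = "yd_target G h t" and ?c = "yd_cocycle G g h t"
  have gT: "g v \<in> carrier G" "g v \<otimes>\<^bsub>G\<^esub> s \<otimes>\<^bsub>G\<^esub> inv\<^bsub>G\<^esub> (g v) = v"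
    if "v \<in> conj_class G s" for v
    using assms(3) that by (auto simp: conj_choice_def)
  have gs: "g v \<otimes>\<^bsub>G\<^esub> s = v \<otimes>\<^bsub>G\<^esub> g v" "v \<in> carrier G"
    if "v \<in> conj_class G s" for v
    using gT[OF that] assms(2) by (metis inv_closed inv_solve_right m_closed)+
  obtain x where x: "x \<in> carrier G" "t = x \<otimes>\<^bsub>G\<^esub> s \<otimes>\<^bsub>G\<^esub> inv\<^bsub>G\<^esub> x"
    using assms(5) by (auto simp: conj_class_def)
  have "?u = (h \<otimes>\<^bsub>G\<^esub> x) \<otimes>\<^bsub>G\<^esub> s \<otimes>\<^bsub>G\<^esub> inv\<^bsub>G\<^esub> (h \<otimes>\<^bsub>G\<^esub> x)"
    unfolding yd_target_def x(2) using x(1) assms(2,4) by (simp add: m_assoc inv_mult_group)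
  then show u: "?u \<in> conj_class G s"
    unfolding conj_class_def using x(1) assms(4) by blast
  note t = assms(5)
  note cl = gT(1)[OF u] gT(1)[OF t] gs(2)[OF u] gs(2)[OF t] assms(2,4)
  show eq: "h \<otimes>\<^bsub>G\<^esub> g t = g ?u \<otimes>\<^bsub>G\<^esub> ?c"
    unfolding yd_cocycle_def using cl by (simp add: m_assoc inv_solve_left[symmetric])
  have c: "?c \<in> carrier G" unfolding yd_cocycle_def using cl by simp
  have uh: "?u \<otimes>\<^bsub>G\<^esub> h = h \<otimes>\<^bsub>G\<^esub> t"
    unfolding yd_target_def using cl by (simp add: m_assoc)
  have "g ?u \<otimes>\<^bsub>G\<^esub> (?c \<otimes>\<^bsub>G\<^esub> s) = h \<otimes>\<^bsub>G\<^esub> (g t \<otimes>\<^bsub>G\<^esub> s)"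
    using eq c cl by (metis m_assoc)
  also have "\<dots> = ?u \<otimes>\<^bsub>G\<^esub> (h \<otimes>\<^bsub>G\<^esub> g t)"
    using gs(1)[OF t] uh cl by (metis m_assoc)
  also have "\<dots> = (?u \<otimes>\<^bsub>G\<^esub> g ?u) \<otimes>\<^bsub>G\<^esub> ?c"
    using eq c cl by (metis m_assoc)
  also have "\<dots> = g ?u \<otimes>\<^bsub>G\<^esub> (s \<otimes>\<^bsub>G\<^esub> ?c)"
    using gs(1)[OF u] c cl by (metis m_assoc)
  finally show "?c \<in> centralizer G s"
    using c cl by (simp add: centralizer_def)
  show "u = ?u \<and> \<gamma> = ?c"
    if u': "u \<in> conj_class G s" and g': "\<gamma> \<in> centralizer G s"
      and e: "h \<otimes>\<^bsub>G\<^esub> g t = g u \<otimes>\<^bsub>G\<^esub> \<gamma>"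
  proof -
    have gc: "\<gamma> \<in> carrier G" "\<gamma> \<otimes>\<^bsub>G\<^esub> s = s \<otimes>\<^bsub>G\<^esub> \<gamma>" using g' by (auto simp: centralizer_def)
    note cl' = cl gT(1)[OF u'] gs(2)[OF u'] gc(1)
    have "u \<otimes>\<^bsub>G\<^esub> (h \<otimes>\<^bsub>G\<^esub> g t) = g u \<otimes>\<^bsub>G\<^esub> (\<gamma> \<otimes>\<^bsub>G\<^esub> s)"
      unfolding e gc(2) using gs(1)[OF u'] cl' by (metis m_assoc)
    also have "\<dots> = h \<otimes>\<^bsub>G\<^esub> g t \<otimes>\<^bsub>G\<^esub> s" unfolding e using cl' by (simp add: m_assoc)
    also have "\<dots> = (h \<otimes>\<^bsub>G\<^esub> t) \<otimes>\<^bsub>G\<^esub> g t" using gs(1)[OF t] cl' by (metis m_assoc)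
    finally have "(u \<otimes>\<^bsub>G\<^esub> h) \<otimes>\<^bsub>G\<^esub> g t = (h \<otimes>\<^bsub>G\<^esub> t) \<otimes>\<^bsub>G\<^esub> g t" using cl' by (simp add: m_assoc)
    then have "u \<otimes>\<^bsub>G\<^esub> h = h \<otimes>\<^bsub>G\<^esub> t" using cl' by simp
    then have "u = ?u" using uh cl' by (metis right_cancel)
    then show ?thesis using e eq cl' c by (metis Units_eq Units_l_cancel)
  qed
qed

text \<open>The action \<open>h \<cdot> (g\<^sub>t \<otimes> v) = g\<^sub>u \<otimes> \<gamma> v\<close>.\<close>

definition yd_action ::
    "('g, 'm) monoid_scheme \<Rightarrow> ('g \<Rightarrow> complex^'n^'n) \<Rightarrow> ('g \<Rightarrow> 'g) \<Rightarrow> 'g \<Rightarrow> 'g \<Rightarrow> complex^'n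
      \<Rightarrow> 'g \<Rightarrow> complex^'n" where
  "yd_action G \<rho> g h t v = yd_elem (yd_target G h t) (\<rho> (yd_cocycle G g h t) *v v)"

text \<open>
  The pair \<open>(t, k)\<close> indexes the basis element \<open>g\<^sub>t \<otimes> e\<^sub>k\<close>. The braiding is
  \<open>c ((g\<^sub>t \<otimes> e\<^sub>k) \<otimes> (g\<^sub>u \<otimes> e\<^sub>l)) = t \<cdot> (g\<^sub>u \<otimes> e\<^sub>l) \<otimes> (g\<^sub>t \<otimes> e\<^sub>k)\<close>.
\<close>

definition yd_basis :: "('g, 'm) monoid_scheme \<Rightarrow> 'g \<Rightarrow> ('g \<times> 'n::finite) set" where
  "yd_basis G s = conj_class G s \<times> UNIV"

definition yd_braiding ::
    "('g, 'm) monoid_scheme \<Rightarrow> ('g \<Rightarrow> complex^'n^'n) \<Rightarrow> ('g \<Rightarrow> 'g) \<Rightarrow> ('g \<times> 'n) braiding" where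
  "yd_braiding G \<rho> g = (\<lambda>((t, k), (u, l)) ((t', k'), b).
     if b = (t, k) then yd_action G \<rho> g t u (axis l 1) t' $ k' else 0)"

end

theory Submission
  imports Defs
begin

text \<open>
  Let \<open>q = q\<^sub>s\<^sub>s\<close>. As \<open>s\<^sup>j\<close> is conjugate to \<open>s\<close>, so is \<open>s\<close> raised to any power of \<open>j\<close>. These
  elements \<open>t\<close> commute, hence for a fixed vector \<open>v\<close> the \<open>g\<^sub>t \<otimes> v\<close> span a braided subspace of diagonal
  type whose matrix entries are powers of \<open>q\<close>, and quantum symmetrizers restrict to it. If
  \<open>q = 1\<close>, the powers of a single letter survive. If \<open>q \<noteq> 1, -1\<close>, then two of \<open>s\<close>, \<open>s\<^sup>j\<close>,
  \<open>s^(j^2)\<close>, or all three, span a braiding with \<open>q\<^sub>t\<^sub>t = q\<close> and \<open>q\<^sub>t\<^sub>u q\<^sub>u\<^sub>t = q\<^sup>-\<^sup>h\<close> for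
  \<open>t \<noteq> u\<close>, where \<open>0 < h < ord q\<close> and \<open>h\<close> times (number of letters minus 1) is at least 2.

  Such a Nichols algebra is infinite-dimensional: let \<open>\<beta>\<close> be a degree of maximal size in which it is
  nonzero. For a letter \<open>d\<close>, the degrees of the kernel of the skew derivation along \<open>d\<close> are stable
  under the reflection at \<open>d\<close>, and by maximality the pairing of \<open>\<beta>\<close> with the coroot of \<open>d\<close> is
  positive. Summing over \<open>d\<close> contradicts that the column sums of the Cartan matrix are not positive.

  So \<open>q = -1\<close>, and the order of \<open>s\<close> is even because \<open>q\<close> to this order is 1.
\<close>

section \<open>Diagonal braidings\<close>

text \<open>Around a fixed letter \<open>d\<close> the argument is explicit representation theory of
  U_q(sl_2). For every letter j other than \<open>d\<close> the pairs (j, 0), ..., (j, h) carry the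
  simple module of dimension h + 1, and words of pairs carry the tensor products. They model the
  kernel K of the right skew derivation along \<open>d\<close>, and the Nichols algebra is K times
  the powers of x_d. The obstacle is the reflection of K: words of pairs satisfy linear relations in
  K that are not known explicitly. They are therefore treated as the radical of a pairing with
  ordinary words, and what has to be shown is that this radical is stable under \<open>flip\<close>.
  This is why the operators act on functionals and why linear functionals \<open>\<Lambda>\<close>
  replace elements. Maximality of \<beta> enters twice. Write \<beta> as a degree \<gamma> of K plus
  k times d. Both \<gamma> and its reflection remain degrees of nonzero elements after adding h
  times d, so neither result exceeds \<beta> in size. Adding these two estimates produces the
  pairing of \<beta> with the coroot, with k absorbed.\<close>

text \<open>
  Functions on words form the quantum shuffle algebra, in which left multiplication by the letter
  \<open>i\<close> inserts \<open>i\<close> at all positions. The left skew derivation along a letter \<open>x\<close> sends \<open>\<phi>\<close> to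
  \<open>\<lambda>w. \<phi> (x # w)\<close>, the right one sends it to \<open>\<lambda>w. \<phi> (w @ [x])\<close>. The Nichols algebra is the
  subalgebra generated by the letters, that is, the span of the functions \<open>diagonal_word Q r\<close>.
\<close>

fun insert_diagonal :: "('b \<Rightarrow> 'b \<Rightarrow> complex) \<Rightarrow> 'b \<Rightarrow> 'b tensor \<Rightarrow> 'b tensor" where
  "insert_diagonal Q i \<phi> [] = 0"
| "insert_diagonal Q i \<phi> (x # w)
    = (if x = i then \<phi> w else 0) + Q x i * insert_diagonal Q i (\<lambda>z. \<phi> (x # z)) w"

definition diagonal_word :: "('b \<Rightarrow> 'b \<Rightarrow> complex) \<Rightarrow> 'b list \<Rightarrow> 'b tensor" where
  "diagonal_word Q r = foldr (insert_diagonal Q) r (\<lambda>w. if w = [] then 1 else 0)"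

lemma diagonal_word_simps [simp]:
  "diagonal_word Q [] = (\<lambda>w. if w = [] then 1 else 0)"
  "diagonal_word Q (i # r) = insert_diagonal Q i (diagonal_word Q r)"
  by (simp_all add: diagonal_word_def)

lemma insert_diagonal_linear:
  "insert_diagonal Q i (\<lambda>w. a * \<phi> w + b * \<psi> w) w = a * insert_diagonal Q i \<phi> w + b * insert_diagonal Q i \<psi> w"
  by (induction w arbitrary: \<phi> \<psi>) (simp_all, simp_all add: algebra_simps)

lemma insert_diagonal_scale: "insert_diagonal Q i (\<lambda>w. a * \<phi> w) w = a * insert_diagonal Q i \<phi> w"
  using insert_diagonal_linear[of Q i a \<phi> 0 \<phi> w] by simp

lemma insert_diagonal_cong:
  "(\<And>v. Suc (length v) = length w \<Longrightarrow> \<phi> v = \<psi> v) \<Longrightarrow> insert_diagonal Q i \<phi> w = insert_diagonal Q i \<psi> w"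
proof (induction w arbitrary: \<phi> \<psi>)
  case (Cons x w)
  have "insert_diagonal Q i (\<lambda>z. \<phi> (x # z)) w = insert_diagonal Q i (\<lambda>z. \<psi> (x # z)) w"
    by (rule Cons.IH) (simp add: Cons.prems)
  then show ?case using Cons.prems[of w] by simp
qed simp

lemmas insert_diagonal_add = insert_diagonal_linear[of _ _ 1 _ 1, simplified]
  and insert_diagonal_zero = insert_diagonal_linear[of _ _ 0 _ 0, simplified]

lemma insert_diagonal_nonzero:
  "insert_diagonal Q i \<phi> w \<noteq> 0 \<Longrightarrow> \<exists>u v. w = u @ i # v \<and> \<phi> (u @ v) \<noteq> 0"
proof (induction w arbitrary: \<phi>)
  case (Cons x w)
  show ?case
  proof (cases "x = i \<and> \<phi> w \<noteq> 0")
    case False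
    then have "insert_diagonal Q i (\<lambda>z. \<phi> (x # z)) w \<noteq> 0" using Cons.prems by (auto split: if_splits)
    from Cons.IH[OF this] show ?thesis by (metis append_Cons)
  qed (metis append_Nil)
qed simp

definition word_weight :: "('b \<Rightarrow> 'b \<Rightarrow> complex) \<Rightarrow> 'b \<Rightarrow> 'b list \<Rightarrow> complex" where
  "word_weight \<sigma> x w = (\<Prod>y\<leftarrow>w. \<sigma> x y)"

text \<open>A weight is multiplicative over the letters, and insertion adds the letter
  \<open>i\<close>; its factor \<open>\<sigma> x i\<close> is kept on the left to avoid a
  division.\<close>

lemma insert_diagonal_weight:
  "insert_diagonal Q i (\<lambda>z. word_weight \<sigma> x z * \<phi> z) w * \<sigma> x i = word_weight \<sigma> x w * insert_diagonal Q i \<phi> w"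
proof (induction w arbitrary: \<phi>)
  case (Cons y w)
  let ?I = "insert_diagonal Q i"
  have *: "word_weight \<sigma> x (y # z) = \<sigma> x y * word_weight \<sigma> x z" for z
    by (simp add: word_weight_def)
  have "?I (\<lambda>z. word_weight \<sigma> x (y # z) * \<phi> (y # z)) w * \<sigma> x i
      = \<sigma> x y * (word_weight \<sigma> x w * ?I (\<lambda>z. \<phi> (y # z)) w)"
    by (simp add: * mult.assoc insert_diagonal_scale flip: Cons)
  then have "Q y i * ?I (\<lambda>z. word_weight \<sigma> x (y # z) * \<phi> (y # z)) w * \<sigma> x i
      = Q y i * (\<sigma> x y * (word_weight \<sigma> x w * ?I (\<lambda>z. \<phi> (y # z)) w))"
    by (simp only: mult.assoc)
  then have "?I (\<lambda>z. word_weight \<sigma> x z * \<phi> z) (y # w) * \<sigma> x i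
      = (if y = i then word_weight \<sigma> x w * \<phi> w else 0) * \<sigma> x i
        + Q y i * (\<sigma> x y * (word_weight \<sigma> x w * ?I (\<lambda>z. \<phi> (y # z)) w))"
    by (simp only: insert_diagonal.simps distrib_right)
  also have "\<dots> = word_weight \<sigma> x (y # w) * ?I \<phi> (y # w)"
    by (simp add: * distrib_left mult_ac)
  finally show ?case .
qed simp

text \<open>The product of \<open>\<sigma>\<close> over all pairs of positions in their order: the
  factor by which each basis word is rescaled.\<close>

primrec twist :: "('b \<Rightarrow> 'b \<Rightarrow> complex) \<Rightarrow> 'b list \<Rightarrow> complex" where
  "twist \<sigma> [] = 1"
| "twist \<sigma> (x # w) = word_weight \<sigma> x w * twist \<sigma> w"

text \<open>Inserting \<open>i\<close> multiplies the twist by \<open>\<sigma> x i\<close> for each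
  \<open>x\<close> in front of it and by \<open>\<sigma> i y\<close> for each \<open>y\<close>
  behind. The assumption trades \<open>Q x i * \<sigma> x i\<close> for
  \<open>Q' x i * \<sigma> i x\<close> in front, and then all letters together contribute
  \<open>word_weight \<sigma> i\<close>.\<close>

lemma insert_diagonal_twist:
  assumes "\<And>x. Q' x i * \<sigma> i x = Q x i * \<sigma> x i"
  shows "insert_diagonal Q i \<phi> w * twist \<sigma> w
    = insert_diagonal Q' i (\<lambda>z. \<phi> z * twist \<sigma> z * word_weight \<sigma> i z) w"
proof (induction w arbitrary: \<phi>)
  case (Cons x w)
  let ?I = "insert_diagonal Q' i" and ?\<psi> = "\<lambda>z. \<phi> (x # z) * twist \<sigma> z * word_weight \<sigma> i z"
  have "?I (\<lambda>z. \<phi> (x # z) * twist \<sigma> (x # z) * word_weight \<sigma> i (x # z)) w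
     = \<sigma> i x * ?I (\<lambda>z. word_weight \<sigma> x z * ?\<psi> z) w"
    unfolding insert_diagonal_scale[symmetric] by (simp add: word_weight_def mult_ac)
  then have "Q' x i * ?I (\<lambda>z. \<phi> (x # z) * twist \<sigma> (x # z) * word_weight \<sigma> i (x # z)) w
     = Q x i * (?I (\<lambda>z. word_weight \<sigma> x z * ?\<psi> z) w * \<sigma> x i)"
    using assms[of x] by (simp add: mult.assoc[symmetric])
  also have "\<dots> = Q x i * (word_weight \<sigma> x w * ?I ?\<psi> w)"
    by (rule arg_cong[where f = "(*) (Q x i)"]) (rule insert_diagonal_weight)
  also have "\<dots> = Q x i * insert_diagonal Q i (\<lambda>z. \<phi> (x # z)) w * twist \<sigma> (x # w)"
    unfolding Cons[symmetric] by (simp add: mult_ac)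
  finally show ?case by (simp add: distrib_right)
qed simp

lemma diagonal_word_mset: "diagonal_word Q r w \<noteq> 0 \<Longrightarrow> mset w = mset r"
proof (induction r arbitrary: w)
  case (Cons i r)
  obtain u v where "w = u @ i # v" "diagonal_word Q r (u @ v) \<noteq> 0"
    using insert_diagonal_nonzero[of Q i "diagonal_word Q r" w] Cons.prems by auto
  with Cons.IH show ?case by fastforce
qed (simp split: if_splits)

lemma word_weight_mset: "mset w = mset r \<Longrightarrow> word_weight \<sigma> x w = word_weight \<sigma> x r"
  unfolding word_weight_def by (metis mset_map prod_mset_prod_list)

text \<open>
  Twist equivalence: only the diagonal entries and the products \<open>Q x y * Q y x\<close> matter for the
  vanishing of these functions.
\<close>

lemma diagonal_word_twist:
  assumes "\<And>x i. Q' x i * \<sigma> i x = Q x i * \<sigma> x i"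
  shows "diagonal_word Q r w * twist \<sigma> w = diagonal_word Q' r w * twist \<sigma> r"
proof (induction r arbitrary: w)
  case (Cons i r)
  have eq: "diagonal_word Q r z * twist \<sigma> z * word_weight \<sigma> i z = (twist \<sigma> r * word_weight \<sigma> i r) * diagonal_word Q' r z" for z
    using Cons[of z] diagonal_word_mset[of Q' r z] word_weight_mset[of z r \<sigma> i]
    by (cases "diagonal_word Q' r z = 0") (auto simp: mult_ac)
  have "diagonal_word Q (i # r) w * twist \<sigma> w
      = insert_diagonal Q' i (\<lambda>z. diagonal_word Q r z * twist \<sigma> z * word_weight \<sigma> i z) w"
    unfolding diagonal_word_simps by (rule insert_diagonal_twist) (rule assms)
  also have "\<dots> = (twist \<sigma> r * word_weight \<sigma> i r) * insert_diagonal Q' i (diagonal_word Q' r) w"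
    unfolding eq by (rule insert_diagonal_scale)
  finally show ?case by (simp add: mult_ac)
qed simp

section \<open>Symmetric Cartan type with constant off-diagonal entries\<close>

type_synonym 'a ad_word = "('a \<times> nat) list"

text \<open>\<open>p\<close> is a square root of q, so that a symmetric braiding matrix can be
  written with integral exponents. Since q^m differs from 1 for 0 < m \<le> h, the quantum integers
  [1], ..., [h] are invertible, while [h + 1] may vanish.\<close>

locale symmetric_cartan_braiding =
  fixes p :: complex and h :: nat
  assumes p_nonzero: "p \<noteq> 0"
    and h_pos: "0 < h"
    and p_power: "\<And>m. 0 < m \<Longrightarrow> m \<le> h \<Longrightarrow> p ^ (2 * m) \<noteq> 1"
begin

text \<open>
  The braiding matrix is \<open>p powi cartan x y\<close>: with \<open>q = p\<^sup>2\<close> it has diagonal entries \<open>q\<close>, and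
  \<open>q\<^sub>x\<^sub>y q\<^sub>y\<^sub>x = q\<^sup>-\<^sup>h\<close> for \<open>x \<noteq> y\<close>. For a distinguished letter \<open>d\<close>, the pair \<open>(j, i)\<close> with
  \<open>j \<noteq> d\<close> stands for \<open>(ad x\<^sub>d)\<^sup>i(x\<^sub>j)\<close> divided by \<open>i\<close>-th quantum factorials; it vanishes for
  \<open>i > h\<close>. Products of these elements are represented by words of pairs.
\<close>

definition qint :: "int \<Rightarrow> complex" where
  "qint m = (p powi m - p powi (- m)) / (p - inverse p)"

definition cartan :: "'a \<Rightarrow> 'a \<Rightarrow> int" where
  "cartan x y = (if x = y then 2 else - int h)"

definition weight :: "'a \<Rightarrow> 'a list \<Rightarrow> int" where
  "weight x w = (\<Sum>y\<leftarrow>w. cartan x y)"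

lemma weight_simps [simp]:
  "weight x [] = 0" "weight x (y # w) = cartan x y + weight x w"
  "weight x (u @ w) = weight x u + weight x w"
  by (auto simp: weight_def)

lemma cartan_refl [simp]: "cartan x x = 2"
  by (simp add: cartan_def)

lemma cartan_neq: "x \<noteq> y \<Longrightarrow> cartan x y = - int h"
  by (simp add: cartan_def)

lemma cartan_commute: "cartan x y = cartan y x"
  by (simp add: cartan_def)

lemma p_diff: "p - inverse p \<noteq> 0"
proof
  assume "p - inverse p = 0"
  then have "p * p = 1" using p_nonzero by (simp add: field_simps)
  then show False using p_power[of 1] h_pos by (simp add: power2_eq_square)
qed

lemma powi_add: "p powi (a + b) = p powi a * p powi b"
  using p_nonzero by (simp add: power_int_add)

lemma powi_eq_one: "p powi a = p powi (- a) \<longleftrightarrow> p powi (2 * a) = 1"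
proof -
  have "p powi (2 * a) = p powi a * p powi a" by (simp flip: powi_add)
  then show ?thesis using p_nonzero
    by (auto simp: power_int_minus field_simps)
qed

lemma qint_0 [simp]: "qint 0 = 0" by (simp add: qint_def)

lemma qint_minus: "qint (- m) = - qint m"
  by (simp add: qint_def minus_divide_left)

lemma qint_nonzero:
  assumes "0 < m" "m \<le> int h" shows "qint m \<noteq> 0"
proof
  assume "qint m = 0"
  then have "p powi (2 * m) = 1" using p_diff by (simp add: qint_def powi_eq_one)
  moreover have "2 * m = int (2 * nat m)" using assms(1) by simp
  ultimately have "p ^ (2 * nat m) = 1" by (metis power_int_of_nat)
  then show False using p_power[of "nat m"] assms by simp
qed

lemma powi_uminus_add: "p powi (- (a + b)) = p powi (- a) * p powi (- b)"
  by (simp flip: powi_add)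

lemma qint_add: "qint (a + b) = p powi a * qint b + p powi (- b) * qint a"
proof -
  have "p powi a * qint b + p powi (- b) * qint a
    = (p powi a * (p powi b - p powi (- b)) + p powi (- b) * (p powi a - p powi (- a))) / (p - inverse p)"
    by (simp only: qint_def add_divide_distrib times_divide_eq_right)
  then show ?thesis
    unfolding qint_def[of "a + b"] powi_add powi_uminus_add by (simp add: algebra_simps)
qed

text \<open>For a = i and b = h - i this is [i + 1] [h - i] - [i] [h - i + 1] = [h - 2 i], the
  commutator of E and F on the simple module of dimension h + 1.\<close>

lemma qint_mult_diff: "qint (a + 1) * qint b - qint a * qint (b + 1) = qint (b - a)"
proof -
  define P Q where "P = p powi a" and "Q = p powi b"
  have nz: "P \<noteq> 0" "Q \<noteq> 0" using p_nonzero by (auto simp: P_def Q_def)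
  have e: "p powi (a+1) = P * p" "p powi (b+1) = Q * p" "p powi (-(a+1)) = inverse P * inverse p"
    "p powi (-(b+1)) = inverse Q * inverse p" "p powi (-a) = inverse P" "p powi (-b) = inverse Q"
    "p powi (b - a) = Q * inverse P" "p powi (-(b - a)) = P * inverse Q"
    using p_nonzero by (simp_all add: P_def Q_def powi_add power_int_minus power_int_diff field_simps)
  have d: "p - inverse p \<noteq> 0" by (rule p_diff)
  have "((P * p - inverse P * inverse p) * (Q - inverse Q)
      - (P - inverse P) * (Q * p - inverse Q * inverse p))
      = (Q * inverse P - P * inverse Q) * (p - inverse p)"
    using p_nonzero nz by (simp add: field_simps)
  then show ?thesis
    unfolding qint_def e P_def[symmetric] Q_def[symmetric]
    using nonzero_divide_eq_eq[OF d] nonzero_mult_div_cancel_right[OF d]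
    by (metis (no_types, lifting) diff_divide_distrib divide_divide_eq_left times_divide_times_eq)
qed


text \<open>Every exponent that a word of pairs contributes is a sum of terms affine in the heights,
  so a single shift lemma per operator covers all of them.\<close>

definition affine_weight :: "int \<Rightarrow> ('a \<Rightarrow> int) \<Rightarrow> 'a ad_word \<Rightarrow> int" where
  "affine_weight d k Y = (\<Sum>(j, i)\<leftarrow>Y. d * int i + k j)"

lemma affine_weight_simps [simp]:
  "affine_weight d k [] = 0" "affine_weight d k ((j, i) # Y) = d * int i + k j + affine_weight d k Y"
  "affine_weight d k (Y @ Z) = affine_weight d k Y + affine_weight d k Z"
  by (auto simp: affine_weight_def)

abbreviation wt :: "'a ad_word \<Rightarrow> int" where
  "wt \<equiv> affine_weight 2 (\<lambda>_. - int h)"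

text \<open>
  The operators are transposed: they act on functionals on words of pairs. Up to normalization,
  \<open>raise\<close> belongs to \<open>ad x\<^sub>d\<close>, \<open>lower\<close> to the left skew derivation along \<open>d\<close>,
  \<open>remove_bottom x\<close> to the left skew derivation along \<open>x \<noteq> d\<close>, and \<open>remove_top x\<close> to
  the right skew derivation along \<open>(ad x\<^sub>d)\<^sup>h\<close> of the letter \<open>x\<close>.
\<close>

fun lower :: "('a ad_word \<Rightarrow> complex) \<Rightarrow> 'a ad_word \<Rightarrow> complex" where
  "lower g [] = 0"
| "lower g ((j, i) # Y) = (if i = 0 then 0 else qint (int h + 1 - int i) * g ((j, i - 1) # Y))
     + p powi (2 * int i - int h) * lower (\<lambda>Z. g ((j, i) # Z)) Y"

fun raise :: "('a ad_word \<Rightarrow> complex) \<Rightarrow> 'a ad_word \<Rightarrow> complex" where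
  "raise g [] = 0"
| "raise g ((j, i) # Y) = qint (int i + 1) * p powi (- wt Y) * g ((j, Suc i) # Y)
     + raise (\<lambda>Z. g ((j, i) # Z)) Y"

fun remove_bottom :: "'a \<Rightarrow> ('a ad_word \<Rightarrow> complex) \<Rightarrow> 'a ad_word \<Rightarrow> complex" where
  "remove_bottom x g [] = 0"
| "remove_bottom x g ((j, i) # Y) = (if j = x \<and> i = 0 then g Y else 0)
     + p powi (cartan x j - int h * int i) * remove_bottom x (\<lambda>Z. g ((j, i) # Z)) Y"

fun remove_top :: "'a \<Rightarrow> ('a ad_word \<Rightarrow> complex) \<Rightarrow> 'a ad_word \<Rightarrow> complex" where
  "remove_top x g [] = 0"
| "remove_top x g ((j, i) # Y) =
     (if j = x \<and> i = h then p powi affine_weight (int h) (\<lambda>y. cartan x y - int h * int h) Y * g Y else 0)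
     + remove_top x (\<lambda>Z. g ((j, i) # Z)) Y"

lemma lower_linear: "lower (\<lambda>Z. a * g Z + b * f Z) Y = a * lower g Y + b * lower f Y"
  by (induction g Y arbitrary: f rule: lower.induct) (simp_all, simp_all add: algebra_simps)

lemma raise_linear: "raise (\<lambda>Z. a * g Z + b * f Z) Y = a * raise g Y + b * raise f Y"
  by (induction g Y arbitrary: f rule: raise.induct) (simp_all, simp_all add: algebra_simps)

lemma remove_bottom_linear:
  "remove_bottom x (\<lambda>Z. a * g Z + b * f Z) Y = a * remove_bottom x g Y + b * remove_bottom x f Y"
  by (induction x g Y arbitrary: f rule: remove_bottom.induct) (simp_all, simp_all add: algebra_simps)

lemma remove_top_linear:
  "remove_top x (\<lambda>Z. a * g Z + b * f Z) Y = a * remove_top x g Y + b * remove_top x f Y"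
  by (induction x g Y arbitrary: f rule: remove_top.induct) (simp_all, simp_all add: algebra_simps)

lemmas lower_add = lower_linear[of 1 _ 1, simplified]
  and remove_bottom_add = remove_bottom_linear[of _ 1 _ 1, simplified]

lemmas lower_scale = lower_linear[of _ _ 0, simplified]
  and remove_bottom_scale = remove_bottom_linear[of _ _ _ 0, simplified]

lemmas lower_zero = lower_linear[of 0 _ 0, simplified]
  and raise_zero = raise_linear[of 0 _ 0, simplified]
  and remove_bottom_zero = remove_bottom_linear[of _ 0 _ 0, simplified]
  and remove_top_zero = remove_top_linear[of _ 0 _ 0, simplified]

lemma lower_shift:
  "lower (\<lambda>Z. p powi (affine_weight d k Z + c) * g Z) Y = p powi (affine_weight d k Y - d + c) * lower g Y"
proof (induction g Y arbitrary: c rule: lower.induct)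
  case (2 g j i Y)
  have "lower (\<lambda>Z. p powi (affine_weight d k ((j, i) # Z) + c) * g ((j, i) # Z)) Y
     = p powi (affine_weight d k ((j, i) # Y) - d + c) * lower (\<lambda>Z. g ((j, i) # Z)) Y"
    using 2[of "d * int i + k j + c"] by (simp add: algebra_simps)
  then show ?case
    by (cases i) (simp_all add: algebra_simps)
qed simp

lemma remove_bottom_shift:
  "remove_bottom x (\<lambda>Z. p powi (affine_weight d k Z + c) * g Z) Y
     = p powi (affine_weight d k Y - k x + c) * remove_bottom x g Y"
proof (induction x g Y arbitrary: c rule: remove_bottom.induct)
  case (2 x g j i Y)
  have "remove_bottom x (\<lambda>Z. p powi (affine_weight d k ((j, i) # Z) + c) * g ((j, i) # Z)) Y
     = p powi (affine_weight d k ((j, i) # Y) - k x + c) * remove_bottom x (\<lambda>Z. g ((j, i) # Z)) Y"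
    using 2[of "d * int i + k j + c"] by (simp add: algebra_simps)
  then show ?case
    by (auto simp add: algebra_simps)
qed simp


section \<open>Commutation relations between the operators on words of pairs\<close>

lemma affine_weight_uminus: "affine_weight (- d) (\<lambda>j. - k j) Y = - affine_weight d k Y"
  by (induction Y) auto

lemmas uminus_wt = affine_weight_uminus[of 2 "\<lambda>_. - int h", simplified]

text \<open>
  The relation between \<open>E\<close> and \<open>F\<close> in \<open>U\<^sub>q(sl\<^sub>2)\<close>, with \<open>wt Y\<close> the weight of \<open>Y\<close>.
\<close>

lemma raise_lower: "raise (lower g) Y = lower (raise g) Y - qint (wt Y) * g Y"
proof (induction g Y rule: raise.induct)
  case (2 g j i Y)
  let ?m = "2 * int i - int h" and ?W = "wt Y"
  define c where "c = (if i = 0 then 0 else qint (int h + 1 - int i))"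
  let ?g = "\<lambda>Z. g ((j, i) # Z)" and ?gs = "\<lambda>Z. g ((j, Suc i) # Z)" and ?gp = "\<lambda>Z. g ((j, i - 1) # Z)"
  have low: "lower f ((j, i) # Z) = c * f ((j, i - 1) # Z) + p powi ?m * lower (\<lambda>Z. f ((j, i) # Z)) Z"
    for f and Z :: "'a ad_word" by (simp add: c_def)
  have sh: "lower (\<lambda>Z. p powi (- wt Z) * f Z) Y = p powi (2 - ?W) * lower f Y"
    for f
    using lower_shift[of "-2" "\<lambda>_. int h" 0 f Y] by (simp add: uminus_wt)
  have cr: "c * raise g ((j, i - 1) # Y) = c * (qint (int i) * p powi (- ?W) * g ((j, i) # Y) + raise ?gp Y)"
    by (cases "i = 0") (simp_all add: c_def of_nat_diff)
  have L: "raise (lower g) ((j, i) # Y) = qint (int i + 1) * p powi (- ?W)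
      * (qint (int h - int i) * g ((j, i) # Y) + p powi (?m + 2) * lower ?gs Y)
      + (c * raise ?gp Y + p powi ?m * raise (lower ?g) Y)"
  proof -
    have "lower g ((j, Suc i) # Y) = qint (int h - int i) * g ((j, i) # Y) + p powi (?m + 2) * lower ?gs Y"
      by (simp add: algebra_simps)
    then show ?thesis by (simp only: raise.simps low raise_linear)
  qed
  have R: "lower (raise g) ((j, i) # Y) = c * (qint (int i) * p powi (- ?W) * g ((j, i) # Y) + raise ?gp Y)
      + p powi ?m * (qint (int i + 1) * (p powi (2 - ?W) * lower ?gs Y) + lower (raise ?g) Y)"
    by (simp only: low cr) (simp only: raise.simps lower_add lower_scale mult.assoc sh)
  have c: "c * qint (int i) = qint (int h + 1 - int i) * qint (int i)"
    by (simp add: c_def)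
  have d: "qint (int i + 1) * qint (int h - int i) - qint (int h + 1 - int i) * qint (int i) = - qint ?m"
    using qint_mult_diff[of "int i" "int h - int i"] qint_minus[of ?m] by (simp add: algebra_simps)
  have w: "qint (wt ((j, i) # Y)) = p powi (- ?W) * qint ?m + p powi ?m * qint ?W"
    using qint_add[of ?m ?W] by simp
  have s: "p powi (- ?W) * p powi (?m + 2) = p powi ?m * p powi (2 - ?W)"
    by (simp flip: powi_add add: algebra_simps)
  have key: "a * P * (f * G + M2 * L) + (c * R + M * (L' - w * G))
      = c * (b * P * G + R) + M * (a * (P2 * L) + L') - (P * m + M * w) * G"
    if "c * b = d * b" "a * f - d * b = - m" "P * M2 = M * P2"
    for a b c d f G L L' M M2 P P2 R m w :: complex
  proof -
    have "a * P * (f * G + M2 * L) + (c * R + M * (L' - w * G))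
      - (c * (b * P * G + R) + M * (a * (P2 * L) + L') - (P * m + M * w) * G)
      = P * G * (a * f - c * b + m) + a * L * (P * M2 - M * P2)"
      by (simp add: algebra_simps)
    then show ?thesis using that by simp
  qed
  show ?case unfolding L R w 2 by (rule key[OF c d s])
qed simp

text \<open>A raised pair has positive height, so it is never the removed one. The exponents agree:
  removing a bottom pair changes \<open>wt\<close> by \<open>h\<close>, and passing a pair that is
  one step higher costs another \<open>- h\<close>.\<close>

lemma raise_remove_bottom: "raise (remove_bottom x g) Y = remove_bottom x (raise g) Y"
proof (induction g Y rule: raise.induct)
  case (2 g j i Y)
  let ?e = "cartan x j - int h * int i" and ?W = "wt Y"
  define c :: complex where "c = (if j = x \<and> i = 0 then 1 else 0)"
  let ?g = "\<lambda>Z. g ((j, i) # Z)" and ?gs = "\<lambda>Z. g ((j, Suc i) # Z)"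
  have rem: "remove_bottom x f ((j, i) # Z) = c * f Z + p powi ?e * remove_bottom x (\<lambda>Z. f ((j, i) # Z)) Z"
    for f and Z :: "'a ad_word" by (simp add: c_def)
  have sh: "remove_bottom x (\<lambda>Z. p powi (- wt Z) * f Z) Y = p powi (- ?W - int h) * remove_bottom x f Y"
    for f
    using remove_bottom_shift[of x "-2" "\<lambda>_. int h" 0 f Y] by (simp add: uminus_wt algebra_simps)
  have L: "raise (remove_bottom x g) ((j, i) # Y) = qint (int i + 1) * p powi (- ?W)
      * (p powi (?e - int h) * remove_bottom x ?gs Y)
      + (c * raise g Y + p powi ?e * raise (remove_bottom x ?g) Y)"
  proof -
    have "remove_bottom x g ((j, Suc i) # Y) = p powi (?e - int h) * remove_bottom x ?gs Y"
      by (simp add: algebra_simps)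
    then show ?thesis by (simp only: raise.simps rem raise_linear)
  qed
  have R: "remove_bottom x (raise g) ((j, i) # Y) = c * raise g Y
      + p powi ?e * (qint (int i + 1) * (p powi (- ?W - int h) * remove_bottom x ?gs Y)
         + remove_bottom x (raise ?g) Y)"
    by (simp only: rem) (simp only: raise.simps remove_bottom_add remove_bottom_scale mult.assoc sh)
  have s: "p powi (- ?W) * p powi (?e - int h) = p powi ?e * p powi (- ?W - int h)"
    by (simp flip: powi_add add: algebra_simps)
  have key: "a * P * (E * L) + (c * R + M * L') = c * R + M * (a * (F * L) + L')"
    if "P * E = M * F" for a c E F L L' M P R :: complex
  proof -
    have "a * P * (E * L) + (c * R + M * L') - (c * R + M * (a * (F * L) + L')) = a * L * (P * E - M * F)"
      by (simp add: algebra_simps)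
    then show ?thesis using that by (simp only: right_minus_eq diff_self mult_zero_right)
  qed
  show ?case unfolding L R 2 by (rule key[OF s])
qed simp

text \<open>A pair that reaches height \<open>h\<close> by lowering comes from height
  \<open>h + 1\<close>, where the coefficient is \<open>qint 0\<close>; so a lowered pair is never
  the removed one.\<close>

lemma remove_top_lower: "remove_top x (lower g) Y = lower (remove_top x g) Y"
proof (induction g Y rule: lower.induct)
  case (2 g j i Y)
  let ?X = "affine_weight (int h) (\<lambda>y. cartan x y - int h * int h)" and ?m = "2 * int i - int h"
  define c where "c = (if i = 0 then 0 else qint (int h + 1 - int i))"
  define b :: complex where "b = (if j = x \<and> i = h then 1 else 0)"
  let ?g = "\<lambda>Z. g ((j, i) # Z)" and ?gp = "\<lambda>Z. g ((j, i - 1) # Z)"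
  have low: "lower f ((j, i) # Z) = c * f ((j, i - 1) # Z) + p powi ?m * lower (\<lambda>Z. f ((j, i) # Z)) Z"
    for f and Z :: "'a ad_word" by (simp add: c_def)
  have top: "remove_top x f ((j, i) # Z) = b * (p powi ?X Z * f Z) + remove_top x (\<lambda>Z. f ((j, i) # Z)) Z"
    for f and Z :: "'a ad_word" by (simp add: b_def)
  have ct: "c * remove_top x g ((j, i - 1) # Y) = c * remove_top x ?gp Y"
    by (auto simp: c_def)
  have sh: "lower (\<lambda>Z. p powi ?X Z * g Z) Y = p powi (?X Y - int h) * lower g Y"
    using lower_shift[of "int h" "\<lambda>y. cartan x y - int h * int h" 0 g Y] by simp
  have "remove_top x (lower g) ((j, i) # Y) = b * (p powi ?X Y * lower g Y)
     + (c * remove_top x ?gp Y + p powi ?m * remove_top x (lower ?g) Y)"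
    by (simp only: top low remove_top_linear)
  moreover have "lower (remove_top x g) ((j, i) # Y) = c * remove_top x ?gp Y
     + p powi ?m * (b * (p powi (?X Y - int h) * lower g Y) + lower (remove_top x ?g) Y)"
    by (simp only: low ct) (simp only: top lower_add lower_scale sh)
  moreover have "p powi ?m * (b * (p powi (?X Y - int h) * lower g Y)) = b * (p powi ?X Y * lower g Y)"
    by (simp add: b_def mult.assoc[symmetric] flip: powi_add)
  ultimately show ?case using 2 by (simp only: distrib_left ac_simps)
qed simp

lemma remove_top_remove_bottom: "remove_top x (remove_bottom y g) Y = remove_bottom y (remove_top x g) Y"
proof (induction g Y rule: lower.induct)
  case (2 g j i Y)
  let ?X = "affine_weight (int h) (\<lambda>y. cartan x y - int h * int h)" and ?e = "cartan y j - int h * int i"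
  define c :: complex where "c = (if j = y \<and> i = 0 then 1 else 0)"
  define b :: complex where "b = (if j = x \<and> i = h then 1 else 0)"
  let ?g = "\<lambda>Z. g ((j, i) # Z)"
  have rem: "remove_bottom y f ((j, i) # Z) = c * f Z + p powi ?e * remove_bottom y (\<lambda>Z. f ((j, i) # Z)) Z"
    for f and Z :: "'a ad_word" by (simp add: c_def)
  have top: "remove_top x f ((j, i) # Z) = b * (p powi ?X Z * f Z) + remove_top x (\<lambda>Z. f ((j, i) # Z)) Z"
    for f and Z :: "'a ad_word" by (simp add: b_def)
  have sh: "remove_bottom y (\<lambda>Z. p powi ?X Z * g Z) Y
      = p powi (?X Y - cartan x y + int h * int h) * remove_bottom y g Y"
    using remove_bottom_shift[of y "int h" "\<lambda>y. cartan x y - int h * int h" 0 g Y]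
    by (simp add: algebra_simps)
  have "remove_top x (remove_bottom y g) ((j, i) # Y) = b * (p powi ?X Y * remove_bottom y g Y)
     + (c * remove_top x g Y + p powi ?e * remove_top x (remove_bottom y ?g) Y)"
    by (simp only: top rem remove_top_linear)
  moreover have "remove_bottom y (remove_top x g) ((j, i) # Y) = c * remove_top x g Y
     + p powi ?e * (b * (p powi (?X Y - cartan x y + int h * int h) * remove_bottom y g Y)
        + remove_bottom y (remove_top x ?g) Y)"
    by (simp only: rem) (simp only: top remove_bottom_add remove_bottom_scale sh)
  moreover have "p powi ?e * (b * (p powi (?X Y - cartan x y + int h * int h) * remove_bottom y g Y))
      = b * (p powi ?X Y * remove_bottom y g Y)"
    by (simp add: b_def cartan_commute[of y] mult.assoc[symmetric] flip: powi_add)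
  ultimately show ?case using 2 by (simp only: distrib_left ac_simps)
qed simp


section \<open>Skew derivation rules on concatenations, and the reflection\<close>

lemma lower_append:
  "lower g (A @ B) = lower (\<lambda>Z. g (Z @ B)) A + p powi wt A * lower (\<lambda>Z. g (A @ Z)) B"
proof (induction g A rule: lower.induct)
  case (2 g j i A)
  have "p powi (2 * int i - int h) * (p powi wt A * X) = p powi wt ((j, i) # A) * X" for X
    by (simp add: mult.assoc[symmetric] add_diff_eq flip: powi_add)
  then show ?case by (simp only: append_Cons lower.simps 2 distrib_left add.assoc)
qed simp

lemma remove_bottom_append:
  "remove_bottom x g (A @ B) = remove_bottom x (\<lambda>Z. g (Z @ B)) A
     + p powi affine_weight (- int h) (cartan x) A * remove_bottom x (\<lambda>Z. g (A @ Z)) B"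
proof (induction x g A rule: remove_bottom.induct)
  case (2 x g j i A)
  have "p powi (cartan x j - int h * int i) * (p powi affine_weight (- int h) (cartan x) A * X)
    = p powi affine_weight (- int h) (cartan x) ((j, i) # A) * X" for X
    by (simp add: mult.assoc[symmetric] flip: powi_add)
  then show ?case by (simp only: append_Cons remove_bottom.simps 2 distrib_left add.assoc)
qed simp

definition height_bounded :: "'a ad_word \<Rightarrow> bool" where
  "height_bounded Y \<longleftrightarrow> (\<forall>y\<in>set Y. snd y \<le> h)"

text \<open>
  The reflection at \<open>d\<close>: it exchanges raising with lowering and top with bottom.
\<close>

definition flip :: "'a ad_word \<Rightarrow> 'a ad_word" where
  "flip Y = rev (map (\<lambda>(j, i). (j, h - i)) Y)"

text \<open>Beyond height \<open>h\<close> the truncated subtraction in \<open>flip\<close> is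
  meaningless; the value 0 there agrees with the vanishing of such words.\<close>

definition flipped :: "('a ad_word \<Rightarrow> complex) \<Rightarrow> 'a ad_word \<Rightarrow> complex" where
  "flipped g Y = (if height_bounded Y then g (flip Y) else 0)"

lemma height_bounded_simps [simp]: "height_bounded []" "height_bounded ((j, i) # Y) \<longleftrightarrow> i \<le> h \<and> height_bounded Y"
  by (auto simp: height_bounded_def)

lemma flip_simps [simp]: "flip [] = []" "flip ((j, i) # Y) = flip Y @ [(j, h - i)]"
  by (auto simp: flip_def)

lemma flipped_Cons:
  "flipped g ((j, i) # Y) = (if i \<le> h then flipped (\<lambda>Z. g (Z @ [(j, h - i)])) Y else 0)"
  by (simp add: flipped_def)

lemma affine_weight_flip:
  "height_bounded Y \<Longrightarrow> affine_weight d k (flip Y) = affine_weight (- d) (\<lambda>j. d * int h + k j) Y"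
proof (induction Y)
  case (Cons y Y)
  obtain j i where y: "y = (j, i)" by (cases y)
  have "int (h - i) = int h - int i" using Cons.prems by (simp add: y of_nat_diff)
  then show ?case using Cons by (simp add: y right_diff_distrib)
qed simp

text \<open>Replacing i by h - i turns the coefficient [h + 1 - i] of lowering into the coefficient
  [i + 1] of raising. The words are reversed because \<open>lower\<close> collects its powers of
  \<open>p\<close> from the pairs on the left and \<open>raise\<close> from those on the
  right.\<close>

lemma raise_flipped: "raise (flipped g) Y = flipped (lower g) Y"
proof (induction Y arbitrary: g)
  case (Cons y Y)
  obtain j i where y: "y = (j, i)" by (cases y)
  show ?case
  proof (cases "i \<le> h \<and> height_bounded Y")
    case True
    have w: "wt (flip Y) = - wt Y"
      using True by (simp add: affine_weight_flip uminus_wt)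
    show ?thesis using True Cons
      by (auto simp: y flipped_Cons) (auto simp: flipped_def lower_append w of_nat_diff algebra_simps)
  next
    case False
    then show ?thesis using Cons
      by (auto simp: y flipped_Cons raise_zero) (auto simp: flipped_def)
  qed
qed (simp add: flipped_def)

lemma remove_top_flipped: "remove_top x (flipped g) Y = flipped (remove_bottom x g) Y"
proof (induction Y arbitrary: g)
  case (Cons y Y)
  obtain j i where y: "y = (j, i)" by (cases y)
  show ?case
  proof (cases "i \<le> h \<and> height_bounded Y")
    case True
    have w: "affine_weight (- int h) (cartan x) (flip Y)
        = affine_weight (int h) (\<lambda>y. cartan x y - int h * int h) Y"
      using True by (simp add: affine_weight_flip algebra_simps)
    show ?thesis using True Cons
      by (auto simp: y flipped_Cons) (auto simp: flipped_def remove_bottom_append w of_nat_diff algebra_simps)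
  next
    case False
    then show ?thesis using Cons
      by (auto simp: y flipped_Cons remove_top_zero) (auto simp: flipped_def)
  qed
qed (simp add: flipped_def)

section \<open>The pairing with words and the skew commutator\<close>

text \<open>
  \<open>pairing d w Y\<close> is the value of the element \<open>Y\<close> of the quantum shuffle algebra at the word \<open>w\<close>.
\<close>

primrec pairing :: "'a \<Rightarrow> 'a list \<Rightarrow> 'a ad_word \<Rightarrow> complex" where
  "pairing d [] = (\<lambda>Y. if Y = [] then 1 else 0)"
| "pairing d (x # w) = (if x = d then lower (pairing d w) else remove_bottom x (pairing d w))"

lemma lower_nonzero:
  assumes "lower g Y \<noteq> 0"
  shows "\<exists>A j i B. Y = A @ (j, Suc i) # B \<and> g (A @ (j, i) # B) \<noteq> 0 \<and> i \<noteq> h"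
  using assms
proof (induction g Y rule: lower.induct)
  case (2 g j i Y)
  show ?case
  proof (cases "i = 0 \<or> i = Suc h \<or> g ((j, i - 1) # Y) = 0")
    case True
    then have "lower (\<lambda>Z. g ((j, i) # Z)) Y \<noteq> 0" using 2(2) by (auto split: if_splits)
    from 2(1)[OF this] show ?thesis by (metis append_Cons)
  next
    case False
    then have "(j, i) # Y = [] @ (j, Suc (i - 1)) # Y \<and> g ([] @ (j, i - 1) # Y) \<noteq> 0 \<and> i - 1 \<noteq> h"
      by auto
    then show ?thesis by blast
  qed
qed simp

lemma remove_bottom_nonzero:
  assumes "remove_bottom x g Y \<noteq> 0"
  shows "\<exists>A B. Y = A @ (x, 0) # B \<and> g (A @ B) \<noteq> 0"
  using assms
proof (induction x g Y rule: remove_bottom.induct)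
  case (2 x g j i Y)
  show ?case
  proof (cases "j = x \<and> i = 0 \<and> g Y \<noteq> 0")
    case False
    then have "remove_bottom x (\<lambda>Z. g ((j, i) # Z)) Y \<noteq> 0" using 2(2) by (auto split: if_splits)
    from 2(1)[OF this] show ?thesis by (metis append_Cons)
  next
    case True
    then have "(j, i) # Y = [] @ (x, 0) # Y \<and> g ([] @ Y) \<noteq> 0" by auto
    then show ?thesis by blast
  qed
qed simp

definition letter_degree :: "'a \<Rightarrow> 'a ad_word \<Rightarrow> 'a multiset" where
  "letter_degree d Y = (\<Sum>(j, i)\<leftarrow>Y. add_mset j (replicate_mset i d))"

lemma letter_degree_simps [simp]:
  "letter_degree d [] = {#}"
  "letter_degree d ((j, i) # Y) = add_mset j (replicate_mset i d) + letter_degree d Y"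
  "letter_degree d (Y @ Z) = letter_degree d Y + letter_degree d Z"
  by (auto simp: letter_degree_def)

text \<open>The bound on the heights is the quantum Serre relation: \<open>lower\<close> weighs the
  passage from height \<open>h + 1\<close> to \<open>h\<close> with \<open>qint 0\<close>.\<close>

lemma pairing_nonzero:
  assumes "pairing d w Y \<noteq> 0"
  shows "mset w = letter_degree d Y \<and> height_bounded Y \<and> d \<notin> fst ` set Y"
  using assms
proof (induction w arbitrary: Y)
  case (Cons x w)
  show ?case
  proof (cases "x = d")
    case True
    then obtain A j i B where Y: "Y = A @ (j, Suc i) # B" "pairing d w (A @ (j, i) # B) \<noteq> 0" "i \<noteq> h"
      using lower_nonzero[of "pairing d w" Y] Cons.prems by auto
    show ?thesis using Cons.IH[OF Y(2)] Y(1,3) True by (auto simp: height_bounded_def)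
  next
    case False
    then obtain A B where Y: "Y = A @ (x, 0) # B" "pairing d w (A @ B) \<noteq> 0"
      using remove_bottom_nonzero[of x "pairing d w" Y] Cons.prems by auto
    show ?thesis using Cons.IH[OF Y(2)] Y(1) False by (auto simp: height_bounded_def)
  qed
qed (auto split: if_splits)

lemma flipped_pairing_Cons:
  "flipped (pairing d (x # w)) = (if x = d then raise (flipped (pairing d w)) else remove_top x (flipped (pairing d w)))"
  by (simp add: fun_eq_iff raise_flipped remove_top_flipped)

text \<open>
  Up to normalization the skew commutator \<open>ad x\<^sub>d\<close>, as an operator on all functions on words.
\<close>

fun commutator_insert :: "'a \<Rightarrow> ('a list \<Rightarrow> complex) \<Rightarrow> 'a list \<Rightarrow> complex" where
  "commutator_insert d \<phi> [] = 0"
| "commutator_insert d \<phi> (x # w) = (if x = d then qint (- weight d w) * \<phi> w else 0) + commutator_insert d (\<lambda>z. \<phi> (x # z)) w"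

lemma lower_commutator: "commutator_insert d (\<lambda>z. lower (F z) Y) w = lower (\<lambda>Z. commutator_insert d (\<lambda>z. F z Z) w) Y"
  by (induction w arbitrary: F) (simp_all add: lower_zero lower_add lower_scale)

lemma remove_bottom_commutator:
  "commutator_insert d (\<lambda>z. remove_bottom x (F z) Y) w = remove_bottom x (\<lambda>Z. commutator_insert d (\<lambda>z. F z Z) w) Y"
  by (induction w arbitrary: F) (simp_all add: remove_bottom_zero remove_bottom_add remove_bottom_scale)

lemma weight_mset: "weight d w = 2 * int (count (mset w) d) - int h * (int (size (mset w)) - int (count (mset w) d))"
  by (induction w) (auto simp: cartan_def algebra_simps)

lemma wt_letter_degree:
  "d \<notin> fst ` set Y \<Longrightarrow> wt Y = 2 * int (count (letter_degree d Y) d) - int h * (int (size (letter_degree d Y)) - int (count (letter_degree d Y) d))"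
  by (induction Y) (auto simp: algebra_simps)

lemma pairing_weight: "pairing d w Y \<noteq> 0 \<Longrightarrow> weight d w = wt Y"
  using pairing_nonzero[of d w Y] by (metis weight_mset wt_letter_degree)

text \<open>Identifies two forms of ad x_d, insertion into the word \<open>w\<close> and raising in
  the word of pairs \<open>Y\<close>. For a leading letter \<open>d\<close>, the term inserted in
  front is exactly the defect \<open>qint (wt Y)\<close> of \<open>raise_lower\<close>, because
  \<open>w\<close> and \<open>Y\<close> have equal weight.\<close>

lemma raise_commutator: "commutator_insert d (\<lambda>z. pairing d z Y) w = raise (pairing d w) Y"
proof (induction w arbitrary: Y)
  case Nil
  then show ?case by (cases Y) (auto simp: raise_zero)
next
  case (Cons x w)
  have q: "qint (- weight d w) * pairing d w Y = - qint (wt Y) * pairing d w Y"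
    using pairing_weight[of d w Y] by (cases "pairing d w Y = 0") (auto simp: qint_minus)
  show ?case
    by (auto simp: lower_commutator remove_bottom_commutator Cons raise_lower raise_remove_bottom q)
qed

text \<open>Words of pairs lie in the kernel of the right skew derivation along \<open>d\<close>:
  the last letter is read first, and \<open>lower\<close> annihilates the functional concentrated at
  the empty word.\<close>

lemma pairing_snoc_self: "pairing d (w @ [d]) Y = 0"
proof (induction w arbitrary: Y)
  case Nil
  show ?case by (cases Y rule: lower.cases[of "(undefined, _)", simplified]) (auto simp: lower_zero)
next
  case (Cons x w)
  have "pairing d (w @ [d]) = (\<lambda>_. 0)" using Cons by blast
  then show ?case by (simp add: lower_zero remove_bottom_zero)
qed

lemma pairing_replicate:
  assumes "j \<noteq> d"
  shows "\<exists>c. \<forall>Y. pairing d (replicate t d @ [j]) Y = (if Y = [(j, t)] then c else 0)"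
proof (induction t)
  case 0
  have "remove_bottom j (pairing d []) Y = (if Y = [(j, 0)] then 1 else 0)" for Y
    by (cases Y) (auto simp: remove_bottom_zero split: if_splits)
  then show ?case using assms by auto
next
  case (Suc t)
  then obtain c where c: "\<And>Y. pairing d (replicate t d @ [j]) Y = (if Y = [(j, t)] then c else 0)" by auto
  define f where "f = (\<lambda>Y :: 'a ad_word. if Y = [(j, t)] then c else 0)"
  have "lower f Y = (if Y = [(j, Suc t)] then qint (int h - int t) * c else 0)" for Y
  proof (cases Y)
    case (Cons y Z)
    obtain x i where y: "y = (x, i)" by (cases y)
    have "lower (\<lambda>Z. f ((x, i) # Z)) Z = 0"
    proof (cases Z)
      case (Cons y' Z')
      then show ?thesis by (cases y') (simp add: f_def lower_zero)
    qed simp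
    then show ?thesis using Cons y by (auto simp: f_def)
  qed simp
  moreover have "pairing d (replicate t d @ [j]) = f" using c by (auto simp: f_def)
  ultimately show ?case by auto
qed

text \<open>The letters appended on the right detect a single top pair by
  \<open>pairing_replicate\<close>, and \<open>remove_top\<close> commutes with the operators that
  read the remaining word.\<close>

lemma pairing_snoc_top:
  assumes "j \<noteq> d"
  shows "\<exists>c. \<forall>w Y. pairing d (w @ replicate h d @ [j]) Y = c * remove_top j (pairing d w) Y"
proof -
  obtain c where c: "\<And>Y. pairing d (replicate h d @ [j]) Y = (if Y = [(j, h)] then c else 0)"
    using pairing_replicate[OF assms] by blast
  have "pairing d (w @ replicate h d @ [j]) Y = c * remove_top j (pairing d w) Y" for w Y
  proof (induction w arbitrary: Y)
    case Nil
    show ?case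
    proof (cases Y)
      case (Cons y Z)
      obtain x i where y: "y = (x, i)" by (cases y)
      show ?thesis using Cons y c by (auto simp: remove_top_zero)
    qed (simp add: c)
  next
    case (Cons x w)
    have "pairing d (w @ replicate h d @ [j]) = (\<lambda>Y. c * remove_top j (pairing d w) Y)"
      using Cons by blast
    then show ?case
      by (simp add: lower_scale remove_bottom_scale remove_top_lower remove_top_remove_bottom)
  qed
  then show ?thesis by blast
qed


lemma commutator_append:
  assumes "\<And>A B. u = A @ d # B \<Longrightarrow> \<phi> (A @ B @ v) = 0"
  shows "commutator_insert d \<phi> (u @ v) = commutator_insert d (\<lambda>z. \<phi> (u @ z)) v"
  using assms
proof (induction u arbitrary: \<phi>)
  case (Cons x u)
  have "commutator_insert d (\<lambda>z. \<phi> (x # z)) (u @ v) = commutator_insert d (\<lambda>z. \<phi> (x # u @ z)) v"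
    by (rule Cons.IH) (metis Cons.prems append_Cons)
  moreover have "x = d \<Longrightarrow> \<phi> (u @ v) = 0" using Cons.prems[of "[]" u] by simp
  ultimately show ?case by simp
qed simp

text \<open>The letters \<open>d\<close> inserted at the different places add up to [h] + [h - 2] +
  ... + [h - 2 t], which \<open>qint_mult_diff\<close> sums to [t + 1] [h - t].\<close>

lemma commutator_replicate:
  assumes "j \<noteq> d"
  shows "commutator_insert d \<phi> (replicate (Suc t) d @ [j])
    = qint (int t + 1) * qint (int h - int t) * \<phi> (replicate t d @ [j])"
proof (induction t arbitrary: \<phi>)
  case 0
  have "qint 1 = 1" using p_diff by (simp add: qint_def)
  then show ?case using assms by (simp add: cartan_neq)
next
  case (Suc t)
  have w: "weight d (replicate k d @ [j]) = 2 * int k - int h" for k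
    using assms by (induction k) (auto simp: cartan_neq)
  have "commutator_insert d \<phi> (replicate (Suc (Suc t)) d @ [j])
    = (qint (int h - 2 * (int t + 1)) + qint (int t + 1) * qint (int h - int t)) * \<phi> (replicate (Suc t) d @ [j])"
  proof -
    have "commutator_insert d \<phi> (d # (replicate (Suc t) d @ [j]))
      = qint (- weight d (replicate (Suc t) d @ [j])) * \<phi> (replicate (Suc t) d @ [j])
        + commutator_insert d (\<lambda>z. \<phi> (d # z)) (replicate (Suc t) d @ [j])"
      by (simp only: commutator_insert.simps refl if_True)
    also have "- weight d (replicate (Suc t) d @ [j]) = int h - 2 * (int t + 1)"
      by (simp only: w) simp
    finally have "commutator_insert d \<phi> (d # (replicate (Suc t) d @ [j]))
      = qint (int h - 2 * (int t + 1)) * \<phi> (replicate (Suc t) d @ [j])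
        + qint (int t + 1) * qint (int h - int t) * \<phi> (d # (replicate t d @ [j]))"
      unfolding Suc .
    then show ?thesis by (simp add: distrib_right)
  qed
  moreover have "qint (int h - 2 * (int t + 1)) + qint (int t + 1) * qint (int h - int t)
     = qint (int (Suc t) + 1) * qint (int h - int (Suc t))"
    using qint_mult_diff[of "int t + 1" "int h - int t - 1"] by (simp add: algebra_simps)
  ultimately show ?case by (simp only:)
qed

lemma removeAll_replicate: "removeAll d (replicate t d) = []"
  by (induction t) auto

text \<open>
  Descending induction on \<open>t\<close>: the value of \<open>ad x\<^sub>d\<close> applied to \<open>\<phi>\<close> at the word \<open>u d\<^sup>t\<^sup>+\<^sup>1 j\<close>
  involves \<open>\<phi> (u d\<^sup>t j)\<close> with the coefficient \<open>[t + 1] [h - t] \<noteq> 0\<close>.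
\<close>

lemma commutator_detects:
  assumes commutator_insert: "\<And>w. length (removeAll d w) = n \<Longrightarrow> count_list w d = Suc a \<Longrightarrow> commutator_insert d \<phi> w = 0"
    and top: "\<And>w j. j \<noteq> d \<Longrightarrow> Suc (length (removeAll d w)) = n \<Longrightarrow> \<phi> (w @ replicate h d @ [j]) = 0"
    and last: "\<And>w. \<phi> (w @ [d]) = 0" and empty: "\<phi> [] = 0"
    and w: "length (removeAll d w) = n" "count_list w d = a"
  shows "\<phi> w = 0"
proof (cases w rule: rev_cases)
  case (snoc u j)
  have *: "length (removeAll d (u @ replicate t d @ [j])) = n \<longrightarrow> count_list (u @ replicate t d @ [j]) d = a
      \<longrightarrow> \<phi> (u @ replicate t d @ [j]) = 0" if j: "j \<noteq> d" and "t \<le> h" for t u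
    using \<open>t \<le> h\<close>
  proof (induction arbitrary: u rule: inc_induct)
    case base
    then show ?case using top[OF j, of u] j by (simp add: removeAll_replicate)
  next
    case (step t)
    show ?case
    proof (intro impI)
      assume A: "length (removeAll d (u @ replicate t d @ [j])) = n" "count_list (u @ replicate t d @ [j]) d = a"
      let ?v = "replicate (Suc t) d @ [j]"
      have "0 = commutator_insert d \<phi> (u @ ?v)" by (rule commutator_insert[symmetric]) (use A j in \<open>auto simp: removeAll_replicate\<close>)
      also have "\<dots> = commutator_insert d (\<lambda>z. \<phi> (u @ z)) ?v"
      proof (rule commutator_append)
        fix A' B' assume u: "u = A' @ d # B'"
        show "\<phi> (A' @ B' @ ?v) = 0"
          using step.IH[of "A' @ B'"] A by (simp add: u)
      qed
      also have "\<dots> = qint (int t + 1) * qint (int h - int t) * \<phi> (u @ replicate t d @ [j])"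
        by (rule commutator_replicate[OF j])
      finally show "\<phi> (u @ replicate t d @ [j]) = 0"
        using qint_nonzero[of "int t + 1"] qint_nonzero[of "int h - int t"] step.hyps by auto
    qed
  qed
  show ?thesis
    using *[of 0 u] w last[of u] snoc by (cases "j = d") auto
qed (simp add: empty)

text \<open>A pair carries at most \<open>h\<close> letters \<open>d\<close>. This bounds the number
  of letters \<open>d\<close>, which grows in the induction of
  \<open>functional_pairing_eq_0\<close>.\<close>

lemma pairing_eq_0:
  assumes "h * length (removeAll d w) < count_list w d"
  shows "pairing d w Y = 0"
proof (rule ccontr)
  assume "pairing d w Y \<noteq> 0"
  from pairing_nonzero[OF this] have Y: "mset w = letter_degree d Y" "height_bounded Y" "d \<notin> fst ` set Y" by auto
  have "length (removeAll d w) + count (mset w) d = size (mset w)"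
    by (induction w) auto
  moreover have "count_list w d = count (mset w) d" by (induction w) auto
  moreover have "size (letter_degree d Y) = length Y + count (letter_degree d Y) d"
    "count (letter_degree d Y) d \<le> h * length Y"
    using Y(2,3) by (induction Y) auto
  ultimately show False using assms Y(1) by simp
qed

section \<open>Stability of the radical of the pairing under the reflection\<close>

definition linear_functional :: "(('a ad_word \<Rightarrow> complex) \<Rightarrow> complex) \<Rightarrow> bool" where
  "linear_functional \<Lambda> \<longleftrightarrow> (\<forall>a b f g. \<Lambda> (\<lambda>Z. a * f Z + b * g Z) = a * \<Lambda> f + b * \<Lambda> g)"

lemma linear_functional_scale:
  assumes "linear_functional \<Lambda>" shows "\<Lambda> (\<lambda>Z. a * f Z) = a * \<Lambda> f"
  using assms[unfolded linear_functional_def, rule_format, of a f 0 f] by simp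

lemma linear_functional_zero: "linear_functional \<Lambda> \<Longrightarrow> \<Lambda> (\<lambda>Z. 0) = 0"
  using linear_functional_scale[of \<Lambda> 0 "\<lambda>_. 0"] by simp

lemma commutator_functional:
  assumes "linear_functional \<Lambda>"
  shows "commutator_insert d (\<lambda>z. \<Lambda> (F z)) w = \<Lambda> (\<lambda>Z. commutator_insert d (\<lambda>z. F z Z) w)"
proof (induction w arbitrary: F)
  case (Cons x w)
  have "\<Lambda> (\<lambda>Z. a * F w Z + 1 * commutator_insert d (\<lambda>z. F (x # z) Z) w)
    = a * \<Lambda> (F w) + 1 * \<Lambda> (\<lambda>Z. commutator_insert d (\<lambda>z. F (x # z) Z) w)" for a
    by (rule assms[unfolded linear_functional_def, rule_format])
  then show ?case using Cons by (auto simp: linear_functional_scale[OF assms])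
qed (simp add: linear_functional_zero[OF assms])

text \<open>
  Here \<open>\<Lambda>\<close> plays the role of a linear combination of words of pairs. If its reflection pairs to
  zero with all words, so do the reflections of its images under the operators of
  \<open>commutator_detects\<close>.
\<close>

lemma functional_pairing_eq_0:
  assumes "linear_functional \<Lambda>" "\<And>w. \<Lambda> (flipped (pairing d w)) = 0"
  shows "\<Lambda> (pairing d w) = 0"
  using assms
\<comment> \<open>Lexicographic order: fewer letters other than \<open>d\<close>, or equally many
  and more letters \<open>d\<close>. The second component counts down to the bound of
  \<open>pairing_eq_0\<close>.\<close>
proof (induction w arbitrary: \<Lambda> rule: wf_induct_rule[OF wf_measures[of
    "[\<lambda>w. length (removeAll d w), \<lambda>w. h * length (removeAll d w) + 1 - count_list w d]"]])
  case (1 w)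
  note lin = 1(2) and flipped = 1(3)
  show ?case
  proof (cases "h * length (removeAll d w) < count_list w d")
    case True
    have "pairing d w = (\<lambda>_. 0)" by (rule ext) (rule pairing_eq_0[OF True])
    then show ?thesis using lin by (simp add: linear_functional_zero)
  next
    case False
    have Suc: "\<Lambda> (raise (pairing d u)) = 0"
      if u: "length (removeAll d u) = length (removeAll d w)" "count_list u d = Suc (count_list w d)" for u
    proof (rule 1(1)[of u "\<lambda>g. \<Lambda> (raise g)"])
      show "linear_functional (\<lambda>g. \<Lambda> (raise g))"
        using lin by (simp add: linear_functional_def raise_linear[abs_def])
      show "\<Lambda> (raise (flipped (pairing d v))) = 0" for v
        using flipped[of "d # v"] by (simp only: flipped_pairing_Cons refl if_True)
    qed (use False u in simp)
    have top: "\<Lambda> (remove_top j (pairing d u)) = 0"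
      if u: "Suc (length (removeAll d u)) = length (removeAll d w)" and j: "j \<noteq> d" for u j
    proof (rule 1(1)[of u "\<lambda>g. \<Lambda> (remove_top j g)"])
      show "linear_functional (\<lambda>g. \<Lambda> (remove_top j g))"
        using lin by (simp add: linear_functional_def remove_top_linear[abs_def])
      show "\<Lambda> (remove_top j (flipped (pairing d v))) = 0" for v
        using flipped[of "j # v"] j by (simp only: flipped_pairing_Cons if_False)
    qed (use u in simp)
    show ?thesis
    proof (rule commutator_detects[where \<phi> = "\<lambda>w. \<Lambda> (pairing d w)", OF _ _ _ _ refl refl])
      show "commutator_insert d (\<lambda>w. \<Lambda> (pairing d w)) u = 0"
        if "length (removeAll d u) = length (removeAll d w)" "count_list u d = Suc (count_list w d)" for u
        using Suc[OF that] by (simp add: commutator_functional[OF lin] raise_commutator)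
      show "\<Lambda> (pairing d (u @ replicate h d @ [j])) = 0"
        if j: "j \<noteq> d" and u: "Suc (length (removeAll d u)) = length (removeAll d w)" for u j
      proof -
        obtain c where "pairing d (u @ replicate h d @ [j]) = (\<lambda>Y. c * remove_top j (pairing d u) Y)"
          using pairing_snoc_top[OF j] by blast
        then show ?thesis using top[OF u j] by (simp add: linear_functional_scale[OF lin])
      qed
      have "pairing d (u @ [d]) = (\<lambda>_. 0)" for u by (rule ext) (rule pairing_snoc_self)
      then show "\<Lambda> (pairing d (u @ [d])) = 0" for u by (simp add: linear_functional_zero[OF lin])
      have "flipped (pairing d []) = pairing d []"
        by (rule ext) (auto simp: flipped_def flip_def)
      then show "\<Lambda> (pairing d []) = 0" using flipped[of "[]"] by (simp only:)
    qed
  qed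
qed

text \<open>Evaluation at \<open>Y\<close> is the functional. This is the form in which the
  reflection is used: it permutes the degrees of nonzero words of pairs.\<close>

lemma pairing_flip_nonzero:
  assumes "pairing d w Y \<noteq> 0"
  shows "\<exists>u. pairing d u (flip Y) \<noteq> 0"
proof (rule ccontr)
  assume "\<not> ?thesis"
  then have "flipped (pairing d u) Y = 0" for u by (simp add: flipped_def)
  moreover have "linear_functional (\<lambda>g. g Y)" by (simp add: linear_functional_def)
  ultimately have "pairing d w Y = 0" by (intro functional_pairing_eq_0[of "\<lambda>g. g Y"])
  then show False using assms by simp
qed

section \<open>Left and right multiplication in the quantum shuffle algebra\<close>

abbreviation left_insert :: "'a \<Rightarrow> ('a list \<Rightarrow> complex) \<Rightarrow> 'a list \<Rightarrow> complex" where
  "left_insert \<equiv> insert_diagonal (\<lambda>x y. p powi cartan x y)"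

fun right_insert :: "'a \<Rightarrow> ('a list \<Rightarrow> complex) \<Rightarrow> 'a list \<Rightarrow> complex" where
  "right_insert i \<phi> [] = 0"
| "right_insert i \<phi> (x # w) = (if x = i then p powi weight i w * \<phi> w else 0) + right_insert i (\<lambda>z. \<phi> (x # z)) w"

lemma right_insert_linear: "right_insert i (\<lambda>w. a * \<phi> w + b * \<psi> w) w = a * right_insert i \<phi> w + b * right_insert i \<psi> w"
  by (induction w arbitrary: \<phi> \<psi>) (simp_all, simp_all add: algebra_simps)

lemmas right_insert_scale = right_insert_linear[of _ _ _ 0, simplified]
  and right_insert_zero = right_insert_linear[of _ 0 _ 0, simplified]

lemma right_insert_nonzero: "right_insert i \<phi> w \<noteq> 0 \<Longrightarrow> \<exists>A B. w = A @ i # B \<and> \<phi> (A @ B) \<noteq> 0"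
proof (induction w arbitrary: \<phi>)
  case (Cons x w)
  show ?case
  proof (cases "x = i \<and> \<phi> w \<noteq> 0")
    case False
    then have "right_insert i (\<lambda>z. \<phi> (x # z)) w \<noteq> 0" using Cons.prems by (auto split: if_splits)
    from Cons.IH[OF this] show ?thesis by (metis append_Cons)
  qed (metis append_Nil)
qed simp

lemma commutator_nonzero: "commutator_insert i \<phi> w \<noteq> 0 \<Longrightarrow> \<exists>A B. w = A @ i # B \<and> \<phi> (A @ B) \<noteq> 0"
proof (induction w arbitrary: \<phi>)
  case (Cons x w)
  show ?case
  proof (cases "x = i \<and> \<phi> w \<noteq> 0")
    case False
    then have "commutator_insert i (\<lambda>z. \<phi> (x # z)) w \<noteq> 0" using Cons.prems by (auto split: if_splits)
    from Cons.IH[OF this] show ?thesis by (metis append_Cons)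
  qed (metis append_Nil)
qed simp

lemma left_insert_shift: "left_insert i (\<lambda>z. p powi (weight k z + c) * \<phi> z) w = p powi (weight k w + c - cartan k i) * left_insert i \<phi> w"
proof (induction w arbitrary: \<phi> c)
  case (Cons x w)
  have "left_insert i (\<lambda>z. p powi (weight k (x # z) + c) * \<phi> (x # z)) w
    = p powi (weight k (x # w) + c - cartan k i) * left_insert i (\<lambda>z. \<phi> (x # z)) w"
    using Cons[of "cartan k x + c" "\<lambda>z. \<phi> (x # z)"] by (simp add: algebra_simps)
  then show ?case by (simp add: algebra_simps)
qed simp

text \<open>An instance of the associativity of the quantum shuffle product.\<close>

lemma left_insert_right_insert: "left_insert i (right_insert k \<phi>) w = right_insert k (left_insert i \<phi>) w"
proof (induction w arbitrary: \<phi>)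
  case (Cons x w)
  define b c :: complex where "b = (if x = i then 1 else 0)" and "c = (if x = k then 1 else 0)"
  let ?\<phi> = "\<lambda>z. \<phi> (x # z)"
  have R: "right_insert k f (x # z) = c * (p powi weight k z * f z) + right_insert k (\<lambda>z. f (x # z)) z" for f z
    by (simp add: c_def)
  have L: "left_insert i f (x # z) = b * f z + p powi cartan x i * left_insert i (\<lambda>z. f (x # z)) z" for f z
    by (simp add: b_def)
  have sh: "left_insert i (\<lambda>z. p powi weight k z * \<phi> z) w = p powi (weight k w - cartan k i) * left_insert i \<phi> w"
    using left_insert_shift[of i k 0 \<phi> w] by simp
  have "left_insert i (right_insert k \<phi>) (x # w) = b * right_insert k \<phi> w
     + p powi cartan x i * (c * (p powi (weight k w - cartan k i) * left_insert i \<phi> w) + right_insert k (left_insert i ?\<phi>) w)"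
    by (simp only: L R insert_diagonal_add insert_diagonal_scale sh Cons)
  moreover have "right_insert k (left_insert i \<phi>) (x # w) = c * (p powi weight k w * left_insert i \<phi> w)
     + (b * right_insert k \<phi> w + p powi cartan x i * right_insert k (left_insert i ?\<phi>) w)"
    by (simp only: R L right_insert_linear)
  moreover have "p powi cartan x i * (c * (p powi (weight k w - cartan k i) * left_insert i \<phi> w))
     = c * (p powi weight k w * left_insert i \<phi> w)"
    by (simp add: c_def mult.assoc[symmetric] flip: powi_add)
  ultimately show ?case by (simp only: distrib_left ac_simps)
qed simp

text \<open>At each place, left insertion yields \<open>p\<close> to the weight of the prefix and
  right insertion \<open>p\<close> to the weight v of the suffix. After taking out the power
  belonging to the whole word, the difference is p^(-v) - p^v, a multiple of [-v].\<close>

lemma left_insert_commutator: "left_insert d \<phi> w = p powi (weight d w - 2) * ((p - inverse p) * commutator_insert d \<phi> w + right_insert d \<phi> w)"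
proof (induction w arbitrary: \<phi>)
  case (Cons x w)
  let ?W = "weight d w" and ?E = "commutator_insert d (\<lambda>z. \<phi> (x # z)) w" and ?R = "right_insert d (\<lambda>z. \<phi> (x # z)) w"
  define c :: complex where "c = (if x = d then 1 else 0)"
  have "(p - inverse p) * qint (- ?W) + p powi ?W = p powi (- ?W)"
    using p_diff by (simp add: qint_def)
  then have 1: "c * p powi (cartan x d + ?W - 2) * ((p - inverse p) * qint (- ?W) + p powi ?W) = c"
    by (simp add: c_def flip: powi_add)
  have "left_insert d \<phi> (x # w) = c * \<phi> w + p powi cartan x d * (p powi (?W - 2) * ((p - inverse p) * ?E + ?R))"
    by (simp add: c_def Cons)
  also have "\<dots> = c * \<phi> w + p powi (cartan x d + ?W - 2) * ((p - inverse p) * ?E + ?R)"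
    by (simp add: mult.assoc[symmetric] add_diff_eq flip: powi_add)
  also have "\<dots> = p powi (cartan x d + ?W - 2) * ((p - inverse p) * (c * (qint (- ?W) * \<phi> w) + ?E)
      + (c * (p powi ?W * \<phi> w) + ?R))"
  proof -
    have "c * f + P * (k * E + R) = P * (k * (c * (q * f) + E) + (c * (r * f) + R))"
      if "c * P * (k * q + r) = c" for E P R c f k q r :: complex
    proof -
      have "P * (k * (c * (q * f) + E) + (c * (r * f) + R)) = c * P * (k * q + r) * f + P * (k * E + R)"
        by (simp add: algebra_simps)
      then show ?thesis by (simp only: that)
    qed
    from this[OF 1] show ?thesis .
  qed
  finally have "left_insert d \<phi> (x # w) = p powi (cartan x d + ?W - 2)
      * ((p - inverse p) * (c * (qint (- ?W) * \<phi> w) + ?E) + (c * (p powi ?W * \<phi> w) + ?R))" .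
  moreover have "commutator_insert d \<phi> (x # w) = c * (qint (- ?W) * \<phi> w) + ?E"
    "right_insert d \<phi> (x # w) = c * (p powi ?W * \<phi> w) + ?R"
    "weight d (x # w) - 2 = cartan x d + ?W - 2"
    by (simp_all add: c_def cartan_commute)
  ultimately show ?case by (simp only:)
qed simp

lemma left_insert_commutator_homogeneous:
  assumes "\<And>w. \<phi> w \<noteq> 0 \<Longrightarrow> mset w = \<beta>"
  shows "\<exists>k. \<forall>w. left_insert d \<phi> w = p powi k * ((p - inverse p) * commutator_insert d \<phi> w + right_insert d \<phi> w)"
proof (intro exI allI)
  fix w
  let ?k = "2 * int (count \<beta> d) - int h * (int (size \<beta>) - int (count \<beta> d))"
  show "left_insert d \<phi> w = p powi ?k * ((p - inverse p) * commutator_insert d \<phi> w + right_insert d \<phi> w)"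
  proof (cases "mset w = add_mset d \<beta>")
    case True
    then have "weight d w - 2 = ?k" by (simp add: weight_mset)
    then show ?thesis by (simp only: left_insert_commutator[of d \<phi> w])
  next
    case False
    have "\<not> (w = A @ d # B \<and> \<phi> (A @ B) \<noteq> 0)" for A B
    proof (intro notI)
      assume w: "w = A @ d # B \<and> \<phi> (A @ B) \<noteq> 0"
      then have "mset (A @ B) = \<beta>" by (intro assms) simp
      then show False using False w by simp
    qed
    then have "left_insert d \<phi> w = 0" "commutator_insert d \<phi> w = 0" "right_insert d \<phi> w = 0"
      using insert_diagonal_nonzero[of "\<lambda>x y. p powi cartan x y" d \<phi> w] commutator_nonzero[of d \<phi> w] right_insert_nonzero[of d \<phi> w] by auto
    then show ?thesis by simp
  qed
qed

lemma lower_left_insert: "left_insert j (\<lambda>z. lower (F z) Y) w = lower (\<lambda>Z. left_insert j (\<lambda>z. F z Z) w) Y"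
  by (induction w arbitrary: F) (simp_all add: lower_zero lower_add lower_scale)

lemma remove_bottom_left_insert:
  "left_insert j (\<lambda>z. remove_bottom x (F z) Y) w = remove_bottom x (\<lambda>Z. left_insert j (\<lambda>z. F z Z) w) Y"
  by (induction w arbitrary: F) (simp_all add: remove_bottom_zero remove_bottom_add remove_bottom_scale)

text \<open>For a bottom pair in front, passing it costs exactly the factor
  \<open>p powi cartan x j\<close> of left multiplication by \<open>j\<close>; for
  \<open>x = d\<close> this is the exponent \<open>- h\<close> at height 0.\<close>

lemma pairing_Cons_bottom:
  assumes "j \<noteq> d"
  shows "pairing d w ((j, 0) # Y) = left_insert j (\<lambda>z. pairing d z Y) w"
  using assms
proof (induction w arbitrary: Y)
  case (Cons x w)
  then show ?case by (auto simp: lower_left_insert remove_bottom_left_insert cartan_neq)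
qed simp


section \<open>Homogeneous components of the Nichols algebra and words of pairs in them\<close>

inductive nichols_component :: "'a set \<Rightarrow> 'a multiset \<Rightarrow> ('a list \<Rightarrow> complex) \<Rightarrow> bool" for I where
  unit: "nichols_component I {#} (\<lambda>w. if w = [] then 1 else 0)"
| mult: "i \<in> I \<Longrightarrow> nichols_component I \<beta> \<phi> \<Longrightarrow> nichols_component I (add_mset i \<beta>) (left_insert i \<phi>)"
| zero: "nichols_component I \<beta> (\<lambda>_. 0)"
| linear: "nichols_component I \<beta> \<phi> \<Longrightarrow> nichols_component I \<beta> \<psi> \<Longrightarrow> nichols_component I \<beta> (\<lambda>w. a * \<phi> w + b * \<psi> w)"

lemma nichols_support: "nichols_component I \<beta> \<phi> \<Longrightarrow> \<phi> w \<noteq> 0 \<Longrightarrow> mset w = \<beta>"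
proof (induction arbitrary: w rule: nichols_component.induct)
  case (mult i \<beta> \<phi>)
  then show ?case using insert_diagonal_nonzero[OF mult.prems] by fastforce
next
  case (linear \<beta> \<phi> \<psi> a b)
  then show ?case by (metis add_cancel_left_left mult_not_zero)
qed (auto split: if_splits)

lemma nichols_degree: "nichols_component I \<beta> \<phi> \<Longrightarrow> \<phi> w \<noteq> 0 \<Longrightarrow> set_mset \<beta> \<subseteq> I"
proof (induction arbitrary: w rule: nichols_component.induct)
  case (mult i \<beta> \<phi>)
  then show ?case using insert_diagonal_nonzero[OF mult.prems] by fastforce
next
  case (linear \<beta> \<phi> \<psi> a b)
  then show ?case by (metis add_cancel_left_left mult_not_zero)
qed auto

text \<open>Right multiplication commutes with the left multiplications that generate, and on the
  unit it coincides with left multiplication.\<close>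

lemma nichols_right_insert:
  assumes "d \<in> I"
  shows "nichols_component I \<beta> \<phi> \<Longrightarrow> nichols_component I (add_mset d \<beta>) (right_insert d \<phi>)"
proof (induction rule: nichols_component.induct)
  case unit
  have "right_insert d (\<lambda>w. if w = [] then 1 else 0) w = left_insert d (\<lambda>w. if w = [] then 1 else 0) w" for w
    by (cases w) (auto simp: right_insert_zero insert_diagonal_zero)
  then have "right_insert d (\<lambda>w. if w = [] then 1 else 0) = left_insert d (\<lambda>w. if w = [] then 1 else 0)" by blast
  then show ?case using nichols_component.mult[OF assms nichols_component.unit] by simp
next
  case (mult i \<beta> \<phi>)
  have "right_insert d (left_insert i \<phi>) = left_insert i (right_insert d \<phi>)" by (rule ext) (rule left_insert_right_insert[symmetric])
  then show ?case using nichols_component.mult[OF mult.hyps(1) mult.IH] by (simp add: add_mset_commute)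
next
  case (zero \<beta>)
  then show ?case using nichols_component.zero by (simp add: right_insert_zero[abs_def])
next
  case (linear \<beta> \<phi> \<psi> a b)
  have "right_insert d (\<lambda>w. a * \<phi> w + b * \<psi> w) = (\<lambda>w. a * right_insert d \<phi> w + b * right_insert d \<psi> w)"
    by (rule ext) (rule right_insert_linear)
  then show ?case using nichols_component.linear[OF linear.IH] by simp
qed

lemma nichols_commutator:
  assumes "d \<in> I" "nichols_component I \<beta> \<phi>"
  shows "nichols_component I (add_mset d \<beta>) (commutator_insert d \<phi>)"
proof -
  obtain k where k: "\<And>w. left_insert d \<phi> w = p powi k * ((p - inverse p) * commutator_insert d \<phi> w + right_insert d \<phi> w)"
    using left_insert_commutator_homogeneous[OF nichols_support[OF assms(2)]] by blast
  have "commutator_insert d \<phi> w = inverse (p powi k * (p - inverse p)) * left_insert d \<phi> w + (- inverse (p - inverse p)) * right_insert d \<phi> w" for w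
  proof -
    have "x = inverse (a * c) * (a * (c * x + y)) + (- inverse c) * y" if "a \<noteq> 0" "c \<noteq> 0" for a c x y :: complex
      using that by (simp add: field_simps)
    from this[OF _ p_diff] show ?thesis using p_nonzero by (simp only: k) simp
  qed
  then have "commutator_insert d \<phi> = (\<lambda>w. inverse (p powi k * (p - inverse p)) * left_insert d \<phi> w + (- inverse (p - inverse p)) * right_insert d \<phi> w)"
    by blast
  then show ?thesis
    by (simp only: nichols_component.linear[OF nichols_component.mult[OF assms] nichols_right_insert[OF assms]])
qed

lemma raise_closed:
  assumes zero: "P (\<lambda>_. 0)" and linear: "\<And>\<phi> \<psi> a b. P \<phi> \<Longrightarrow> P \<psi> \<Longrightarrow> P (\<lambda>w. a * \<phi> w + b * \<psi> w)"
    and raised: "\<And>A j i B. Y = A @ (j, i) # B \<Longrightarrow> P (\<lambda>w. g w (A @ (j, Suc i) # B))"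
  shows "P (\<lambda>w :: 'b. raise (g w) Y)"
  using raised
proof (induction Y arbitrary: g)
  case (Cons y Y)
  obtain j i where y: "y = (j, i)" by (cases y)
  have "P (\<lambda>w. raise (\<lambda>Z. g w (y # Z)) Y)"
  proof (rule Cons.IH)
    show "P (\<lambda>w. g w (y # A @ (j, Suc i) # B))" if "Y = A @ (j, i) # B" for A j i B
      using Cons.prems[of "y # A" j i B] that by simp
  qed
  moreover have "P (\<lambda>w. g w ((j, Suc i) # Y))"
    using Cons.prems[of "[]" j i Y] by (simp add: y)
  ultimately have "P (\<lambda>w. qint (int i + 1) * p powi (- wt Y) * g w ((j, Suc i) # Y)
      + 1 * raise (\<lambda>Z. g w (y # Z)) Y)"
    by (rule linear[rotated])
  then show ?case by (simp add: y)
qed (simp add: zero)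

lemma pairing_Cons_bottom_fun: "j \<noteq> d \<Longrightarrow> (\<lambda>w. pairing d w ((j, 0) # Y)) = left_insert j (\<lambda>w. pairing d w Y)"
  by (rule ext) (rule pairing_Cons_bottom)

lemma pairing_Nil: "(\<lambda>w. pairing d w []) = (\<lambda>w. if w = [] then 1 else 0)"
proof (rule ext)
  show "pairing d w [] = (if w = [] then 1 else 0)" for w by (cases w) auto
qed

text \<open>Applying ad x_d to the word with head (j, i) gives a multiple of the word with head (j,
  i + 1) plus words in which a later pair is raised. The multiple involves [i + 1], invertible for i
  < h. The inner induction on i is over all tails of fixed length, since the tail changes.\<close>

lemma pairing_nichols:
  assumes "d \<in> I" "fst ` set Y \<subseteq> I - {d}"
  shows "nichols_component I (letter_degree d Y) (\<lambda>w. pairing d w Y)"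
  using assms(2)
proof (induction "length Y" arbitrary: Y)
  case 0
  then show ?case using nichols_component.unit[of I] by (simp add: pairing_Nil)
next
  case (Suc n)
  note IH = Suc(1)
  have "\<forall>j Y. j \<in> I - {d} \<longrightarrow> length Y = n \<longrightarrow> fst ` set Y \<subseteq> I - {d} \<longrightarrow>
      nichols_component I (letter_degree d ((j, i) # Y)) (\<lambda>w. pairing d w ((j, i) # Y))" for i
  proof (induction i)
    case 0
    have "nichols_component I (letter_degree d ((j, 0) # Y)) (\<lambda>w. pairing d w ((j, 0) # Y))"
      if "j \<in> I - {d}" "length Y = n" "fst ` set Y \<subseteq> I - {d}" for j Y
      using nichols_component.mult[OF _ IH[OF that(2)[symmetric] that(3)], of j] that(1)
      by (simp add: pairing_Cons_bottom_fun)
    then show ?case by blast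
  next
    case (Suc i)
    have "nichols_component I (letter_degree d ((j, Suc i) # Y)) (\<lambda>w. pairing d w ((j, Suc i) # Y))"
      if j: "j \<in> I - {d}" and Y: "length Y = n" "fst ` set Y \<subseteq> I - {d}" for j Y
    proof (cases "Suc i \<le> h")
      case False
      then have "pairing d w ((j, Suc i) # Y) = 0" for w
        using pairing_nonzero[of d w "(j, Suc i) # Y"] by auto
      then show ?thesis by (simp add: nichols_component.zero)
    next
      case True
      let ?c = "qint (int i + 1) * p powi (- wt Y)"
      have c: "?c \<noteq> 0" using qint_nonzero[of "int i + 1"] True p_nonzero by simp
      have e: "nichols_component I (letter_degree d ((j, Suc i) # Y)) (commutator_insert d (\<lambda>w. pairing d w ((j, i) # Y)))"
      proof -
        have "nichols_component I (letter_degree d ((j, i) # Y)) (\<lambda>w. pairing d w ((j, i) # Y))"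
          using Suc j Y by blast
        from nichols_commutator[OF assms(1) this] show ?thesis by (simp add: add_mset_commute)
      qed
      have r: "nichols_component I (letter_degree d ((j, Suc i) # Y)) (\<lambda>w. raise (\<lambda>Z. pairing d w ((j, i) # Z)) Y)"
      proof (rule raise_closed[where P = "nichols_component I (letter_degree d ((j, Suc i) # Y))"])
        show "nichols_component I (letter_degree d ((j, Suc i) # Y)) (\<lambda>w. pairing d w ((j, i) # A @ (j', Suc i') # B))"
          if Y': "Y = A @ (j', i') # B" for A j' i' B
        proof -
          have "length (A @ (j', Suc i') # B) = n" "fst ` set (A @ (j', Suc i') # B) \<subseteq> I - {d}"
            using Y Y' by auto
          then have "nichols_component I (letter_degree d ((j, i) # A @ (j', Suc i') # B))
              (\<lambda>w. pairing d w ((j, i) # A @ (j', Suc i') # B))"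
            using Suc j by blast
          then show ?thesis by (simp add: Y' add_mset_commute)
        qed
      qed (auto intro: nichols_component.intros)
      have "pairing d w ((j, Suc i) # Y) = inverse ?c * commutator_insert d (\<lambda>w. pairing d w ((j, i) # Y)) w
          + (- inverse ?c) * raise (\<lambda>Z. pairing d w ((j, i) # Z)) Y" for w
      proof -
        have 1: "commutator_insert d (\<lambda>w. pairing d w ((j, i) # Y)) w
            = ?c * pairing d w ((j, Suc i) # Y) + raise (\<lambda>Z. pairing d w ((j, i) # Z)) Y"
          by (simp only: raise_commutator raise.simps)
        have "x = inverse a * e + (- inverse a) * r" if "e = a * x + r" "a \<noteq> 0" for a e r x :: complex
          using that by (simp add: field_simps)
        from this[OF 1 c] show ?thesis .
      qed
      then have "(\<lambda>w. pairing d w ((j, Suc i) # Y)) = (\<lambda>w. inverse ?c * commutator_insert d (\<lambda>w. pairing d w ((j, i) # Y)) w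
          + (- inverse ?c) * raise (\<lambda>Z. pairing d w ((j, i) # Z)) Y)" by (rule ext)
      then show ?thesis by (simp only: nichols_component.linear[OF e r])
    qed
    then show ?case by blast
  qed
  moreover obtain j i Z where "Y = (j, i) # Z" using Suc(2) by (cases Y) auto
  ultimately show ?case using Suc(2,3) by simp
qed

lemma right_insert_snoc_self: "right_insert d \<phi> (w @ [d]) = \<phi> w + p\<^sup>2 * right_insert d (\<lambda>z. \<phi> (z @ [d])) w"
proof (induction w arbitrary: \<phi>)
  case (Cons x w)
  have "weight d (w @ [d]) = weight d w + 2" by simp
  then have 1: "p powi weight d (w @ [d]) = p powi weight d w * p\<^sup>2" by (simp add: powi_add)
  have "(if b then P * q * f else 0) + (g + q * R) = g + q * ((if b then P * f else 0) + R)"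
    for b and P q f g R :: complex
    by (simp add: algebra_simps)
  then show ?case unfolding append_Cons right_insert.simps Cons 1 .
qed simp

lemma right_insert_funpow_snoc:
  assumes "\<And>w. \<psi> (w @ [d]) = 0"
  shows "(right_insert d ^^ Suc k) \<psi> (w @ [d]) = (\<Sum>i\<le>k. p ^ (2 * i)) * (right_insert d ^^ k) \<psi> w"
proof (induction k arbitrary: w)
  case 0
  show ?case by (simp add: right_insert_snoc_self assms right_insert_zero)
next
  case (Suc k)
  have "(\<Sum>i\<le>Suc k. p ^ (2 * i)) = 1 + p\<^sup>2 * (\<Sum>i\<le>k. p ^ (2 * i))"
    by (subst sum.atMost_Suc_shift) (simp add: sum_distrib_left power_add power2_eq_square mult_ac)
  moreover have "(right_insert d ^^ Suc (Suc k)) \<psi> (w @ [d])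
      = (right_insert d ^^ Suc k) \<psi> w + p\<^sup>2 * right_insert d (\<lambda>z. (right_insert d ^^ Suc k) \<psi> (z @ [d])) w"
    by (simp add: right_insert_snoc_self)
  moreover have "right_insert d (\<lambda>z. (right_insert d ^^ Suc k) \<psi> (z @ [d])) w
      = (\<Sum>i\<le>k. p ^ (2 * i)) * (right_insert d ^^ Suc k) \<psi> w"
    by (simp only: Suc right_insert_scale) simp
  ultimately show ?case by (simp only: distrib_right mult_1 mult.assoc)
qed

text \<open>As \<open>\<psi>\<close> is in its kernel, the right skew derivation along
  \<open>d\<close> takes \<psi> x_d^(k+1) to (k+1)_q \<psi> x_d^k with q = p^2, and (1 - q) (k+1)_q
  = 1 - q^(k+1) is nonzero for k < h.\<close>

lemma right_insert_funpow_nonzero: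
  assumes "\<And>w. \<psi> (w @ [d]) = 0" "\<psi> w \<noteq> 0" "k \<le> h"
  shows "\<exists>w. (right_insert d ^^ k) \<psi> w \<noteq> 0"
  using assms(3)
proof (induction k)
  case 0
  then show ?case using assms(2) by auto
next
  case (Suc k)
  then obtain w where w: "(right_insert d ^^ k) \<psi> w \<noteq> 0" by auto
  have "(1 - p\<^sup>2) * (\<Sum>i\<le>k. (p\<^sup>2) ^ i) = 1 - (p\<^sup>2) ^ Suc k" by (rule sum_gp_basic)
  moreover have "(p\<^sup>2) ^ Suc k \<noteq> 1"
    using p_power[OF zero_less_Suc Suc.prems] by (simp only: power_mult not_False_eq_True)
  ultimately have "(\<Sum>i\<le>k. p ^ (2 * i)) \<noteq> 0" by (auto simp: power_mult)
  then have "(right_insert d ^^ Suc k) \<psi> (w @ [d]) \<noteq> 0"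
    using w by (subst right_insert_funpow_snoc[of \<psi>, rule_format]) (simp_all add: assms(1))
  then show ?case by blast
qed

lemma nichols_right_insert_funpow:
  "d \<in> I \<Longrightarrow> nichols_component I \<beta> \<phi> \<Longrightarrow> nichols_component I (\<beta> + replicate_mset k d) ((right_insert d ^^ k) \<phi>)"
  by (induction k) (simp_all add: nichols_right_insert)

lemma nichols_pairing_power:
  assumes "d \<in> I" "fst ` set Y \<subseteq> I - {d}" "pairing d w Y \<noteq> 0"
  shows "\<exists>\<phi> w. nichols_component I (letter_degree d Y + replicate_mset h d) \<phi> \<and> \<phi> w \<noteq> 0"
proof -
  have "nichols_component I (letter_degree d Y + replicate_mset h d) ((right_insert d ^^ h) (\<lambda>w. pairing d w Y))"
    by (rule nichols_right_insert_funpow[OF assms(1) pairing_nichols[OF assms(1,2)]])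
  moreover have "\<exists>w. (right_insert d ^^ h) (\<lambda>w. pairing d w Y) w \<noteq> 0"
    by (rule right_insert_funpow_nonzero[where w = w]) (simp_all add: pairing_snoc_self assms(3))
  ultimately show ?thesis by blast
qed

text \<open>The span of the products of words of pairs with powers of x_d on the right, which turns
  out to contain the whole Nichols algebra.\<close>

inductive spanned :: "'a \<Rightarrow> 'a set \<Rightarrow> 'a multiset \<Rightarrow> ('a list \<Rightarrow> complex) \<Rightarrow> bool" for d I where
  pairing: "fst ` set Y \<subseteq> I - {d} \<Longrightarrow> spanned d I (letter_degree d Y) (\<lambda>w. pairing d w Y)"
| mult: "spanned d I \<beta> \<phi> \<Longrightarrow> spanned d I (add_mset d \<beta>) (right_insert d \<phi>)"
| zero: "spanned d I \<beta> (\<lambda>_. 0)"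
| linear: "spanned d I \<beta> \<phi> \<Longrightarrow> spanned d I \<beta> \<psi> \<Longrightarrow> spanned d I \<beta> (\<lambda>w. a * \<phi> w + b * \<psi> w)"

lemma spanned_nonzero:
  "spanned d I \<beta> \<phi> \<Longrightarrow> \<phi> w \<noteq> 0 \<Longrightarrow>
    \<exists>k Y u. fst ` set Y \<subseteq> I - {d} \<and> pairing d u Y \<noteq> 0 \<and> \<beta> = letter_degree d Y + replicate_mset k d"
proof (induction arbitrary: w rule: spanned.induct)
  case (pairing Y)
  then show ?case by (metis add.right_neutral replicate_mset_0)
next
  case (mult \<beta> \<phi>)
  obtain v where "\<phi> v \<noteq> 0" using right_insert_nonzero[OF mult.prems] by auto
  then obtain k Y u where "fst ` set Y \<subseteq> I - {d}" "pairing d u Y \<noteq> 0" "\<beta> = letter_degree d Y + replicate_mset k d"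
    using mult.IH by blast
  then have "fst ` set Y \<subseteq> I - {d} \<and> pairing d u Y \<noteq> 0 \<and> add_mset d \<beta> = letter_degree d Y + replicate_mset (Suc k) d"
    by simp
  then show ?case by blast
next
  case (linear \<beta> \<phi> \<psi> a b)
  then show ?case by (metis add_cancel_left_left mult_not_zero)
qed simp

text \<open>A letter other than \<open>d\<close> prepends a bottom pair. The letter \<open>d\<close>
  moves past a word of pairs, up to scalars, at the cost of a raised word, and then joins the power
  of x_d on the right.\<close>

lemma spanned_left_insert:
  assumes "i \<in> I"
  shows "spanned d I \<beta> \<phi> \<Longrightarrow> spanned d I (add_mset i \<beta>) (left_insert i \<phi>)"
proof (induction rule: spanned.induct)
  case (pairing Y)
  show ?case
  proof (cases "i = d")
    case False
    then have "spanned d I (letter_degree d ((i, 0) # Y)) (\<lambda>w. pairing d w ((i, 0) # Y))"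
      using pairing assms by (intro spanned.pairing) auto
    then show ?thesis using False by (simp add: pairing_Cons_bottom_fun)
  next
    case True
    obtain k where k: "\<And>w. left_insert d (\<lambda>w. pairing d w Y) w
        = p powi k * ((p - inverse p) * commutator_insert d (\<lambda>w. pairing d w Y) w + right_insert d (\<lambda>w. pairing d w Y) w)"
      using left_insert_commutator_homogeneous[of "\<lambda>w. pairing d w Y" "letter_degree d Y" d] pairing_nonzero[of d _ Y] by auto
    have r: "spanned d I (add_mset d (letter_degree d Y)) (\<lambda>w. raise (pairing d w) Y)"
    proof (rule raise_closed[where P = "spanned d I (add_mset d (letter_degree d Y))"])
      show "spanned d I (add_mset d (letter_degree d Y)) (\<lambda>w. pairing d w (A @ (j, Suc i) # B))"
        if "Y = A @ (j, i) # B" for A j i B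
        using spanned.pairing[of "A @ (j, Suc i) # B" I d] pairing that by (auto simp: add_mset_commute)
    qed (auto intro: spanned.intros)
    have "left_insert d (\<lambda>w. pairing d w Y) = (\<lambda>w. (p powi k * (p - inverse p)) * raise (pairing d w) Y
        + p powi k * right_insert d (\<lambda>w. pairing d w Y) w)"
      by (rule ext) (simp add: k raise_commutator algebra_simps)
    then show ?thesis
      by (simp only: True spanned.linear[OF r spanned.mult[OF spanned.pairing[OF pairing]]])
  qed
next
  case (mult \<beta> \<phi>)
  have "left_insert i (right_insert d \<phi>) = right_insert d (left_insert i \<phi>)" by (rule ext) (rule left_insert_right_insert)
  then show ?case using spanned.mult[OF mult.IH] by (simp add: add_mset_commute)
next
  case (zero \<beta>)
  then show ?case using spanned.zero by (simp add: insert_diagonal_zero[abs_def])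
next
  case (linear \<beta> \<phi> \<psi> a b)
  have "left_insert i (\<lambda>w. a * \<phi> w + b * \<psi> w) = (\<lambda>w. a * left_insert i \<phi> w + b * left_insert i \<psi> w)"
    by (rule ext) (rule insert_diagonal_linear)
  then show ?case using spanned.linear[OF linear.IH] by simp
qed

lemma nichols_spanned: "nichols_component I \<beta> \<phi> \<Longrightarrow> spanned d I \<beta> \<phi>"
proof (induction rule: nichols_component.induct)
  case unit
  then show ?case using spanned.pairing[of "[]" I d] by (simp add: pairing_Nil)
qed (auto intro: spanned_left_insert spanned.intros)

section \<open>The degree of maximal size\<close>

text \<open>
  Nonzero elements of the kernel of the skew derivation along \<open>d\<close> can be multiplied by \<open>x\<^sub>d\<^sup>h\<close>, and
  their degrees are permuted by the reflection at \<open>d\<close>. Applied to \<open>\<beta>\<close> minus a multiple of \<open>d\<close> and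
  to its reflection, maximality gives the estimate.
\<close>

lemma top_degree:
  assumes "nichols_component I \<beta> \<phi>" "\<phi> w \<noteq> 0" "d \<in> I"
    and max: "\<And>\<gamma> \<psi> u. nichols_component I \<gamma> \<psi> \<Longrightarrow> \<psi> u \<noteq> 0 \<Longrightarrow> size \<gamma> \<le> size \<beta>"
  shows "h * (size \<beta> - count \<beta> d) + 2 * h \<le> 2 * count \<beta> d"
proof -
  obtain k Y u where Y: "fst ` set Y \<subseteq> I - {d}" "pairing d u Y \<noteq> 0" and \<beta>: "\<beta> = letter_degree d Y + replicate_mset k d"
    using spanned_nonzero[OF nichols_spanned[OF assms(1)] assms(2)] by blast
  obtain u' where u': "pairing d u' (flip Y) \<noteq> 0" using pairing_flip_nonzero[OF Y(2)] by blast
  have flip: "fst ` set (flip Y) \<subseteq> I - {d}" using Y(1) by (force simp: flip_def)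
  have b: "height_bounded Y" using pairing_nonzero[OF Y(2)] by simp
  have 1: "size (letter_degree d Y) + h \<le> size \<beta>"
    using nichols_pairing_power[OF assms(3) Y] max by fastforce
  have 2: "size (letter_degree d (flip Y)) + h \<le> size \<beta>"
    using nichols_pairing_power[OF assms(3) flip u'] max by fastforce
  \<comment> \<open>With L = \<open>length Y\<close> and c letters \<open>d\<close> in
    \<open>Y\<close>, estimate 1 reads h \<le> k and estimate 2 reads h (L + 1) \<le> 2 c + k; their
    sum is the claim.\<close>
  have "size (letter_degree d Y) = length Y + count (letter_degree d Y) d"
    using Y(1) by (induction Y) auto
  moreover have "size (letter_degree d (flip Y)) = length Y + (h * length Y - count (letter_degree d Y) d)"
    "count (letter_degree d Y) d \<le> h * length Y"
    using Y(1) b by (induction Y) auto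
  ultimately show ?thesis using 1 2 unfolding \<beta> by simp
qed

theorem nichols_infinite:
  assumes "finite I" "2 \<le> h * (card I - 1)"
    and fin: "\<And>\<beta> \<phi> w. nichols_component I \<beta> \<phi> \<Longrightarrow> \<phi> w \<noteq> 0 \<Longrightarrow> size \<beta> < N"
  shows False
proof -
  let ?S = "{size \<beta> | \<beta>. \<exists>\<phi> w. nichols_component I \<beta> \<phi> \<and> \<phi> w \<noteq> 0}"
  have S: "finite ?S" using fin by (auto intro!: finite_subset[of _ "{..<N}"])
  have "?S \<noteq> {}" using nichols_component.unit[of I] by fastforce
  with S have "Max ?S \<in> ?S" by (rule Max_in)
  then obtain \<beta> \<phi> w where M: "Max ?S = size \<beta>" and \<beta>: "nichols_component I \<beta> \<phi>" "\<phi> w \<noteq> 0"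
    by blast
  have max: "size \<gamma> \<le> size \<beta>" if "nichols_component I \<gamma> \<psi>" "\<psi> u \<noteq> 0" for \<gamma> \<psi> u
    unfolding M[symmetric] by (rule Max_ge[OF S]) (use that in blast)
  have le: "h * (size \<beta> - count \<beta> d) + 2 * h \<le> 2 * count \<beta> d" if "d \<in> I" for d
    by (rule top_degree[OF \<beta> that max])
  have "set_mset \<beta> \<subseteq> I" by (rule nichols_degree[OF \<beta>])
  then have sz: "(\<Sum>d\<in>I. count \<beta> d) = size \<beta>"
    unfolding size_multiset_overloaded_eq using assms(1)
    by (intro sum.mono_neutral_right) (auto simp: count_eq_zero_iff)
  have "(\<Sum>d\<in>I. h * (size \<beta> - count \<beta> d) + 2 * h) \<le> (\<Sum>d\<in>I. 2 * count \<beta> d)"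
    by (rule sum_mono) (rule le)
  moreover have "(\<Sum>d\<in>I. size \<beta> - count \<beta> d) = card I * size \<beta> - size \<beta>"
    using sz by (subst sum_subtractf_nat) (auto simp: count_le_size)
  ultimately have "h * (card I * size \<beta> - size \<beta>) + card I * (2 * h) \<le> 2 * size \<beta>"
    by (simp add: sum.distrib sz flip: sum_distrib_left)
  moreover have "card I * size \<beta> - size \<beta> = (card I - 1) * size \<beta>" by (simp add: diff_mult_distrib)
  ultimately have le: "h * ((card I - 1) * size \<beta>) + card I * (2 * h) \<le> 2 * size \<beta>" by (simp only:)
  have ge: "2 * size \<beta> \<le> h * ((card I - 1) * size \<beta>)"
    using mult_right_mono[OF assms(2), of "size \<beta>"] by (simp add: mult_ac)
  have "0 < card I * (2 * h)" using assms(2) h_pos by (cases "card I") auto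
  then show False using order_trans[OF le ge] by linarith
qed

end

section \<open>The Nichols algebra is a ring\<close>

lemma tensor_mult_Nil: "(x \<otimes>\<^bsub>tensor_algebra B\<^esub> y) [] = x [] * y []"
  by (simp add: tensor_algebra_def)

lemma tensor_mult_Cons:
  "(x \<otimes>\<^bsub>tensor_algebra B\<^esub> y) (a # w)
    = x [] * y (a # w) + ((\<lambda>v. x (a # v)) \<otimes>\<^bsub>tensor_algebra B\<^esub> y) w"
  by (simp add: tensor_algebra_def sum.atMost_Suc_shift del: sum.atMost_Suc)

lemma tensor_mult_snoc:
  "(x \<otimes>\<^bsub>tensor_algebra B\<^esub> y) (w @ [a])
    = (x \<otimes>\<^bsub>tensor_algebra B\<^esub> (\<lambda>v. y (v @ [a]))) w + x (w @ [a]) * y []"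
  by (simp add: tensor_algebra_def)

lemma tensor_mult_add_left:
  "((\<lambda>v. a * x v + b * x' v) \<otimes>\<^bsub>tensor_algebra B\<^esub> y) w
    = a * (x \<otimes>\<^bsub>tensor_algebra B\<^esub> y) w + b * (x' \<otimes>\<^bsub>tensor_algebra B\<^esub> y) w"
  by (simp add: tensor_algebra_def sum_distrib_left sum.distrib distrib_left distrib_right mult.assoc)

lemma tensor_mult_add_right:
  "(x \<otimes>\<^bsub>tensor_algebra B\<^esub> (\<lambda>v. y v + y' v)) w
    = (x \<otimes>\<^bsub>tensor_algebra B\<^esub> y) w + (x \<otimes>\<^bsub>tensor_algebra B\<^esub> y') w"
  by (simp add: tensor_algebra_def sum.distrib distrib_left)

lemma tensor_mult_assoc:
  "((x \<otimes>\<^bsub>tensor_algebra B\<^esub> y) \<otimes>\<^bsub>tensor_algebra B\<^esub> z) w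
    = (x \<otimes>\<^bsub>tensor_algebra B\<^esub> (y \<otimes>\<^bsub>tensor_algebra B\<^esub> z)) w"
proof (induction w arbitrary: x y)
  case (Cons a w)
  let ?x = "\<lambda>v. x (a # v)" and ?y = "\<lambda>v. y (a # v)"
  have "(\<lambda>v. (x \<otimes>\<^bsub>tensor_algebra B\<^esub> y) (a # v))
      = (\<lambda>v. x [] * ?y v + 1 * (?x \<otimes>\<^bsub>tensor_algebra B\<^esub> y) v)"
    by (simp add: tensor_mult_Cons)
  then show ?case
    by (simp only: tensor_mult_Cons[of _ _ _ a w] tensor_mult_Nil tensor_mult_add_left Cons) (simp add: algebra_simps)
qed (simp add: tensor_mult_Nil)

lemma tensor_scalar_mult_left: "(tensor_scalar a \<otimes>\<^bsub>tensor_algebra B\<^esub> x) w = a * x w"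
proof (cases w)
  case (Cons b v)
  have "(\<lambda>u. tensor_scalar a (b # u)) = (\<lambda>_. 0)" by (simp add: tensor_scalar_def)
  then show ?thesis by (simp only: Cons tensor_mult_Cons) (simp add: tensor_algebra_def tensor_scalar_def)
qed (simp add: tensor_mult_Nil tensor_scalar_def)

lemma tensor_scalar_mult_right: "(x \<otimes>\<^bsub>tensor_algebra B\<^esub> tensor_scalar a) w = x w * a"
proof (induction w arbitrary: x)
  case (Cons b w)
  then show ?case by (simp only: tensor_mult_Cons) (simp add: tensor_scalar_def)
qed (simp add: tensor_mult_Nil tensor_scalar_def)

lemma tensor_carrier_iff:
  "x \<in> carrier (tensor_algebra B) \<longleftrightarrow> finite {w. x w \<noteq> 0} \<and> {w. x w \<noteq> 0} \<subseteq> lists B"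
  by (simp add: tensor_algebra_def)

lemma tensor_simps:
  "\<zero>\<^bsub>tensor_algebra B\<^esub> = (\<lambda>w. 0)" "x \<oplus>\<^bsub>tensor_algebra B\<^esub> y = (\<lambda>w. x w + y w)"
  "\<one>\<^bsub>tensor_algebra B\<^esub> = tensor_scalar 1"
  by (simp_all add: tensor_algebra_def)

lemma tensor_mult_closed:
  assumes "x \<in> carrier (tensor_algebra B)" "y \<in> carrier (tensor_algebra B)"
  shows "x \<otimes>\<^bsub>tensor_algebra B\<^esub> y \<in> carrier (tensor_algebra B)"
proof -
  let ?S = "(\<lambda>(u, v). u @ v) ` ({w. x w \<noteq> 0} \<times> {w. y w \<noteq> 0})"
  have "{w. (x \<otimes>\<^bsub>tensor_algebra B\<^esub> y) w \<noteq> 0} \<subseteq> ?S"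
  proof
    fix w assume "w \<in> {w. (x \<otimes>\<^bsub>tensor_algebra B\<^esub> y) w \<noteq> 0}"
    then obtain k where "x (take k w) * y (drop k w) \<noteq> 0"
      by (auto simp: tensor_algebra_def elim: sum.not_neutral_contains_not_neutral)
    then show "w \<in> ?S" by (intro image_eqI[of _ _ "(take k w, drop k w)"]) auto
  qed
  moreover have "finite ?S" "?S \<subseteq> lists B"
    using assms by (auto simp: tensor_carrier_iff) blast+
  ultimately show ?thesis unfolding tensor_carrier_iff using finite_subset by blast
qed

lemma tensor_linear_closed:
  assumes "x \<in> carrier (tensor_algebra B)" "y \<in> carrier (tensor_algebra B)"
  shows "(\<lambda>w. a * x w + b * y w) \<in> carrier (tensor_algebra B)"
proof -
  have "{w. a * x w + b * y w \<noteq> 0} \<subseteq> {w. x w \<noteq> 0} \<union> {w. y w \<noteq> 0}" by auto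
  moreover have "finite ({w. x w \<noteq> 0} \<union> {w. y w \<noteq> 0})" "{w. x w \<noteq> 0} \<union> {w. y w \<noteq> 0} \<subseteq> lists B"
    using assms by (auto simp: tensor_carrier_iff)
  ultimately show ?thesis unfolding tensor_carrier_iff using finite_subset by blast
qed

lemma tensor_scalar_closed: "tensor_scalar a \<in> carrier (tensor_algebra B)"
proof -
  have "{w. tensor_scalar a w \<noteq> 0} \<subseteq> {[]}" by (auto simp: tensor_scalar_def)
  then show ?thesis unfolding tensor_carrier_iff using finite_subset by auto
qed

lemma tensor_uminus: "x \<in> carrier (tensor_algebra B) \<Longrightarrow> (\<lambda>w. - x w) \<in> carrier (tensor_algebra B)"
  using tensor_linear_closed[where a = "-1" and b = 0 and y = x] by simp

lemma ring_tensor_algebra: "ring (tensor_algebra B)"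
proof (rule ringI)
  show "abelian_group (tensor_algebra B)"
  proof (rule abelian_groupI)
    show "x \<oplus>\<^bsub>tensor_algebra B\<^esub> y \<in> carrier (tensor_algebra B)"
      if "x \<in> carrier (tensor_algebra B)" "y \<in> carrier (tensor_algebra B)" for x y
      using tensor_linear_closed[OF that, of 1 1] by (simp add: tensor_simps)
    show "\<exists>y\<in>carrier (tensor_algebra B). y \<oplus>\<^bsub>tensor_algebra B\<^esub> x = \<zero>\<^bsub>tensor_algebra B\<^esub>"
      if "x \<in> carrier (tensor_algebra B)" for x
      by (rule bexI[OF _ tensor_uminus[OF that]]) (simp add: tensor_simps)
  qed (auto simp: tensor_simps tensor_carrier_iff algebra_simps)
  show "monoid (tensor_algebra B)"
    by (rule monoidI)
      (auto simp: tensor_mult_closed tensor_scalar_closed tensor_simps(3) tensor_mult_assoc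
        tensor_scalar_mult_left tensor_scalar_mult_right)
  fix x y z :: "'a tensor"
  show "(x \<oplus>\<^bsub>tensor_algebra B\<^esub> y) \<otimes>\<^bsub>tensor_algebra B\<^esub> z
      = x \<otimes>\<^bsub>tensor_algebra B\<^esub> z \<oplus>\<^bsub>tensor_algebra B\<^esub> y \<otimes>\<^bsub>tensor_algebra B\<^esub> z"
    using tensor_mult_add_left[of B 1 x 1 y z] by (simp add: tensor_simps fun_eq_iff)
  show "z \<otimes>\<^bsub>tensor_algebra B\<^esub> (x \<oplus>\<^bsub>tensor_algebra B\<^esub> y)
      = z \<otimes>\<^bsub>tensor_algebra B\<^esub> x \<oplus>\<^bsub>tensor_algebra B\<^esub> z \<otimes>\<^bsub>tensor_algebra B\<^esub> y"
    by (simp add: tensor_simps tensor_mult_add_right fun_eq_iff)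
qed

section \<open>Braid operators and quantum symmetrizers on words\<close>

lemma braid_at_linear: "braid_at B C i (\<lambda>v. a * x v + b * y v) w = a * braid_at B C i x w + b * braid_at B C i y w"
  by (simp add: braid_at_def case_prod_unfold sum_distrib_left sum.distrib algebra_simps)

lemma braid_at_sum: "braid_at B C i (\<lambda>v. \<Sum>k\<in>K. x k v) w = (\<Sum>k\<in>K. braid_at B C i (x k) w)"
proof (cases "Suc i < length w")
  case True
  then show ?thesis
    by (simp add: braid_at_def case_prod_unfold sum_distrib_right sum.swap[of _ K])
qed (simp add: braid_at_def)

lemma braid_at_cong:
  assumes "\<And>v. length v = length w \<Longrightarrow> x v = y v"
  shows "braid_at B C i x w = braid_at B C i y w"
  using assms by (auto simp: braid_at_def)

abbreviation braids :: "'b set \<Rightarrow> 'b braiding \<Rightarrow> nat list \<Rightarrow> 'b tensor \<Rightarrow> 'b tensor" where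
  "braids B C \<equiv> foldr (braid_at B C)"

lemma braids_linear:
  "braids B C js (\<lambda>v. a * x v + b * y v) = (\<lambda>w. a * braids B C js x w + b * braids B C js y w)"
  by (induction js) (simp_all add: braid_at_linear[abs_def])

lemma braids_scale: "braids B C js (\<lambda>v. a * x v) = (\<lambda>w. a * braids B C js x w)"
  using braids_linear[of B C js a x 0 x] by simp

lemma braids_sum: "braids B C js (\<lambda>v. \<Sum>k\<in>K. x k v) = (\<lambda>w. \<Sum>k\<in>K. braids B C js (x k) w)"
  by (induction js) (simp_all add: braid_at_sum[abs_def])

lemma braids_cong:
  assumes "\<And>v. length v = length w \<Longrightarrow> x v = y v"
  shows "braids B C js x w = braids B C js y w"
  using assms by (induction js arbitrary: w) (auto intro!: braid_at_cong)

lemma quantum_symmetrizer_linear: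
  "quantum_symmetrizer B C n (\<lambda>v. a * x v + b * y v)
    = (\<lambda>w. a * quantum_symmetrizer B C n x w + b * quantum_symmetrizer B C n y w)"
  by (induction n) (simp_all add: braids_linear sum.distrib sum_distrib_left)

lemma quantum_symmetrizer_cong:
  assumes "\<And>v. length v = length w \<Longrightarrow> x v = y v"
  shows "quantum_symmetrizer B C n x w = quantum_symmetrizer B C n y w"
  using assms
proof (induction n arbitrary: w)
  case (Suc n)
  have "quantum_symmetrizer B C n x v = quantum_symmetrizer B C n y v" if "length v = length w" for v
    using Suc that by metis
  then show ?case by (auto intro!: sum.cong braids_cong)
qed simp

lemma quantum_symmetrizer_zero: "quantum_symmetrizer B C n (\<lambda>_. 0) = (\<lambda>_. 0)"
  using quantum_symmetrizer_linear[of B C n 0 "\<lambda>_. 0" 0 "\<lambda>_. 0"] by simp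

lemma quantum_symmetrizer_homogeneous_part:
  "quantum_symmetrizer B C n (homogeneous_part m x) w
    = (if length w = m then quantum_symmetrizer B C n x w else 0)"
proof (cases "length w = m")
  case True
  then show ?thesis by (auto intro!: quantum_symmetrizer_cong simp: homogeneous_part_def)
next
  case False
  have "quantum_symmetrizer B C n (homogeneous_part m x) w = quantum_symmetrizer B C n (\<lambda>_. 0) w"
    using False by (intro quantum_symmetrizer_cong) (simp add: homogeneous_part_def)
  then show ?thesis using False by (simp add: quantum_symmetrizer_zero)
qed

text \<open>All operators preserve the length of words, so the value at \<open>w\<close> sees only
  the homogeneous part of degree \<open>length w\<close>.\<close>

lemma nichols_ideal_iff:
  "x \<in> nichols_ideal B C \<longleftrightarrow>
    x \<in> carrier (tensor_algebra B) \<and> (\<forall>w. quantum_symmetrizer B C (length w) x w = 0)"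
  by (auto simp: nichols_ideal_def fun_eq_iff quantum_symmetrizer_homogeneous_part)


text \<open>All positions are moved up by one, so that \<open>shifted_symmetrizer\<close> becomes
  the quantum symmetrizer acting behind the first letter.\<close>

definition shifted_symmetrizer_step :: "'b set \<Rightarrow> 'b braiding \<Rightarrow> nat \<Rightarrow> 'b tensor \<Rightarrow> 'b tensor" where
  "shifted_symmetrizer_step B C n x = (\<lambda>w. \<Sum>k\<le>n. braids B C [Suc k..<Suc n] x w)"

primrec shifted_symmetrizer :: "'b set \<Rightarrow> 'b braiding \<Rightarrow> nat \<Rightarrow> 'b tensor \<Rightarrow> 'b tensor" where
  "shifted_symmetrizer B C 0 x = x"
| "shifted_symmetrizer B C (Suc n) x = shifted_symmetrizer_step B C n (shifted_symmetrizer B C n x)"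

lemma braid_at_Suc_Cons: "braid_at B C (Suc i) x (b # w) = braid_at B C i (\<lambda>v. x (b # v)) w"
  by (simp add: braid_at_def)

lemma braids_Suc_Cons: "braids B C (map Suc js) x (b # w) = braids B C js (\<lambda>v. x (b # v)) w"
proof (induction js arbitrary: w)
  case (Cons j js)
  then show ?case by (simp add: braid_at_Suc_Cons)
qed simp

lemma shifted_symmetrizer_Cons:
  "shifted_symmetrizer B C n x (b # w) = quantum_symmetrizer B C n (\<lambda>v. x (b # v)) w"
proof (induction n arbitrary: w)
  case (Suc n)
  have "braids B C [Suc k..<Suc n] (shifted_symmetrizer B C n x) (b # w)
      = braids B C [k..<n] (quantum_symmetrizer B C n (\<lambda>v. x (b # v))) w" for k
    unfolding map_Suc_upt[symmetric] braids_Suc_Cons by (simp add: Suc cong: braids_cong)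
  then show ?case by (simp add: shifted_symmetrizer_step_def del: upt_Suc)
qed simp

lemma braid_at_snoc: "Suc i < length w \<Longrightarrow> braid_at B C i x (w @ [b]) = braid_at B C i (\<lambda>v. x (v @ [b])) w"
  by (simp add: braid_at_def nth_append list_update_append)

lemma braids_snoc:
  "\<forall>j\<in>set js. Suc j < length w \<Longrightarrow> braids B C js x (w @ [b]) = braids B C js (\<lambda>v. x (v @ [b])) w"
proof (induction js arbitrary: w)
  case (Cons j js)
  have "braid_at B C j (\<lambda>v. braids B C js x (v @ [b])) w = braid_at B C j (braids B C js (\<lambda>v. x (v @ [b]))) w"
    by (rule braid_at_cong) (use Cons in auto)
  then show ?case using Cons.prems by (simp add: braid_at_snoc)
qed simp

lemma quantum_symmetrizer_snoc:
  "n \<le> length w \<Longrightarrow> quantum_symmetrizer B C n x (w @ [b]) = quantum_symmetrizer B C n (\<lambda>v. x (v @ [b])) w"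
proof (induction n arbitrary: w)
  case (Suc n)
  have "braids B C [k..<n] (quantum_symmetrizer B C n x) (w @ [b])
      = braids B C [k..<n] (quantum_symmetrizer B C n (\<lambda>v. x (v @ [b]))) w" for k
  proof -
    have "braids B C [k..<n] (quantum_symmetrizer B C n x) (w @ [b])
      = braids B C [k..<n] (\<lambda>v. quantum_symmetrizer B C n x (v @ [b])) w"
      using Suc.prems by (intro braids_snoc) auto
    also have "\<dots> = braids B C [k..<n] (quantum_symmetrizer B C n (\<lambda>v. x (v @ [b]))) w"
      by (rule braids_cong) (use Suc in simp)
    finally show ?thesis .
  qed
  then show ?case by simp
qed simp

text \<open>Split off the last letter. If it comes from \<open>y\<close>, the symmetrizer on the
  first \<open>n\<close> letters already vanishes by induction; otherwise \<open>y\<close>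
  contributes only \<open>y []\<close>. What remains is \<open>y []\<close> times the symmetrizer of
  \<open>x\<close>.\<close>

lemma quantum_symmetrizer_mult_right:
  assumes "\<And>w. quantum_symmetrizer B C (length w) x w = 0"
  shows "length w = n \<Longrightarrow> quantum_symmetrizer B C n (x \<otimes>\<^bsub>tensor_algebra B\<^esub> y) w = 0"
proof (induction n arbitrary: w y)
  case 0
  then show ?case using assms[of "[]"] by (simp add: tensor_mult_Nil)
next
  case (Suc n)
  let ?xy = "x \<otimes>\<^bsub>tensor_algebra B\<^esub> y"
  have "quantum_symmetrizer B C n ?xy v = y [] * quantum_symmetrizer B C n x v" if v: "length v = Suc n" for v
  proof -
    obtain u b where u: "v = u @ [b]" "length u = n" using v by (cases v rule: rev_cases) auto
    have "(\<lambda>u. ?xy (u @ [b])) = (\<lambda>u. 1 * (x \<otimes>\<^bsub>tensor_algebra B\<^esub> (\<lambda>v. y (v @ [b]))) u + y [] * x (u @ [b]))"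
      by (simp add: tensor_mult_snoc mult.commute)
    then show ?thesis
      using Suc.IH[of u] u by (simp only: quantum_symmetrizer_snoc quantum_symmetrizer_linear) simp
  qed
  then have "braids B C [k..<n] (quantum_symmetrizer B C n ?xy) w
      = braids B C [k..<n] (\<lambda>v. y [] * quantum_symmetrizer B C n x v) w" for k
    by (intro braids_cong) (simp add: Suc.prems)
  then have "quantum_symmetrizer B C (Suc n) ?xy w = y [] * quantum_symmetrizer B C (Suc n) x w"
    by (simp add: braids_scale sum_distrib_left)
  then show ?case using assms[of w] Suc.prems by simp
qed


section \<open>Distant braid operators and the braid equation\<close>

lemma braid_at_far:
  assumes "Suc i < j"
  shows "braid_at B C i (braid_at B C j x) w = braid_at B C j (braid_at B C i x) w"
proof (cases "Suc j < length w")
  case True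
  then have i: "Suc i < length w" using assms by simp
  let ?f = "\<lambda>q r. x (w[i := fst q, Suc i := snd q, j := fst r, Suc j := snd r])
    * (C r (w ! j, w ! Suc j) * C q (w ! i, w ! Suc i))"
  have swap: "w[j := c, Suc j := d, i := a, Suc i := b] = w[i := a, Suc i := b, j := c, Suc j := d]"
    for a b c d
    by (rule nth_equalityI) (use assms i True in \<open>auto simp: nth_list_update\<close>)
  have "braid_at B C i (braid_at B C j x) w = (\<Sum>q\<in>B \<times> B. \<Sum>r\<in>B \<times> B. ?f q r)"
    using assms True i by (simp add: braid_at_def case_prod_unfold sum_distrib_right mult.assoc)
  also have "\<dots> = (\<Sum>r\<in>B \<times> B. \<Sum>q\<in>B \<times> B. ?f q r)" by (rule sum.swap)
  also have "\<dots> = braid_at B C j (braid_at B C i x) w"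
    using assms True i
    by (simp add: braid_at_def case_prod_unfold sum_distrib_right swap mult.assoc mult.commute[of "C (fst _, snd _) _"] cong: sum.cong)
      (simp add: mult.left_commute mult.commute)?
  finally show ?thesis .
next
  case False
  then show ?thesis by (simp add: braid_at_def)
qed

lemma braids_far:
  assumes "\<forall>j\<in>set js. Suc i < j \<or> Suc j < i"
  shows "braids B C js (braid_at B C i x) = braid_at B C i (braids B C js x)"
  using assms
proof (induction js)
  case (Cons j js)
  have "braid_at B C j (braid_at B C i y) = braid_at B C i (braid_at B C j y)" for y
    using Cons.prems braid_at_far[of i j B C y] braid_at_far[of j i B C y] by auto
  then show ?case using Cons by simp
qed simp

lemma braids_braids_far:
  assumes "\<forall>i\<in>set is. \<forall>j\<in>set js. Suc i < j \<or> Suc j < i"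
  shows "braids B C js (braids B C is x) = braids B C is (braids B C js x)"
  using assms by (induction "is") (simp_all add: braids_far)

text \<open>
  The braiding \<open>c (x\<^sub>a \<otimes> x\<^sub>b) = (a \<cdot> x\<^sub>b) \<otimes> x\<^sub>a\<close>, where \<open>M a\<close> is the matrix of the action of the group
  element that underlies the basis element \<open>a\<close>. The last assumption says that
  \<open>h\<^sub>\<beta> h\<^sub>\<gamma> = h\<^sub>\<gamma> h\<^sub>e\<close> as soon as \<open>x\<^sub>\<beta>\<close> occurs in \<open>\<gamma> \<cdot> x\<^sub>e\<close>; it yields the braid equation.
\<close>

locale group_type_braiding =
  fixes B :: "'b set" and C :: "'b braiding" and M :: "'b \<Rightarrow> 'b \<Rightarrow> 'b \<Rightarrow> complex"
  assumes braiding: "a \<in> B \<Longrightarrow> b \<in> B \<Longrightarrow> C (a, b) (\<alpha>, \<beta>) = (if \<beta> = a then M a \<alpha> b else 0)"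
    and finite_basis: "finite B"
    and action_closed: "a \<in> B \<Longrightarrow> b \<in> B \<Longrightarrow> M a \<alpha> b \<noteq> 0 \<Longrightarrow> \<alpha> \<in> B"
    and action_conj: "\<lbrakk>\<beta> \<in> B; \<gamma> \<in> B; d \<in> B; e \<in> B; M \<gamma> \<beta> e \<noteq> 0\<rbrakk> \<Longrightarrow>
      (\<Sum>b\<in>B. M \<beta> \<alpha> b * M \<gamma> b d) = (\<Sum>b\<in>B. M \<gamma> \<alpha> b * M e b d)"
begin

lemma braid_at_eq:
  assumes "length u = i"
  shows "braid_at B C i x (u @ \<alpha> # \<beta> # v) = (if \<beta> \<in> B then \<Sum>b\<in>B. M \<beta> \<alpha> b * x (u @ \<beta> # b # v) else 0)"
proof -
  have "braid_at B C i x (u @ \<alpha> # \<beta> # v)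
     = (\<Sum>a\<in>B. \<Sum>b\<in>B. x (u @ a # b # v) * C (a, b) (\<alpha>, \<beta>))"
    using assms by (simp add: braid_at_def nth_append list_update_append sum.cartesian_product)
  also have "\<dots> = (\<Sum>a\<in>B. if \<beta> = a then \<Sum>b\<in>B. M \<beta> \<alpha> b * x (u @ \<beta> # b # v) else 0)"
    by (intro sum.cong refl) (auto simp: braiding intro!: sum.cong)
  also have "\<dots> = (if \<beta> \<in> B then \<Sum>b\<in>B. M \<beta> \<alpha> b * x (u @ \<beta> # b # v) else 0)"
    using finite_basis by simp
  finally show ?thesis .
qed

lemma braid_relation:
  assumes "Suc (Suc i) < length w"
  shows "braid_at B C i (braid_at B C (Suc i) (braid_at B C i x)) w
    = braid_at B C (Suc i) (braid_at B C i (braid_at B C (Suc i) x)) w"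
proof -
  obtain u \<alpha> \<beta> \<gamma> v where w: "w = u @ \<alpha> # \<beta> # \<gamma> # v" and u: "length u = i"
  proof
    show "w = take i w @ w ! i # w ! Suc i # w ! Suc (Suc i) # drop (Suc (Suc (Suc i))) w"
      using assms by (simp add: Cons_nth_drop_Suc)
    show "length (take i w) = i" using assms by simp
  qed
  have at: "braid_at B C i y (u @ \<alpha> # \<beta> # \<gamma> # v)
      = (if \<beta> \<in> B then \<Sum>b\<in>B. M \<beta> \<alpha> b * y (u @ \<beta> # b # \<gamma> # v) else 0)" for y \<alpha> \<beta> \<gamma>
    using u by (rule braid_at_eq)
  have at_Suc: "braid_at B C (Suc i) y (u @ \<alpha> # \<beta> # \<gamma> # v)
      = (if \<gamma> \<in> B then \<Sum>b\<in>B. M \<gamma> \<beta> b * y (u @ \<alpha> # \<gamma> # b # v) else 0)" for y \<alpha> \<beta> \<gamma>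
    using braid_at_eq[of "u @ [\<alpha>]" "Suc i" y \<beta> \<gamma> v] u by simp
  let ?L = "\<Sum>b\<in>B. \<Sum>d\<in>B. \<Sum>e\<in>B. M \<beta> \<alpha> b * (M \<gamma> b d * (M \<gamma> \<beta> e * x (u @ \<gamma> # e # d # v)))"
  let ?R = "\<Sum>e\<in>B. \<Sum>b\<in>B. \<Sum>d\<in>B. M \<gamma> \<beta> e * (M \<gamma> \<alpha> b * (M e b d * x (u @ \<gamma> # e # d # v)))"
  have L: "braid_at B C i (braid_at B C (Suc i) (braid_at B C i x)) w = (if \<beta> \<in> B \<and> \<gamma> \<in> B then ?L else 0)"
    by (simp add: w at at_Suc sum_distrib_left)
  have R: "braid_at B C (Suc i) (braid_at B C i (braid_at B C (Suc i) x)) w = (if \<gamma> \<in> B then ?R else 0)"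
    by (simp add: w at at_Suc sum_distrib_left)
  show ?thesis
  proof (cases "\<beta> \<in> B \<and> \<gamma> \<in> B")
    case True
    have "?L = (\<Sum>d\<in>B. \<Sum>b\<in>B. \<Sum>e\<in>B. M \<beta> \<alpha> b * (M \<gamma> b d * (M \<gamma> \<beta> e * x (u @ \<gamma> # e # d # v))))"
      by (rule sum.swap)
    also have "\<dots> = (\<Sum>d\<in>B. \<Sum>e\<in>B. \<Sum>b\<in>B. M \<beta> \<alpha> b * (M \<gamma> b d * (M \<gamma> \<beta> e * x (u @ \<gamma> # e # d # v))))"
      by (rule sum.cong[OF refl]) (rule sum.swap)
    also have "\<dots> = (\<Sum>e\<in>B. \<Sum>d\<in>B. \<Sum>b\<in>B. M \<beta> \<alpha> b * (M \<gamma> b d * (M \<gamma> \<beta> e * x (u @ \<gamma> # e # d # v))))"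
      by (rule sum.swap)
    also have "\<dots> = (\<Sum>e\<in>B. \<Sum>d\<in>B. M \<gamma> \<beta> e * x (u @ \<gamma> # e # d # v) * (\<Sum>b\<in>B. M \<beta> \<alpha> b * M \<gamma> b d))"
      by (simp add: sum_distrib_left mult_ac)
    \<comment> \<open>The two sides of the braid equation differ only in the sum over
      \<open>b\<close>. It is exchanged by \<open>action_conj\<close>, unless its factor
      \<open>M \<gamma> \<beta> e\<close> vanishes.\<close>
    also have "\<dots> = (\<Sum>e\<in>B. \<Sum>d\<in>B. M \<gamma> \<beta> e * x (u @ \<gamma> # e # d # v) * (\<Sum>b\<in>B. M \<gamma> \<alpha> b * M e b d))"
    proof (intro sum.cong refl)
      show "M \<gamma> \<beta> e * x (u @ \<gamma> # e # d # v) * (\<Sum>b\<in>B. M \<beta> \<alpha> b * M \<gamma> b d)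
         = M \<gamma> \<beta> e * x (u @ \<gamma> # e # d # v) * (\<Sum>b\<in>B. M \<gamma> \<alpha> b * M e b d)"
        if "e \<in> B" "d \<in> B" for e d
        using action_conj[of \<beta> \<gamma> d e \<alpha>] True that by (cases "M \<gamma> \<beta> e = 0") auto
    qed
    also have "\<dots> = (\<Sum>e\<in>B. \<Sum>d\<in>B. \<Sum>b\<in>B. M \<gamma> \<beta> e * (M \<gamma> \<alpha> b * (M e b d * x (u @ \<gamma> # e # d # v))))"
      by (simp add: sum_distrib_left mult_ac)
    also have "\<dots> = ?R" by (rule sum.cong[OF refl]) (rule sum.swap)
    finally show ?thesis using True by (simp add: L R)
  next
    case False
    have "M \<gamma> \<beta> e = 0" if "\<gamma> \<in> B" "e \<in> B" for e
      using action_closed[of \<gamma> e \<beta>] that False by blast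
    then show ?thesis using False by (simp add: L R)
  qed
qed

text \<open>Conjugation by c_k ... c_n moves c_j to c_(j+1): distant factors commute, and the braid
  relation at j, j + 1 does the rest.\<close>

lemma braids_shift:
  assumes "k \<le> j" "j < n" "Suc n < length w"
  shows "braids B C [k..<Suc n] (braid_at B C j x) w = braid_at B C (Suc j) (braids B C [k..<Suc n] x) w"
proof -
  have split: "[k..<Suc n] = [k..<j] @ [j, Suc j] @ [Suc (Suc j)..<Suc n]"
    using assms upt_add_eq_append[of k j "Suc n - j"] by (simp add: upt_conv_Cons[of j] upt_conv_Cons[of "Suc j"] del: upt_Suc)
  let ?y = "braids B C [Suc (Suc j)..<Suc n] x"
  have "braids B C [k..<Suc n] (braid_at B C j x) w
      = braids B C [k..<j] (braid_at B C j (braid_at B C (Suc j) (braid_at B C j ?y))) w"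
    unfolding split by (simp add: braids_far del: upt_Suc)
  also have "\<dots> = braids B C [k..<j] (braid_at B C (Suc j) (braid_at B C j (braid_at B C (Suc j) ?y))) w"
    using assms by (intro braids_cong braid_relation) simp
  also have "\<dots> = braid_at B C (Suc j) (braids B C [k..<Suc n] x) w"
    unfolding split by (simp add: braids_far del: upt_Suc)
  finally show ?thesis .
qed

lemma braids_shift_rev:
  "k \<le> l \<Longrightarrow> l \<le> n \<Longrightarrow> Suc n < length w \<Longrightarrow> braids B C [k..<Suc n] (braids B C (rev [k..<l]) x) w
    = braids B C (rev [Suc k..<Suc l]) (braids B C [k..<Suc n] x) w"
proof (induction l arbitrary: w rule: dec_induct)
  case (step l)
  have "braids B C [k..<Suc n] (braid_at B C l (braids B C (rev [k..<l]) x)) w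
     = braid_at B C (Suc l) (braids B C [k..<Suc n] (braids B C (rev [k..<l]) x)) w"
    using step by (intro braids_shift) auto
  also have "\<dots> = braid_at B C (Suc l) (braids B C (rev [Suc k..<Suc l]) (braids B C [k..<Suc n] x)) w"
    by (rule braid_at_cong) (use step in simp)
  moreover have "rev [k..<Suc l] = l # rev [k..<l]" "rev [Suc k..<Suc (Suc l)] = Suc l # rev [Suc k..<Suc l]"
    using step.hyps by simp_all
  ultimately show ?case by (simp del: upt_Suc)
qed simp

text \<open>The factors of the descending product from position \<open>k\<close> on are shifted up
  by one, and the leading c_k of the ascending product fills the gap.\<close>

lemma braids_exchange:
  assumes "k \<le> l" "l \<le> n" "Suc n < length w"
  shows "braids B C [k..<Suc n] (braids B C (rev [0..<l]) x) w
    = braids B C (rev [0..<Suc l]) (braids B C [Suc k..<Suc n] x) w"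
proof -
  have k: "[k..<Suc n] = k # [Suc k..<Suc n]" using assms by (simp add: upt_conv_Cons del: upt_Suc)
  have "rev [0..<l] = rev [k..<l] @ rev [0..<k]"
    using upt_add_eq_append[of 0 k "l - k"] assms by simp
  then have "braids B C [k..<Suc n] (braids B C (rev [0..<l]) x) w
     = braids B C (rev [Suc k..<Suc l]) (braids B C [k..<Suc n] (braids B C (rev [0..<k]) x)) w"
    using assms by (simp add: braids_shift_rev del: upt_Suc)
  also note k
  also have "braids B C (rev [Suc k..<Suc l]) (braids B C (k # [Suc k..<Suc n]) (braids B C (rev [0..<k]) x)) w
     = braids B C (rev [Suc k..<Suc l] @ k # rev [0..<k]) (braids B C [Suc k..<Suc n] x) w"
    by (simp add: braids_braids_far del: upt_Suc)
  also have "rev [Suc k..<Suc l] @ k # rev [0..<k] = rev [0..<Suc l]"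
    using upt_add_eq_append[of 0 "Suc k" "l - k"] assms by (simp del: upt_Suc) simp
  finally show ?thesis unfolding k .
qed

text \<open>
  The ideal of the Nichols algebra is a right ideal by the recursion that defines the quantum
  symmetrizer. For the left ideal property the recursion is turned round: with the sums of braid
  operators below, \<open>\<SS>\<^sub>n\<^sub>+\<^sub>1 = (\<Sum>l\<le>n. c\<^sub>l\<^sub>-\<^sub>1 \<dots> c\<^sub>0) (id \<otimes> \<SS>\<^sub>n)\<close>.
\<close>

definition left_step :: "nat \<Rightarrow> 'b tensor \<Rightarrow> 'b tensor" where
  "left_step n x = (\<lambda>w. \<Sum>l\<le>n. braids B C (rev [0..<l]) x w)"

text \<open>The double sums agree term by term. For l < k the two products are distant and commute,
  giving the index (l, k - 1); for k \<le> l the lemma \<open>braids_exchange\<close> gives the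
  index (l + 1, k). Together this is a bijection.\<close>

lemma step_exchange:
  assumes "Suc n < length w"
  shows "(\<Sum>k\<le>Suc n. braids B C [k..<Suc n] (left_step n x) w)
    = left_step (Suc n) (shifted_symmetrizer_step B C n x) w"
proof -
  let ?f = "\<lambda>(k, l). braids B C [k..<Suc n] (braids B C (rev [0..<l]) x) w"
  let ?g = "\<lambda>(l, k). braids B C (rev [0..<l]) (braids B C [Suc k..<Suc n] x) w"
  have "(\<Sum>k\<le>Suc n. braids B C [k..<Suc n] (left_step n x) w) = sum ?f ({..Suc n} \<times> {..n})"
    by (simp add: left_step_def braids_sum sum.cartesian_product del: sum.atMost_Suc upt_Suc)
  also have "\<dots> = sum ?g ({..Suc n} \<times> {..n})"
  proof (rule sum.reindex_bij_witness[where
      i = "\<lambda>(l, k). if l \<le> k then (Suc k, l) else (k, l - 1)" and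
      j = "\<lambda>(k, l). if l < k then (l, k - 1) else (Suc l, k)"])
    fix a assume a: "a \<in> {..Suc n} \<times> {..n}"
    obtain k l where kl: "a = (k, l)" "k \<le> Suc n" "l \<le> n" using a by auto
    show "?g ((\<lambda>(k, l). if l < k then (l, k - 1) else (Suc l, k)) a) = ?f a"
    proof (cases "l < k")
      case True
      then have "Suc (k - 1) = k" by simp
      moreover have "braids B C [k..<Suc n] (braids B C (rev [0..<l]) x)
          = braids B C (rev [0..<l]) (braids B C [k..<Suc n] x)"
        using True by (intro braids_braids_far) auto
      ultimately show ?thesis using True kl(1) by (simp del: upt_Suc)
    next
      case False
      then show ?thesis using braids_exchange[of k l n w x] kl assms by (simp del: upt_Suc)
    qed
  qed (auto split: if_splits)
  also have "\<dots> = left_step (Suc n) (shifted_symmetrizer_step B C n x) w"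
    by (simp add: left_step_def shifted_symmetrizer_step_def braids_sum sum.cartesian_product
        del: sum.atMost_Suc upt_Suc)
  finally show ?thesis .
qed

lemma quantum_symmetrizer_left:
  "n < length w \<Longrightarrow> quantum_symmetrizer B C (Suc n) x w = left_step n (shifted_symmetrizer B C n x) w"
proof (induction n arbitrary: w)
  case 0
  then show ?case by (simp add: left_step_def)
next
  case (Suc n)
  have "quantum_symmetrizer B C (Suc (Suc n)) x w
     = (\<Sum>k\<le>Suc n. braids B C [k..<Suc n] (quantum_symmetrizer B C (Suc n) x) w)"
    by (simp only: quantum_symmetrizer.simps)
  also have "\<dots> = (\<Sum>k\<le>Suc n. braids B C [k..<Suc n] (left_step n (shifted_symmetrizer B C n x)) w)"
    by (intro sum.cong refl braids_cong Suc.IH) (use Suc.prems in simp)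
  also have "\<dots> = left_step (Suc n) (shifted_symmetrizer B C (Suc n) x) w"
    using Suc.prems by (simp only: step_exchange shifted_symmetrizer.simps)
  finally show ?case .
qed

lemma left_step_cong:
  "(\<And>v. length v = length w \<Longrightarrow> x v = y v) \<Longrightarrow> left_step n x w = left_step n y w"
  unfolding left_step_def by (intro sum.cong refl braids_cong)

lemma left_step_scale: "left_step n (\<lambda>v. a * x v) w = a * left_step n x w"
  by (simp add: left_step_def braids_scale sum_distrib_left)

lemma quantum_symmetrizer_mult_left:
  assumes "\<And>w. quantum_symmetrizer B C (length w) x w = 0"
  shows "length w = n \<Longrightarrow> quantum_symmetrizer B C n (y \<otimes>\<^bsub>tensor_algebra B\<^esub> x) w = 0"
proof (induction n arbitrary: w y)
  case 0
  then show ?case using assms[of "[]"] by (simp add: tensor_mult_Nil)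
next
  case (Suc n)
  let ?yx = "y \<otimes>\<^bsub>tensor_algebra B\<^esub> x"
  have "shifted_symmetrizer B C n ?yx v = y [] * shifted_symmetrizer B C n x v" if v: "length v = Suc n" for v
  proof -
    obtain b u where u: "v = b # u" "length u = n" using v by (cases v) auto
    have "(\<lambda>u. ?yx (b # u)) = (\<lambda>u. y [] * x (b # u) + 1 * ((\<lambda>v. y (b # v)) \<otimes>\<^bsub>tensor_algebra B\<^esub> x) u)"
      by (simp add: tensor_mult_Cons)
    then show ?thesis
      using Suc.IH[of u] u by (simp only: shifted_symmetrizer_Cons quantum_symmetrizer_linear) simp
  qed
  then have "left_step n (shifted_symmetrizer B C n ?yx) w = y [] * left_step n (shifted_symmetrizer B C n x) w"
    unfolding left_step_scale[symmetric] by (intro left_step_cong) (simp add: Suc.prems)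
  then show ?case
    using assms[of w] Suc.prems quantum_symmetrizer_left[of n w x] quantum_symmetrizer_left[of n w ?yx]
    by (simp del: quantum_symmetrizer.simps)
qed

lemma ideal_nichols_ideal: "ideal (nichols_ideal B C) (tensor_algebra B)"
proof (rule idealI)
  show "ring (tensor_algebra B)" by (rule ring_tensor_algebra)
  interpret T: ring "tensor_algebra B" by (rule ring_tensor_algebra)
  show "subgroup (nichols_ideal B C) (add_monoid (tensor_algebra B))"
  proof (rule T.add.subgroupI)
    show "nichols_ideal B C \<subseteq> carrier (tensor_algebra B)" by (auto simp: nichols_ideal_iff)
    have "(\<lambda>_. 0) \<in> nichols_ideal B C"
      using T.zero_closed by (simp add: nichols_ideal_iff quantum_symmetrizer_zero tensor_simps)
    then show "nichols_ideal B C \<noteq> {}" by blast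
  next
    fix x assume x: "x \<in> nichols_ideal B C"
    then have c: "x \<in> carrier (tensor_algebra B)" by (simp add: nichols_ideal_iff)
    have "\<ominus>\<^bsub>tensor_algebra B\<^esub> x = (\<lambda>w. - x w)"
      by (rule T.minus_equality) (simp_all add: tensor_simps c tensor_uminus)
    moreover have "quantum_symmetrizer B C n (\<lambda>w. - x w) = (\<lambda>w. - quantum_symmetrizer B C n x w)" for n
      using quantum_symmetrizer_linear[of B C n "-1" x 0 x] by simp
    ultimately show "\<ominus>\<^bsub>tensor_algebra B\<^esub> x \<in> nichols_ideal B C"
      using x by (simp add: nichols_ideal_iff tensor_uminus)
  next
    fix x y assume "x \<in> nichols_ideal B C" "y \<in> nichols_ideal B C"
    then show "x \<oplus>\<^bsub>tensor_algebra B\<^esub> y \<in> nichols_ideal B C"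
      using tensor_linear_closed[of x B y 1 1] quantum_symmetrizer_linear[of B C _ 1 x 1 y]
      by (simp add: nichols_ideal_iff tensor_simps)
  qed
  fix a x assume "a \<in> nichols_ideal B C" "x \<in> carrier (tensor_algebra B)"
  then show "x \<otimes>\<^bsub>tensor_algebra B\<^esub> a \<in> nichols_ideal B C" "a \<otimes>\<^bsub>tensor_algebra B\<^esub> x \<in> nichols_ideal B C"
    using quantum_symmetrizer_mult_left[of a] quantum_symmetrizer_mult_right[of B C a]
    by (simp_all add: nichols_ideal_iff tensor_mult_closed)
qed

lemma ring_nichols_algebra: "ring (nichols_algebra B C)"
  unfolding nichols_algebra_def by (rule ideal.quotient_is_ring[OF ideal_nichols_ideal])

end

section \<open>Finite dimension bounds the degree\<close>

context group_type_braiding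
begin

text \<open>Each basis vector has a representative of finite support, so in large degrees all
  elements of a finite-dimensional span agree with elements of the ideal.\<close>

lemma dimension_degree_bound:
  assumes "ring.dimension (nichols_algebra B C) n K E" "K = nichols_scalars B C"
  shows "\<exists>N. \<forall>X\<in>E. \<forall>x\<in>X. \<exists>j\<in>nichols_ideal B C. \<forall>w. N \<le> length w \<longrightarrow> x w = j w"
  using assms
proof (induction rule: ring.dimension.induct[OF ring_nichols_algebra, consumes 1])
  case (1 K)
  have "\<zero>\<^bsub>nichols_algebra B C\<^esub> = nichols_ideal B C" by (simp add: nichols_algebra_def FactRing_def)
  then show ?case by auto
next
  case (2 v E n K)
  let ?T = "tensor_algebra B" and ?J = "nichols_ideal B C"
  interpret J: ideal ?J ?T by (rule ideal_nichols_ideal)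
  from 2 obtain N where N: "\<And>X x. X \<in> E \<Longrightarrow> x \<in> X \<Longrightarrow> \<exists>j\<in>?J. \<forall>w. N \<le> length w \<longrightarrow> x w = j w"
    by blast
  from 2(1) obtain y where y: "y \<in> carrier ?T" "v = ?J +>\<^bsub>?T\<^esub> y"
    by (auto simp: nichols_algebra_def FactRing_def A_RCOSETS_def')
  have "finite (length ` {w. y w \<noteq> 0})" using y(1) by (simp add: tensor_carrier_iff)
  then obtain N' where "\<forall>k\<in>length ` {w. y w \<noteq> 0}. k < N'" by (auto simp: finite_nat_set_iff_bounded)
  then have N': "y w = 0" if "N' \<le> length w" for w using that by fastforce
  have "\<exists>j\<in>?J. \<forall>w. max N N' \<le> length w \<longrightarrow> x w = j w"
    if X: "X \<in> ring.line_extension (nichols_algebra B C) K v E" and x: "x \<in> X" for X x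
  proof -
    obtain k e where k: "k \<in> nichols_scalars B C" and e: "e \<in> E"
      and X: "X = k \<otimes>\<^bsub>nichols_algebra B C\<^esub> v \<oplus>\<^bsub>nichols_algebra B C\<^esub> e"
      using X 2 ring.line_extension_mem_iff[OF ring_nichols_algebra] by metis
    obtain a where a: "k = ?J +>\<^bsub>?T\<^esub> tensor_scalar a" using k by (auto simp: nichols_scalars_def)
    have "k \<otimes>\<^bsub>nichols_algebra B C\<^esub> v = ?J +>\<^bsub>?T\<^esub> (tensor_scalar a \<otimes>\<^bsub>?T\<^esub> y)"
      using J.rcoset_mult_add[OF tensor_scalar_closed y(1)]
      by (simp add: nichols_algebra_def FactRing_def a y(2))
    then obtain q z where q: "q \<in> ?J" and z: "z \<in> e"
      and x: "x = (q \<oplus>\<^bsub>?T\<^esub> (tensor_scalar a \<otimes>\<^bsub>?T\<^esub> y)) \<oplus>\<^bsub>?T\<^esub> z"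
      using x X by (auto simp: nichols_algebra_def FactRing_def set_add_def' a_r_coset_def')
    obtain j where j: "j \<in> ?J" "\<And>w. N \<le> length w \<Longrightarrow> z w = j w" using N[OF e z] by blast
    have "x w = (q \<oplus>\<^bsub>?T\<^esub> j) w" if "max N N' \<le> length w" for w
      using that by (simp add: x tensor_simps(2) tensor_scalar_mult_left N' j(2))
    moreover have "q \<oplus>\<^bsub>?T\<^esub> j \<in> ?J" using additive_subgroup.a_closed[OF ideal.axioms(1)[OF ideal_nichols_ideal]] q j(1) by blast
    ultimately show ?thesis by blast
  qed
  then show ?case by blast
qed

lemma finite_dim_degree_bound:
  assumes "nichols_finite_dim B C"
  shows "\<exists>N. \<forall>x w. x \<in> carrier (tensor_algebra B) \<longrightarrow> N \<le> length w \<longrightarrow>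
    quantum_symmetrizer B C (length w) x w = 0"
proof -
  let ?T = "tensor_algebra B" and ?J = "nichols_ideal B C"
  interpret J: ideal ?J ?T by (rule ideal_nichols_ideal)
  obtain n where "ring.dimension (nichols_algebra B C) n (nichols_scalars B C) (carrier (nichols_algebra B C))"
    using assms unfolding nichols_finite_dim_def ring.finite_dimension_def[OF ring_nichols_algebra] by blast
  from dimension_degree_bound[OF this refl] obtain N where
    N: "\<And>X x. X \<in> carrier (nichols_algebra B C) \<Longrightarrow> x \<in> X \<Longrightarrow> \<exists>j\<in>?J. \<forall>w. N \<le> length w \<longrightarrow> x w = j w"
    by blast
  have "quantum_symmetrizer B C (length w) x w = 0" if x: "x \<in> carrier ?T" and w: "N \<le> length w" for x w
  proof -
    have "?J +>\<^bsub>?T\<^esub> x \<in> carrier (nichols_algebra B C)"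
      using x by (auto simp: nichols_algebra_def FactRing_def A_RCOSETS_def')
    from N[OF this J.a_rcos_self[OF x]] obtain j where j: "j \<in> ?J" "\<And>w. N \<le> length w \<Longrightarrow> x w = j w" by blast
    have "quantum_symmetrizer B C (length w) x w = quantum_symmetrizer B C (length w) j w"
      by (rule quantum_symmetrizer_cong) (use j(2) w in simp)
    then show ?thesis using j(1) by (simp add: nichols_ideal_iff)
  qed
  then show ?thesis by blast
qed

end

section \<open>Restriction to a braided subspace of diagonal type\<close>

context group_type_braiding
begin

lemma braid_at_diagonal:
  assumes D: "D \<subseteq> B" "\<And>a b \<alpha>. a \<in> D \<Longrightarrow> b \<in> D \<Longrightarrow> M a \<alpha> b = (if \<alpha> = b then Q a b else 0)"
    and x: "\<And>w. x w \<noteq> 0 \<Longrightarrow> w \<in> lists D" and u: "length u = i"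
  shows "braid_at B C i x (u @ \<alpha> # \<beta> # v) = Q \<beta> \<alpha> * x (u @ \<beta> # \<alpha> # v)"
proof (cases "\<beta> \<in> D")
  case True
  have "M \<beta> \<alpha> b * x (u @ \<beta> # b # v) = (if b = \<alpha> then Q \<beta> \<alpha> * x (u @ \<beta> # \<alpha> # v) else 0)" for b
    using D(2)[OF True, of b \<alpha>] x[of "u @ \<beta> # b # v"] by (cases "x (u @ \<beta> # b # v) = 0") auto
  then have "braid_at B C i x (u @ \<alpha> # \<beta> # v) = (if \<alpha> \<in> B then Q \<beta> \<alpha> * x (u @ \<beta> # \<alpha> # v) else 0)"
    using True D(1) finite_basis by (simp add: braid_at_eq[OF u] subset_iff)
  then show ?thesis using x[of "u @ \<beta> # \<alpha> # v"] D(1) by (auto simp: subset_iff)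
next
  case False
  then have "x (u @ \<beta> # b # v) = 0" for b using x[of "u @ \<beta> # b # v"] by auto
  then show ?thesis by (simp add: braid_at_eq[OF u])
qed

lemma braid_at_support:
  assumes D: "D \<subseteq> B" "\<And>a b \<alpha>. a \<in> D \<Longrightarrow> b \<in> D \<Longrightarrow> M a \<alpha> b = (if \<alpha> = b then Q a b else 0)"
    and x: "\<And>w. x w \<noteq> 0 \<Longrightarrow> w \<in> lists D" and w: "braid_at B C i x w \<noteq> 0"
  shows "w \<in> lists D"
proof (cases "Suc i < length w")
  case True
  have eq: "w = take i w @ w ! i # w ! Suc i # drop (Suc (Suc i)) w"
    using True by (simp add: Cons_nth_drop_Suc)
  have "length (take i w) = i" using True by simp
  from braid_at_diagonal[where x = x, OF D x this] w
  have "x (take i w @ w ! Suc i # w ! i # drop (Suc (Suc i)) w) \<noteq> 0"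
    by (subst (asm) eq) auto
  from x[OF this] show ?thesis by (subst eq) auto
next
  case False
  then show ?thesis using w x by (simp add: braid_at_def)
qed

text \<open>The product c_k ... c_(n-1) carries the last letter \<open>i\<close> to position k, so
  the sum inserts \<open>i\<close> everywhere. Words are reversed because the symmetrizer acquires
  letters on the right and \<open>insert_diagonal\<close> on the left.\<close>

lemma braids_diagonal:
  assumes D: "D \<subseteq> B" "\<And>a b \<alpha>. a \<in> D \<Longrightarrow> b \<in> D \<Longrightarrow> M a \<alpha> b = (if \<alpha> = b then Q a b else 0)"
  shows "\<lbrakk>\<And>w. y w \<noteq> 0 \<Longrightarrow> w \<in> lists D; \<And>v b. length v = n \<Longrightarrow> y (v @ [b]) = (if b = i then \<phi> v else 0);
      length W = Suc n\<rbrakk> \<Longrightarrow>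
    (\<Sum>k\<le>n. braids B C [k..<n] y (rev W)) = insert_diagonal Q i (\<lambda>z. \<phi> (rev z)) W"
proof (induction n arbitrary: y \<phi> W)
  case 0
  obtain x where "W = [x]" using 0(3) by (cases W) auto
  then show ?case using 0(2)[of "[]" x] by simp
next
  case (Suc n)
  obtain x W' where W: "W = x # W'" "length W' = Suc n" using Suc.prems(3) by (cases W) auto
  let ?y = "\<lambda>v. braid_at B C n y (v @ [x])"
  have supp: "v \<in> lists D" if "?y v \<noteq> 0" for v
    using braid_at_support[where x = y, OF D Suc.prems(1) that] by simp
  have y: "?y (v @ [b]) = (if b = i then Q x i * \<phi> (v @ [x]) else 0)" if v: "length v = n" for v b
    using braid_at_diagonal[where x = y, OF D Suc.prems(1) v, of b x "[]"] Suc.prems(2)[of "v @ [x]" b] v by simp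
  have "braids B C [k..<Suc n] y (rev W) = braids B C [k..<n] ?y (rev W')" if "k \<le> n" for k
    using that W by (simp add: braids_snoc)
  then have "(\<Sum>k\<le>Suc n. braids B C [k..<Suc n] y (rev W))
      = (\<Sum>k\<le>n. braids B C [k..<n] ?y (rev W')) + y (rev W' @ [x])"
    using W by simp
  also have "\<dots> = insert_diagonal Q i (\<lambda>z. Q x i * \<phi> (rev z @ [x])) W' + (if x = i then \<phi> (rev W') else 0)"
    using Suc.IH[of ?y "\<lambda>v. Q x i * \<phi> (v @ [x])", OF supp y W(2)] Suc.prems(2)[of "rev W'" x] W(2) by simp
  also have "\<dots> = insert_diagonal Q i (\<lambda>z. \<phi> (rev z)) W"
    by (simp add: W insert_diagonal_scale)
  finally show ?case .
qed

lemma quantum_symmetrizer_support: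
  assumes D: "D \<subseteq> B" "\<And>a b \<alpha>. a \<in> D \<Longrightarrow> b \<in> D \<Longrightarrow> M a \<alpha> b = (if \<alpha> = b then Q a b else 0)"
    and x: "\<And>w. x w \<noteq> 0 \<Longrightarrow> w \<in> lists D"
  shows "quantum_symmetrizer B C n x w \<noteq> 0 \<Longrightarrow> w \<in> lists D"
proof (induction n arbitrary: w)
  case (Suc n)
  have "braids B C js y w \<noteq> 0 \<Longrightarrow> w \<in> lists D" if "\<And>w. y w \<noteq> 0 \<Longrightarrow> w \<in> lists D" for js y w
    using that
  proof (induction js arbitrary: w)
    case (Cons j js)
    have y: "v \<in> lists D" if "braids B C js y v \<noteq> 0" for v
      using Cons.IH[OF that] Cons.prems(2) by blast
    have w: "braid_at B C j (braids B C js y) w \<noteq> 0" using Cons.prems(1) by simp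
    show ?case by (rule braid_at_support[where x = "braids B C js y", OF D y w])
  qed simp
  moreover obtain k where "braids B C [k..<n] (quantum_symmetrizer B C n x) w \<noteq> 0"
    using Suc.prems by (auto elim: sum.not_neutral_contains_not_neutral)
  ultimately show ?case using Suc.IH by blast
qed (use x in simp)

text \<open>Up to reversal, \<open>diagonal_word Q r\<close> is the column of the quantum
  symmetrizer at the basis word \<open>r\<close>.\<close>

lemma quantum_symmetrizer_diagonal:
  assumes D: "D \<subseteq> B" "\<And>a b \<alpha>. a \<in> D \<Longrightarrow> b \<in> D \<Longrightarrow> M a \<alpha> b = (if \<alpha> = b then Q a b else 0)"
  shows "r \<in> lists D \<Longrightarrow> length w = length r \<Longrightarrow>
    quantum_symmetrizer B C (length r) (\<lambda>v. if v = rev r then 1 else 0) (rev w) = diagonal_word Q r w"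
proof (induction r arbitrary: w)
  case (Cons i r)
  let ?n = "length r" and ?x = "\<lambda>v. if v = rev (i # r) then 1 else 0 :: complex"
  let ?y = "quantum_symmetrizer B C ?n ?x"
  have "v \<in> lists D" if "?y v \<noteq> 0" for v
    by (rule quantum_symmetrizer_support[where x = ?x, OF D _ that]) (use Cons.prems in \<open>auto split: if_splits\<close>)
  moreover have "?y (v @ [b]) = (if b = i then quantum_symmetrizer B C ?n (\<lambda>v. if v = rev r then 1 else 0) v else 0)"
    if "length v = ?n" for v b
    using that by (auto simp: quantum_symmetrizer_snoc quantum_symmetrizer_zero)
  ultimately have "(\<Sum>k\<le>?n. braids B C [k..<?n] ?y (rev w))
     = insert_diagonal Q i (\<lambda>z. quantum_symmetrizer B C ?n (\<lambda>v. if v = rev r then 1 else 0) (rev z)) w"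
    using braids_diagonal[OF D, of ?y ?n i _ w] Cons.prems(2) by simp
  also have "\<dots> = insert_diagonal Q i (diagonal_word Q r) w"
    using Cons by (intro insert_diagonal_cong) simp
  finally show ?case by simp
qed simp

lemma diagonal_word_bound:
  assumes D: "D \<subseteq> B" "\<And>a b \<alpha>. a \<in> D \<Longrightarrow> b \<in> D \<Longrightarrow> M a \<alpha> b = (if \<alpha> = b then Q a b else 0)"
    and "nichols_finite_dim B C"
  shows "\<exists>N. \<forall>r w. r \<in> lists D \<longrightarrow> N \<le> length r \<longrightarrow> diagonal_word Q r w = 0"
proof -
  obtain N where N: "\<And>x w. x \<in> carrier (tensor_algebra B) \<Longrightarrow> N \<le> length w \<Longrightarrow>
    quantum_symmetrizer B C (length w) x w = 0"
    using finite_dim_degree_bound[OF assms(3)] by blast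
  have "diagonal_word Q r w = 0" if r: "r \<in> lists D" "N \<le> length r" for r w
  proof (cases "length w = length r")
    case True
    have "{v. (if v = rev r then 1 else 0 :: complex) \<noteq> 0} = {rev r}" by auto
    moreover have "rev r \<in> lists B" using r D(1) by auto
    ultimately have "(\<lambda>v. if v = rev r then 1 else 0) \<in> carrier (tensor_algebra B)"
      by (simp add: tensor_carrier_iff)
    from N[OF this, of "rev w"] show ?thesis
      using quantum_symmetrizer_diagonal[OF D r(1) True] True r(2) by simp
  next
    case False
    then show ?thesis using diagonal_word_mset[of Q r w] by (metis size_mset)
  qed
  then show ?thesis by blast
qed

end

section \<open>From the Cartan matrix to twist-equivalent braidings\<close>

context symmetric_cartan_braiding
begin

lemma insert_diagonal_sum_list:
  "insert_diagonal Q i (\<lambda>w. \<Sum>(a, r)\<leftarrow>cs. a * f r w) w = (\<Sum>(a, r)\<leftarrow>cs. a * insert_diagonal Q i (f r) w)"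
proof (induction cs)
  case Nil
  show ?case using insert_diagonal_scale[of Q i 0 "\<lambda>_. 0" w] by simp
next
  case (Cons c cs)
  obtain a r where c: "c = (a, r)" by (cases c)
  show ?case
    using insert_diagonal_linear[of Q i a "f r" 1 "\<lambda>w. \<Sum>(a, r)\<leftarrow>cs. a * f r w" w] Cons by (simp add: c)
qed

lemma nichols_words:
  "nichols_component I \<beta> \<phi> \<Longrightarrow> \<exists>cs. (\<forall>w. \<phi> w = (\<Sum>(a, r)\<leftarrow>cs. a * diagonal_word (\<lambda>x y. p powi cartan x y) r w))
    \<and> (\<forall>(a, r)\<in>set cs. r \<in> lists I \<and> mset r = \<beta>)"
proof (induction rule: nichols_component.induct)
  case unit
  show ?case by (rule exI[of _ "[(1, [])]"]) simp
next
  case (mult i \<beta> \<phi>)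
  then obtain cs where cs: "\<And>w. \<phi> w = (\<Sum>(a, r)\<leftarrow>cs. a * diagonal_word (\<lambda>x y. p powi cartan x y) r w)"
    "\<forall>(a, r)\<in>set cs. r \<in> lists I \<and> mset r = \<beta>" by blast
  have \<phi>: "\<phi> = (\<lambda>w. \<Sum>(a, r)\<leftarrow>cs. a * diagonal_word (\<lambda>x y. p powi cartan x y) r w)"
    using cs(1) by blast
  have "left_insert i \<phi> w = (\<Sum>(a, r)\<leftarrow>map (\<lambda>(a, r). (a, i # r)) cs.
      a * diagonal_word (\<lambda>x y. p powi cartan x y) r w)" for w
    unfolding \<phi> insert_diagonal_sum_list by (simp add: o_def case_prod_unfold)
  moreover have "\<forall>(a, r)\<in>set (map (\<lambda>(a, r). (a, i # r)) cs). r \<in> lists I \<and> mset r = add_mset i \<beta>"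
    using cs(2) mult.hyps(1) by fastforce
  ultimately show ?case by blast
next
  case (zero \<beta>)
  show ?case by (rule exI[of _ "[]"]) simp
next
  case (linear \<beta> \<phi> \<psi> a b)
  then obtain cs ds where cs: "\<And>w. \<phi> w = (\<Sum>(a, r)\<leftarrow>cs. a * diagonal_word (\<lambda>x y. p powi cartan x y) r w)"
    "\<forall>(a, r)\<in>set cs. r \<in> lists I \<and> mset r = \<beta>"
    and ds: "\<And>w. \<psi> w = (\<Sum>(a, r)\<leftarrow>ds. a * diagonal_word (\<lambda>x y. p powi cartan x y) r w)"
    "\<forall>(a, r)\<in>set ds. r \<in> lists I \<and> mset r = \<beta>" by blast
  have "a * \<phi> w + b * \<psi> w = (\<Sum>(c, r)\<leftarrow>map (\<lambda>(c, r). (a * c, r)) cs @ map (\<lambda>(c, r). (b * c, r)) ds.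
      c * diagonal_word (\<lambda>x y. p powi cartan x y) r w)" for w
    by (simp add: cs(1) ds(1) o_def case_prod_unfold mult.assoc flip: sum_list_const_mult)
  moreover have "\<forall>(c, r)\<in>set (map (\<lambda>(c, r). (a * c, r)) cs @ map (\<lambda>(c, r). (b * c, r)) ds).
      r \<in> lists I \<and> mset r = \<beta>"
    using cs(2) ds(2) by fastforce
  ultimately show ?case by blast
qed

lemma diagonal_words_infinite:
  assumes "finite I" "2 \<le> h * (card I - 1)"
  shows "\<exists>r w. r \<in> lists I \<and> N \<le> length r \<and> diagonal_word (\<lambda>x y. p powi cartan x y) r w \<noteq> 0"
proof (rule ccontr)
  assume *: "\<not> ?thesis"
  show False
  proof (rule nichols_infinite[OF assms])
    fix \<beta> \<phi> w assume \<phi>: "nichols_component I \<beta> \<phi>" "\<phi> w \<noteq> 0"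
    from nichols_words[OF \<phi>(1)] obtain cs where
      "\<phi> w = (\<Sum>(a, r)\<leftarrow>cs. a * diagonal_word (\<lambda>x y. p powi cartan x y) r w)"
      "\<forall>(a, r)\<in>set cs. r \<in> lists I \<and> mset r = \<beta>" by blast
    moreover have "(\<Sum>(a, r)\<leftarrow>cs. a * diagonal_word (\<lambda>x y. p powi cartan x y) r w) = 0"
      if "\<forall>(a, r)\<in>set cs. diagonal_word (\<lambda>x y. p powi cartan x y) r w = 0"
      using that by (induction cs) auto
    ultimately obtain a r where "r \<in> lists I" "mset r = \<beta>"
      "diagonal_word (\<lambda>x y. p powi cartan x y) r w \<noteq> 0" using \<phi>(2) by fastforce
    with * show "size \<beta> < N" by (metis not_le size_mset)
  qed
qed

end

text \<open>An injection into the naturals selects one order of each pair of letters of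
  \<open>D\<close>; there \<open>\<sigma>\<close> is the quotient of \<open>Q\<close> by
  \<open>R\<close>, and 1 elsewhere. In the opposite order the relation is the equality of the
  products.\<close>

lemma inj_twist:
  assumes "finite D" and nz: "\<And>x y. R x y \<noteq> (0 :: complex)" "\<And>x y. Q x y \<noteq> 0"
    and eq: "\<And>x y. x \<notin> D \<or> y \<notin> D \<or> x = y \<Longrightarrow> Q x y = R x y"
    and prod: "\<And>x y. Q x y * Q y x = R x y * R y x"
  shows "\<exists>\<sigma>. (\<forall>x y. \<sigma> x y \<noteq> 0) \<and> (\<forall>x i. R x i * \<sigma> i x = Q x i * \<sigma> x i)"
proof -
  obtain f :: "'a \<Rightarrow> nat" where f: "inj_on f D"
    using finite_imp_inj_to_nat_seg[OF assms(1)] by blast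
  define \<sigma> where "\<sigma> i x = (if i \<in> D \<and> x \<in> D \<and> f i < f x then Q x i / R x i else 1)" for i x
  have "R x i * \<sigma> i x = Q x i * \<sigma> x i" for x i
  proof (cases "x \<in> D \<and> i \<in> D \<and> x \<noteq> i")
    case True
    then consider "f i < f x" | "f x < f i" using f by (metis inj_on_def linorder_neqE_nat)
    then show ?thesis
    proof cases
      case 1
      then show ?thesis using True nz by (simp add: \<sigma>_def)
    next
      case 2
      then show ?thesis using True nz prod[of x i] by (simp add: \<sigma>_def field_simps)
    qed
  next
    case False
    then show ?thesis using eq[of x i] by (auto simp: \<sigma>_def)
  qed
  moreover have "\<sigma> x y \<noteq> 0" for x y using nz by (simp add: \<sigma>_def)
  ultimately show ?thesis by blast
qed

lemma twist_nonzero: "(\<And>x y. \<sigma> x y \<noteq> 0) \<Longrightarrow> twist \<sigma> w \<noteq> 0"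
  by (induction w) (auto simp: word_weight_def prod_list_zero_iff)

context group_type_braiding
begin

theorem cartan_type_infinite:
  assumes D: "D \<subseteq> B" "\<And>a b \<alpha>. a \<in> D \<Longrightarrow> b \<in> D \<Longrightarrow> M a \<alpha> b = (if \<alpha> = b then Q a b else 0)"
    and p: "p \<noteq> 0" "0 < h" "\<And>m. 0 < m \<Longrightarrow> m \<le> h \<Longrightarrow> p ^ (2 * m) \<noteq> 1"
    and Q: "\<And>a. a \<in> D \<Longrightarrow> Q a a = p\<^sup>2" "\<And>a b. a \<in> D \<Longrightarrow> b \<in> D \<Longrightarrow> a \<noteq> b \<Longrightarrow> Q a b * Q b a * p ^ (2 * h) = 1"
    and card: "2 \<le> h * (card D - 1)"
  shows "\<not> nichols_finite_dim B C"
proof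
  assume fin: "nichols_finite_dim B C"
  interpret S: symmetric_cartan_braiding p h by unfold_locales (use p in auto)
  let ?R = "\<lambda>x y :: 'b. p powi S.cartan x y"
  \<comment> \<open>The twist relation is needed for all letters of the type, so \<open>Q\<close> is
    completed outside \<open>D\<close> by the Cartan matrix.\<close>
  define Q' where "Q' a b = (if a \<in> D \<and> b \<in> D then Q a b else ?R a b)" for a b
  have finD: "finite D" using D(1) finite_basis by (rule finite_subset)
  have R: "?R x y * ?R y x * p ^ (2 * h) = 1" if "x \<noteq> y" for x y
  proof -
    have "?R x y * ?R y x * p ^ (2 * h) = p powi (- int h) * p powi (- int h) * p powi int (2 * h)"
      using that by (simp add: S.cartan_neq power_int_of_nat del: of_nat_mult)
    also have "\<dots> = 1" by (simp flip: S.powi_add)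
    finally show ?thesis .
  qed
  have Q': "Q' x y * Q' y x = ?R x y * ?R y x" for x y
  proof (cases "x \<in> D \<and> y \<in> D")
    case True
    show ?thesis
    proof (cases "x = y")
      case True
      then show ?thesis using Q(1) by (simp add: Q'_def)
    next
      case False
      then have "Q x y * Q y x * p ^ (2 * h) = ?R x y * ?R y x * p ^ (2 * h)"
        using True Q(2) R by simp
      then show ?thesis using True p(1) by (simp add: Q'_def)
    qed
  qed (auto simp: Q'_def)
  have "\<exists>\<sigma>. (\<forall>x y. \<sigma> x y \<noteq> 0) \<and> (\<forall>x i. ?R x i * \<sigma> i x = Q' x i * \<sigma> x i)"
  proof (rule inj_twist[OF finD])
    show "?R x y \<noteq> 0" for x y using p(1) by simp
    show "Q' x y \<noteq> 0" for x y using Q'[of x y] p(1) by auto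
    show "Q' x y = ?R x y" if "x \<notin> D \<or> y \<notin> D \<or> x = y" for x y
      using that Q(1) by (auto simp: Q'_def)
  qed (rule Q')
  then obtain \<sigma> where \<sigma>: "\<And>x y. \<sigma> x y \<noteq> 0" "\<And>x i. ?R x i * \<sigma> i x = Q' x i * \<sigma> x i" by blast
  have "M a \<alpha> b = (if \<alpha> = b then Q' a b else 0)" if "a \<in> D" "b \<in> D" for a b \<alpha>
    using D(2) that by (simp add: Q'_def)
  from diagonal_word_bound[OF D(1) this fin] obtain N where
    N: "\<And>r w. r \<in> lists D \<Longrightarrow> N \<le> length r \<Longrightarrow> diagonal_word Q' r w = 0" by blast
  obtain r w where r: "r \<in> lists D" "N \<le> length r" "diagonal_word ?R r w \<noteq> 0"
    using S.diagonal_words_infinite[OF finD card] by blast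
  have "diagonal_word Q' r w * twist \<sigma> w = diagonal_word ?R r w * twist \<sigma> r"
    by (rule diagonal_word_twist) (rule \<sigma>(2))
  then show False using r N[OF r(1,2)] twist_nonzero[of \<sigma>, OF \<sigma>(1)] by simp
qed

text \<open>A single letter with trivial self-braiding generates a polynomial ring: the coefficient
  of its m-th power is m!, which is nonzero over the complex numbers.\<close>

theorem trivial_type_infinite:
  assumes "a \<in> B" "\<And>\<alpha>. M a \<alpha> a = (if \<alpha> = a then 1 else 0)"
  shows "\<not> nichols_finite_dim B C"
proof
  assume fin: "nichols_finite_dim B C"
  have "M b \<alpha> c = (if \<alpha> = c then 1 else 0)" if "b \<in> {a}" "c \<in> {a}" for b c \<alpha>
    using assms(2) that by auto
  from diagonal_word_bound[where D = "{a}" and Q = "\<lambda>_ _. 1", OF _ this fin] assms(1) obtain N where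
    N: "\<And>r w. r \<in> lists {a} \<Longrightarrow> N \<le> length r \<Longrightarrow> diagonal_word (\<lambda>_ _. 1) r w = 0" by blast
  have I: "insert_diagonal (\<lambda>_ _. 1) a \<phi> (replicate (Suc m) a) = of_nat (Suc m) * \<phi> (replicate m a)" for \<phi> m
  proof (induction m arbitrary: \<phi>)
    case (Suc m)
    then show ?case by (simp add: algebra_simps)
  qed simp
  have "diagonal_word (\<lambda>_ _. 1) (replicate m a) (replicate m a) = fact m" for m
  proof (induction m)
    case (Suc m)
    have "diagonal_word (\<lambda>_ _. 1) (replicate (Suc m) a) (replicate (Suc m) a)
        = of_nat (Suc m) * diagonal_word (\<lambda>_ _. 1) (replicate m a) (replicate m a)"
      unfolding I[symmetric] by simp
    then show ?case using Suc by simp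
  qed simp
  moreover have "replicate N a \<in> lists {a}" by auto
  ultimately show False using N[of "replicate N a" "replicate N a"] by (simp del: in_lists_conv_set)
qed

end

lemma mat_mult_vector: "mat c *v x = c *s (x :: complex^'n)"
  by (simp add: vec_eq_iff matrix_vector_mult_def mat_def if_distrib if_distribR cong: if_cong)

lemma mat_mult_mat: "mat c ** mat d = (mat (c * d) :: complex^'n^'n)"
proof -
  have "(mat c ** mat d) *v x = (mat (c * d) :: complex^'n^'n) *v x" for x
    by (simp only: matrix_vector_mul_assoc[symmetric] mat_mult_vector vec.scale_scale)
  then show ?thesis by (simp add: matrix_eq)
qed

lemma mat_inject: "mat c = (mat d :: complex^'n^'n) \<Longrightarrow> c = d"
  by (auto simp: mat_def vec_eq_iff split: if_splits)

section \<open>Yetter-Drinfeld modules\<close>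

locale yd_module = group G for G :: "('g, 'm) monoid_scheme" (structure) +
  fixes s :: 'g and \<rho> :: "'g \<Rightarrow> complex^'n^'n" and g :: "'g \<Rightarrow> 'g"
  assumes finite_carrier: "finite (carrier G)"
    and s_closed: "s \<in> carrier G"
    and rep_hom: "\<rho> \<in> hom (G\<lparr>carrier := centralizer G s\<rparr>) general_linear"
    and choice: "conj_choice G s g"
begin

definition action_matrix :: "'g \<Rightarrow> 'g \<times> 'n \<Rightarrow> 'g \<times> 'n \<Rightarrow> complex" where
  "action_matrix h \<alpha> b = yd_action G \<rho> g h (fst b) (axis (snd b) 1) (fst \<alpha>) $ snd \<alpha>"

lemma action_matrix_eq:
  "action_matrix h (t, k) (u, l) = (if t = yd_target G h u then \<rho> (yd_cocycle G g h u) $ k $ l else 0)"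
  by (simp add: action_matrix_def yd_action_def yd_elem_def matrix_vector_mult_def axis_def
      if_distrib cong: if_cong)

lemma rep_mult: "x \<in> centralizer G s \<Longrightarrow> y \<in> centralizer G s \<Longrightarrow> \<rho> (x \<otimes> y) = \<rho> x ** \<rho> y"
  using rep_hom by (auto simp: hom_def general_linear_def)

lemma class_closed: "t \<in> conj_class G s \<Longrightarrow> t \<in> carrier G"
  using s_closed by (auto simp: conj_class_def)

lemma yd_target_closed: "h \<in> carrier G \<Longrightarrow> t \<in> conj_class G s \<Longrightarrow> yd_target G h t \<in> conj_class G s"
  by (rule yd_cocycle(1)[OF is_group s_closed choice])

lemma cocycle_closed: "h \<in> carrier G \<Longrightarrow> t \<in> conj_class G s \<Longrightarrow> yd_cocycle G g h t \<in> centralizer G s"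
  by (rule yd_cocycle(2)[OF is_group s_closed choice])

lemma choice_closed: "t \<in> conj_class G s \<Longrightarrow> g t \<in> carrier G"
  and choice_conj: "t \<in> conj_class G s \<Longrightarrow> g t \<otimes> s \<otimes> inv (g t) = t"
  using choice by (auto simp: conj_choice_def)

lemma yd_target_mult:
  "h \<in> carrier G \<Longrightarrow> h' \<in> carrier G \<Longrightarrow> t \<in> carrier G \<Longrightarrow> yd_target G (h \<otimes> h') t = yd_target G h (yd_target G h' t)"
  by (simp add: yd_target_def m_assoc inv_mult_group)

lemma yd_cocycle_mult:
  assumes "h \<in> carrier G" "h' \<in> carrier G" "t \<in> conj_class G s"
  shows "yd_cocycle G g (h \<otimes> h') t = yd_cocycle G g h (yd_target G h' t) \<otimes> yd_cocycle G g h' t"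
proof -
  let ?u = "yd_target G h' t" and ?v = "yd_target G h (yd_target G h' t)"
  have u: "?u \<in> conj_class G s" and v: "?v \<in> conj_class G s"
    using assms yd_target_closed by auto
  note cl = choice_closed[OF u] choice_closed[OF v] choice_closed[OF assms(3)] assms(1,2)
  have "inv (g ?v) \<otimes> h \<otimes> g ?u \<otimes> (inv (g ?u) \<otimes> h' \<otimes> g t) = inv (g ?v) \<otimes> (h \<otimes> h') \<otimes> g t"
    using cl by (simp add: m_assoc) (simp add: m_assoc[symmetric])
  then show ?thesis
    using assms class_closed by (simp add: yd_cocycle_def yd_target_mult)
qed

lemma finite_class: "finite (conj_class G s)"
  by (rule finite_subset[OF _ finite_carrier]) (use class_closed in auto)

lemma action_matrix_mult:
  assumes "h \<in> carrier G" "h' \<in> carrier G" "r \<in> conj_class G s"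
  shows "(\<Sum>b\<in>yd_basis G s. action_matrix h \<alpha> b * action_matrix h' b (r, l)) = action_matrix (h \<otimes> h') \<alpha> (r, l)"
proof -
  obtain t k where \<alpha>: "\<alpha> = (t, k)" by (cases \<alpha>)
  let ?v = "yd_target G h' r"
  have v: "?v \<in> conj_class G s" using assms by (simp add: yd_target_closed)
  have "(\<Sum>b\<in>yd_basis G s. action_matrix h \<alpha> b * action_matrix h' b (r, l))
    = (\<Sum>u\<in>conj_class G s. \<Sum>j\<in>UNIV. action_matrix h \<alpha> (u, j) * action_matrix h' (u, j) (r, l))"
    by (simp add: yd_basis_def sum.cartesian_product)
  also have "\<dots> = (\<Sum>u\<in>conj_class G s. if ?v = u then
      \<Sum>j\<in>UNIV. action_matrix h \<alpha> (?v, j) * \<rho> (yd_cocycle G g h' r) $ j $ l else 0)"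
    by (intro sum.cong refl) (simp add: action_matrix_eq)
  also have "\<dots> = (\<Sum>j\<in>UNIV. action_matrix h \<alpha> (?v, j) * \<rho> (yd_cocycle G g h' r) $ j $ l)"
    using v finite_class by simp
  also have "\<dots> = action_matrix (h \<otimes> h') \<alpha> (r, l)"
    using assms v class_closed
    by (simp add: \<alpha> action_matrix_eq yd_target_mult yd_cocycle_mult rep_mult cocycle_closed
        matrix_matrix_mult_def)
  finally show ?thesis .
qed

sublocale group_type_braiding "yd_basis G s" "yd_braiding G \<rho> g" "\<lambda>a. action_matrix (fst a)"
proof
  show "yd_braiding G \<rho> g (a, b) (\<alpha>, \<beta>) = (if \<beta> = a then action_matrix (fst a) \<alpha> b else 0)"
    for a b \<alpha> \<beta>
    by (cases a; cases b; cases \<alpha>) (simp add: yd_braiding_def action_matrix_def)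
  show "finite (yd_basis G s :: ('g \<times> 'n) set)"
    using finite_class by (simp add: yd_basis_def)
  show "\<alpha> \<in> yd_basis G s" if "a \<in> yd_basis G s" "b \<in> yd_basis G s" "action_matrix (fst a) \<alpha> b \<noteq> 0"
    for a b \<alpha> :: "'g \<times> 'n"
    using that class_closed yd_target_closed
    by (cases a; cases b; cases \<alpha>) (auto simp: yd_basis_def action_matrix_eq split: if_splits)
  fix \<alpha> \<beta> \<gamma> d e :: "'g \<times> 'n"
  assume *: "\<beta> \<in> yd_basis G s" "\<gamma> \<in> yd_basis G s" "d \<in> yd_basis G s" "e \<in> yd_basis G s"
    and ne: "action_matrix (fst \<gamma>) \<beta> e \<noteq> 0"
  obtain r l where d: "d = (r, l)" by (cases d)
  have cl: "fst \<beta> \<in> carrier G" "fst \<gamma> \<in> carrier G" "fst e \<in> carrier G" "r \<in> conj_class G s"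
    using * d class_closed by (auto simp: yd_basis_def)
  \<comment> \<open>A nonzero entry forces this conjugacy, and then both sums are entries of the
    matrix of one and the same group element.\<close>
  have "fst \<beta> = yd_target G (fst \<gamma>) (fst e)"
    using ne by (cases \<beta>; cases e) (auto simp: action_matrix_eq split: if_splits)
  then have "fst \<beta> \<otimes> fst \<gamma> = fst \<gamma> \<otimes> fst e"
    using cl by (simp add: yd_target_def m_assoc)
  then show "(\<Sum>b\<in>yd_basis G s. action_matrix (fst \<beta>) \<alpha> b * action_matrix (fst \<gamma>) b d)
      = (\<Sum>b\<in>yd_basis G s. action_matrix (fst \<gamma>) \<alpha> b * action_matrix (fst e) b d)"
    unfolding d using cl by (simp add: action_matrix_mult)
qed

section \<open>The scalar by which s acts\<close>

lemma power_centralizer: "s [^] (e :: nat) \<in> centralizer G s"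
proof -
  have "s [^] e \<otimes> s = s \<otimes> s [^] e" using s_closed by (metis nat_pow_Suc nat_pow_Suc2)
  then show ?thesis using s_closed by (simp add: centralizer_def)
qed

lemma s_centralizer: "s \<in> centralizer G s"
  using s_closed by (simp add: centralizer_def)

lemma rep_one: "\<rho> \<one> = mat 1"
proof -
  have one: "\<one> \<in> centralizer G s" using s_closed by (simp add: centralizer_def)
  then have "invertible (\<rho> \<one>)" using rep_hom by (auto simp: hom_def general_linear_def Pi_iff)
  then obtain A where A: "A ** \<rho> \<one> = mat 1" by (auto simp: invertible_def)
  have "\<rho> \<one> ** \<rho> \<one> = \<rho> \<one>" using rep_mult[OF one one] by simp
  then show ?thesis using A by (metis matrix_mul_assoc matrix_mul_lid)
qed

lemma rep_power_Suc: "\<rho> (s [^] Suc e) = \<rho> s ** \<rho> (s [^] e)"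
  using rep_mult[OF s_centralizer power_centralizer[of e]] nat_pow_Suc2[OF s_closed, of e] by (simp only:)

lemma rep_power: "\<rho> s = mat q \<Longrightarrow> \<rho> (s [^] (e :: nat)) = mat (q ^ e)"
proof (induction e)
  case (Suc e)
  then show ?case by (simp only: rep_power_Suc mat_mult_mat power_Suc)
qed (simp add: rep_one)

text \<open>
  Since \<open>\<rho> s\<close> has finite order, an eigenvector is obtained by averaging the vectors
  \<open>\<zeta>\<^sup>i\<^sup>k \<rho>(s)\<^sup>k v\<close> over \<open>k\<close>.
\<close>

lemma rep_s_scalar:
  assumes irr: "irreducible_rep (G\<lparr>carrier := centralizer G s\<rparr>) \<rho>"
  shows "\<exists>q. \<rho> s = mat q"
proof -
  define N where "N = ord s"
  have N: "0 < N" using ord_ge_1[OF finite_carrier s_closed] by (simp add: N_def)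
  define v :: "complex^'n" where "v = 1"
  define P where "P k = \<rho> (s [^] k) *v v" for k :: nat
  have P_Suc: "P (Suc k) = \<rho> s *v P k" for k
    by (simp only: P_def rep_power_Suc matrix_vector_mul_assoc)
  have P_0: "P 0 = v" and P_N: "P N = v"
    using s_closed by (simp_all add: P_def N_def rep_one)
  define \<zeta> where "\<zeta> = exp (2 * of_real pi * \<i> * of_nat 1 / of_nat N)"
  have \<zeta>_power: "\<zeta> ^ k = exp (2 * of_real pi * \<i> * of_nat k / of_nat N)" for k
    unfolding \<zeta>_def exp_of_nat_mult[symmetric] by (simp add: mult_ac)
  have \<zeta>_N: "\<zeta> ^ N = 1" unfolding \<zeta>_def using N by (intro complex_root_unity) simp
  have \<zeta>_nz: "\<zeta> \<noteq> 0" by (simp add: \<zeta>_def)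
  define V where "V i = (\<Sum>k<N. ((\<zeta> ^ i) ^ k) *s P k)" for i
  have eigen: "\<rho> s *v V i = inverse (\<zeta> ^ i) *s V i" for i
  proof -
    let ?f = "\<lambda>k. ((\<zeta> ^ i) ^ k) *s P k"
    have "\<zeta> ^ i *s (\<rho> s *v V i) = (\<Sum>k<N. ?f (Suc k))"
      unfolding V_def vec.linear_sum[OF matrix_vector_mul_linear_gen]
      by (simp add: vec.scale_sum_right vector_scalar_commute P_Suc)
    also have "\<dots> = (\<Sum>k<N. ?f k)"
    proof -
      have "?f 0 + (\<Sum>k<N. ?f (Suc k)) = (\<Sum>k<N. ?f k) + ?f N"
        using sum.lessThan_Suc_shift[of ?f N, symmetric] sum.lessThan_Suc[of ?f N] by (rule trans)
      moreover have "?f N = ?f 0" by (simp add: P_0 P_N \<zeta>_N power_mult[symmetric] mult.commute[of i]) (simp add: power_mult \<zeta>_N)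
      ultimately show ?thesis by simp
    qed
    finally have "\<zeta> ^ i *s (\<rho> s *v V i) = V i" by (simp add: V_def)
    then have "inverse (\<zeta> ^ i) *s (\<zeta> ^ i *s (\<rho> s *v V i)) = inverse (\<zeta> ^ i) *s V i" by simp
    then show ?thesis using \<zeta>_nz by simp
  qed
  \<comment> \<open>By orthogonality of the roots of unity the \<open>V i\<close> add up to
    \<open>N\<close> times \<open>v\<close>, so one of them is nonzero.\<close>
  have "(\<Sum>i<N. V i) = (\<Sum>k<N. (\<Sum>i<N. (\<zeta> ^ k) ^ i) *s P k)"
    unfolding V_def by (subst sum.swap) (simp add: vec.scale_sum_left power_mult[symmetric] mult.commute)
  also have "\<dots> = (\<Sum>k<N. if k = 0 then of_nat N *s v else 0)"
  proof (intro sum.cong refl)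
    fix k assume k: "k \<in> {..<N}"
    show "(\<Sum>i<N. (\<zeta> ^ k) ^ i) *s P k = (if k = 0 then of_nat N *s v else 0)"
    proof (cases "k = 0")
      case False
      then have "\<zeta> ^ k \<noteq> 1"
        unfolding \<zeta>_power using k N by (subst complex_root_unity_eq_1) (auto dest: dvd_imp_le)
      moreover have "(\<zeta> ^ k) ^ N = 1" by (metis \<zeta>_N mult.commute power_mult power_one)
      ultimately have "(\<Sum>i<N. (\<zeta> ^ k) ^ i) = 0" by (simp add: geometric_sum)
      then show ?thesis using False by simp
    qed (simp add: P_0)
  qed
  also have "\<dots> = of_nat N *s v" using N by simp
  finally have "(\<Sum>i<N. V i) \<noteq> 0" using N by (simp add: v_def vec_eq_iff)
  then obtain i where i: "V i \<noteq> 0" by (metis sum.neutral)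
  define c where "c = inverse (\<zeta> ^ i)"
  \<comment> \<open>Schur's argument: the centralizer commutes with \<open>s\<close>, so this
    nonzero eigenspace is a subrepresentation.\<close>
  let ?W = "{w. \<rho> s *v w = c *s w}"
  have "vec.subspace ?W"
    by (auto simp: vec.subspace_def matrix_vector_right_distrib vector_scalar_commute
        vec.scale_right_distrib mult.commute)
  moreover have "\<rho> x *v w \<in> ?W" if x: "x \<in> centralizer G s" and w: "w \<in> ?W" for x w
  proof -
    have "\<rho> s ** \<rho> x = \<rho> x ** \<rho> s"
      using rep_mult[OF s_centralizer x] rep_mult[OF x s_centralizer] x by (simp add: centralizer_def)
    then have "\<rho> s *v (\<rho> x *v w) = \<rho> x *v (\<rho> s *v w)" by (simp add: matrix_vector_mul_assoc)
    then show ?thesis using w by (simp add: vector_scalar_commute)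
  qed
  ultimately have "?W = {0} \<or> ?W = UNIV" using irr unfolding irreducible_rep_def by auto
  moreover have "V i \<in> ?W" using eigen[of i] by (simp add: c_def)
  ultimately have "?W = UNIV" using i by auto
  then have "\<rho> s *v w = mat c *v w" for w by (auto simp: mat_mult_vector)
  then show ?thesis by (auto simp: matrix_eq)
qed

section \<open>Diagonal subspaces spanned by powers of s\<close>

lemma conj_power:
  "y \<in> carrier G \<Longrightarrow> u \<in> carrier G \<Longrightarrow> inv y \<otimes> u [^] (e :: nat) \<otimes> y = (inv y \<otimes> u \<otimes> y) [^] e"
proof (induction e)
  case (Suc e)
  have "inv y \<otimes> u [^] Suc e \<otimes> y = (inv y \<otimes> u [^] e \<otimes> y) \<otimes> (inv y \<otimes> u \<otimes> y)"
    using Suc.prems by (simp add: m_assoc) (simp add: m_assoc[symmetric])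
  then show ?case using Suc by simp
qed simp

text \<open>Conjugation by \<open>g u\<close> takes \<open>s\<close> to \<open>u\<close>, hence
  \<open>s [^] e\<close> to \<open>u [^] e\<close>. So a power of \<open>u\<close> acts on the
  component of \<open>u\<close> through the same power of \<open>s\<close>.\<close>

lemma cocycle_power:
  assumes "u \<in> conj_class G s" "t = u [^] (e :: nat)"
  shows "yd_target G t u = u" "yd_cocycle G g t u = s [^] e"
proof -
  have u: "u \<in> carrier G" using assms(1) by (rule class_closed)
  have "u [^] e \<otimes> u = u \<otimes> u [^] e" using u by (metis nat_pow_Suc nat_pow_Suc2)
  then show target: "yd_target G t u = u" using u by (simp add: yd_target_def assms(2) m_assoc)
  have gu: "g u \<in> carrier G" by (rule choice_closed[OF assms(1)])
  have "inv (g u) \<otimes> u \<otimes> g u = inv (g u) \<otimes> (g u \<otimes> s \<otimes> inv (g u)) \<otimes> g u"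
    by (simp add: choice_conj[OF assms(1)])
  also have "\<dots> = s" using gu s_closed by (simp add: m_assoc) (simp add: m_assoc[symmetric])
  finally show "yd_cocycle G g t u = s [^] e"
    using conj_power[OF gu u, of e] by (simp add: yd_cocycle_def target[unfolded assms(2)] assms(2))
qed

lemma action_matrix_power:
  assumes "\<rho> s = mat q" "u \<in> conj_class G s" "t = u [^] (e :: nat)"
  shows "action_matrix t \<alpha> (u, l) = (if \<alpha> = (u, l) then q ^ e else 0)"
  by (cases \<alpha>) (auto simp: action_matrix_eq cocycle_power[OF assms(2,3)] rep_power[OF assms(1)] mat_def)

lemma conj_class_conj:
  assumes "x \<in> carrier G" "t \<in> conj_class G s"
  shows "x \<otimes> t \<otimes> inv x \<in> conj_class G s"
  using yd_target_closed[OF assms] by (simp add: yd_target_def)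

text \<open>For \<open>t = u [^] a\<close> and \<open>u = t [^] b\<close> the entries satisfy q_tu
  q_ut = q^(a+b), so the condition on \<open>a + b + h\<close> says that this product is
  q^(-h).\<close>

lemma infinite_powers:
  assumes q: "\<rho> s = mat q" and D: "D \<subseteq> conj_class G s"
    and power: "\<And>t u. t \<in> D \<Longrightarrow> u \<in> D \<Longrightarrow> t \<noteq> u \<Longrightarrow>
      \<exists>a b. t = u [^] (a :: nat) \<and> u = t [^] (b :: nat) \<and> q ^ (a + b + h) = 1"
    and h: "0 < h" "\<And>m. 0 < m \<Longrightarrow> m \<le> h \<Longrightarrow> q ^ m \<noteq> 1"
    and card: "2 \<le> h * (card D - 1)"
  shows "\<not> nichols_finite_dim (yd_basis G s) (yd_braiding G \<rho> g)"
proof (rule cartan_type_infinite)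
  \<comment> \<open>An arbitrary fixed basis vector of V; powers of s act on V by scalars, so the
    choice is immaterial.\<close>
  let ?k = "undefined :: 'n"
  let ?D = "(\<lambda>t. (t, ?k)) ` D"
  define Q where "Q a b = \<rho> (yd_cocycle G g (fst a) (fst b)) $ ?k $ ?k" for a b :: "'g \<times> 'n"
  have Q: "Q (t, ?k) (u, ?k) = q ^ a" if "u \<in> conj_class G s" "t = u [^] (a :: nat)" for t u a
    by (simp add: Q_def cocycle_power[OF that] rep_power[OF q] mat_def)
  have self: "t = t [^] (1 :: nat)" if "t \<in> conj_class G s" for t
    using class_closed[OF that] by simp
  define p where "p = csqrt q"
  have p: "p\<^sup>2 = q" by (simp add: p_def)
  have pp: "p ^ (2 * m) = q ^ m" for m by (simp add: power_mult p)
  show "?D \<subseteq> yd_basis G s" using D by (auto simp: yd_basis_def)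
  show "action_matrix (fst a) \<alpha> b = (if \<alpha> = b then Q a b else 0)" if ab: "a \<in> ?D" "b \<in> ?D" for a b \<alpha>
  proof -
    obtain t u where t: "a = (t, ?k)" "b = (u, ?k)" "t \<in> D" "u \<in> D" using ab by auto
    then have u: "u \<in> conj_class G s" using D by auto
    obtain e :: nat where e: "t = u [^] e" using power[OF t(3,4)] self[OF u] by blast
    show ?thesis unfolding t(1,2) fst_conv action_matrix_power[OF q u e] Q[OF u e] ..
  qed
  show "0 < h" by (rule h)
  show "p ^ (2 * m) \<noteq> 1" if "0 < m" "m \<le> h" for m using h(2)[OF that] by (simp add: pp)
  show "p \<noteq> 0"
  proof
    assume "p = 0"
    then have "q = 0" using p by simp
    have "D \<noteq> {}" "card D \<noteq> 1" using card by auto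
    then obtain t where t: "t \<in> D" by blast
    have "D \<noteq> {t}" using \<open>card D \<noteq> 1\<close> by auto
    then obtain u where "u \<in> D" "t \<noteq> u" using t by auto
    from power[OF t this] show False using h(1) \<open>q = 0\<close> by (auto simp: power_0_left)
  qed
  show "Q a a = p\<^sup>2" if "a \<in> ?D" for a
    using that D Q[OF _ self] by (auto simp: p)
  show "Q a b * Q b a * p ^ (2 * h) = 1" if ab: "a \<in> ?D" "b \<in> ?D" "a \<noteq> b" for a b
  proof -
    obtain t u where t: "a = (t, ?k)" "b = (u, ?k)" "t \<in> D" "u \<in> D" "t \<noteq> u" using ab by auto
    obtain c e where ce: "t = u [^] (c :: nat)" "u = t [^] (e :: nat)" "q ^ (c + e + h) = 1"
      using power[OF t(3-5)] by blast
    have "u \<in> conj_class G s" "t \<in> conj_class G s" using t D by auto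
    note Q[OF this(1) ce(1)] Q[OF this(2) ce(2)]
    then show ?thesis using ce(3) by (simp only: t pp power_add)
  qed
  show "2 \<le> h * (card ?D - 1)" using card by (subst card_image) (auto simp: inj_on_def)
qed

lemma infinite_of_conj_powers:
  assumes q: "\<rho> s = mat q" and "q \<noteq> - 1"
    and x: "x \<in> carrier G" "x \<otimes> s \<otimes> inv x = s [^] (j :: nat)"
    and ne: "s \<noteq> s [^] j" "s [^] j \<noteq> s [^] (j * j)" "s \<noteq> s [^] (j * j)"
  shows "\<not> nichols_finite_dim (yd_basis G s) (yd_braiding G \<rho> g)"
proof (cases "q = 1")
  case True
  have s: "s \<in> conj_class G s" using s_closed by (auto simp: conj_class_def intro!: exI[of _ \<one>])
  show ?thesis
  proof (rule trivial_type_infinite)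
    show "(s, undefined) \<in> yd_basis G s" using s by (simp add: yd_basis_def)
    show "action_matrix (fst (s, undefined)) \<alpha> (s, undefined) = (if \<alpha> = (s, undefined) then 1 else 0)" for \<alpha>
      using action_matrix_power[OF q s, of s 1] s_closed True by simp
  qed
next
  case False
  have conj: "x \<otimes> s [^] (e :: nat) \<otimes> inv x = s [^] (j * e)" for e
    using conj_power[of "inv x" s e] x s_closed by (simp add: nat_pow_pow)
  have s: "s \<in> conj_class G s" using s_closed by (auto simp: conj_class_def intro!: exI[of _ \<one>])
  have sj: "s [^] j \<in> conj_class G s" using conj_class_conj[OF x(1) s] x(2) by simp
  have sjj: "s [^] (j * j) \<in> conj_class G s" using conj_class_conj[OF x(1) sj] conj by simp
  have conj_funpow: "x [^] m \<otimes> s \<otimes> inv (x [^] m) = s [^] (j ^ m)" for m :: nat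
  proof (induction m)
    case (Suc m)
    have "x [^] Suc m \<otimes> s \<otimes> inv (x [^] Suc m) = x \<otimes> (x [^] m \<otimes> s \<otimes> inv (x [^] m)) \<otimes> inv x"
      using x(1) s_closed nat_pow_Suc2[OF x(1), of m] by (simp add: inv_mult_group m_assoc)
    then show ?case by (simp only: Suc conj power_Suc)
  qed (use s_closed in simp)
  \<comment> \<open>Conjugation by \<open>x\<close> multiplies exponents of \<open>s\<close> by
    \<open>j\<close>, and \<open>x [^] ord x\<close> is the identity. Hence \<open>j ^ m\<close> is
    a natural exponent that inverts \<open>j\<close> on the powers of \<open>s\<close>.\<close>
  obtain m where m: "ord x = Suc m" using ord_ge_1[OF finite_carrier x(1)] by (cases "ord x") auto
  define i where "i = j ^ m"
  have ij: "s [^] (j * i) = s"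
    using conj_funpow[of "Suc m"] x(1) s_closed pow_ord_eq_1[OF x(1)] by (simp add: i_def m del: nat_pow_Suc)
  have qij: "q ^ (j * i) = q"
  proof -
    have "mat (q ^ (j * i)) = (mat q :: complex^'n^'n)" using rep_power[OF q, of "j * i"] ij q by simp
    then show ?thesis by (rule mat_inject)
  qed
  let ?t = "s [^] j" and ?u = "s [^] (j * j)"
  have pow: "?t = s [^] j" "s = ?t [^] i" "?u = s [^] (j * j)" "s = ?u [^] (i * i)" "?u = ?t [^] j" "?t = ?u [^] i"
  proof -
    show "s = ?t [^] i" using s_closed by (simp add: nat_pow_pow ij)
    show "?u = ?t [^] j" using s_closed by (simp add: nat_pow_pow)
    have "?u [^] (i * i) = (s [^] (j * i)) [^] (j * i)" using s_closed by (simp add: nat_pow_pow mult_ac)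
    then show "s = ?u [^] (i * i)" by (simp only: ij)
    have "?u [^] i = (s [^] (j * i)) [^] j" using s_closed by (simp add: nat_pow_pow mult_ac)
    then show "?t = ?u [^] i" by (simp only: ij)
  qed simp_all
  have q2: "q ^ m \<noteq> 1" if "0 < m" "m \<le> 2" for m
  proof -
    have "m = 1 \<or> m = 2" using that by auto
    then show ?thesis using False \<open>q \<noteq> - 1\<close> by (auto simp: power2_eq_1_iff)
  qed
  define linked where "linked k t u \<longleftrightarrow>
    (\<exists>a b. t = u [^] (a :: nat) \<and> u = t [^] (b :: nat) \<and> q ^ (a + b + k) = 1)" for k t u
  have sym: "linked k u t" if "linked k t u" for k t u
    using that unfolding linked_def by (metis add.commute)
  have link: "linked k s ?t" "linked k ?t ?u" if "q ^ (j + i + k) = 1" for k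
    unfolding linked_def using pow(1,2,5,6) that add.commute[of i j] by metis+
  have link_far: "linked k s ?u" if "q ^ (j * j + i * i + k) = 1" for k
    unfolding linked_def using pow(3,4) that add.commute[of "i * i" "j * j"] by metis
  have conclude: ?thesis
    if "D \<subseteq> conj_class G s" "0 < k" "\<And>m. 0 < m \<Longrightarrow> m \<le> k \<Longrightarrow> q ^ m \<noteq> 1"
      "\<And>t u. t \<in> D \<Longrightarrow> u \<in> D \<Longrightarrow> t \<noteq> u \<Longrightarrow> linked k t u" "2 \<le> k * (card D - 1)" for D k
    using infinite_powers[OF q that(1) _ that(2,3,5)] that(4) unfolding linked_def by blast
  consider "q ^ (j + i) = 1" | "q ^ (j + i + 1) = 1" | "q ^ (j + i) \<noteq> 1" "q ^ (j + i + 1) \<noteq> 1" by blast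
  then show ?thesis
  proof cases
    case 1
    \<comment> \<open>Neighbours have q_tu q_ut = 1. Squaring j + i and using
      \<open>q ^ (j * i) = q\<close> gives the exponent -2 for \<open>s\<close> and
      \<open>?u\<close>: affine type A_1^(1).\<close>
    have "(j + i) * (j + i) = j * j + i * i + (j * i) * 2" by (simp add: algebra_simps)
    then have "(q ^ (j + i)) ^ (j + i) = q ^ (j * j + i * i + (j * i) * 2)"
      by (simp only: power_mult[symmetric])
    also have "\<dots> = q ^ (j * j + i * i) * (q ^ (j * i)) ^ 2"
      by (simp only: power_add power_mult)
    finally have "1 = q ^ (j * j + i * i) * q ^ 2" unfolding 1 qij power_one .
    then have "q ^ (j * j + i * i + 2) = 1" by (simp only: power_add[of q "j * j + i * i" 2])
    from link_far[OF this] have "linked 2 t u" if "t \<in> {s, ?u}" "u \<in> {s, ?u}" "t \<noteq> u" for t u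
      using that sym by blast
    then show ?thesis using s sjj ne(3) q2 by (intro conclude[of "{s, ?u}" 2]) auto
  next
    case 2
    \<comment> \<open>Neighbours have exponent -1. Squaring j + i + 1 gives the same for
      \<open>s\<close> and \<open>?u\<close>, so the three letters form affine type A_2^(1).\<close>
    have "(j + i + 1) * (j + i + 1) = j * j + i * i + 1 + (j * i) * 2 + (j + i) * 2" by (simp add: algebra_simps)
    then have "(q ^ (j + i + 1)) ^ (j + i + 1) = q ^ (j * j + i * i + 1 + (j * i) * 2 + (j + i) * 2)"
      by (simp only: power_mult[symmetric])
    also have "\<dots> = q ^ (j * j + i * i + 1) * (q ^ (j * i)) ^ 2 * (q ^ (j + i)) ^ 2"
      by (simp only: power_add power_mult)
    also have "\<dots> = q ^ (j * j + i * i + 1) * (q ^ (j + i + 1)) ^ 2"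
      unfolding qij by (simp add: power_mult_distrib power_add[of q "j + i"])
    finally have "q ^ (j * j + i * i + 1) = 1" unfolding 2 by (simp only: power_one mult_1_right)
    from link_far[OF this] link[OF 2] have "linked 1 t u"
      if "t \<in> {s, ?t, ?u}" "u \<in> {s, ?t, ?u}" "t \<noteq> u" for t u
      using that sym by blast
    then show ?thesis using s sj sjj ne q2 by (intro conclude[of "{s, ?t, ?u}" 1]) auto
  next
    case 3
    define n where "n = (LEAST n. 0 < n \<and> q ^ n = 1)"
    have "\<exists>n. 0 < n \<and> q ^ n = 1"
    proof (intro exI conjI)
      show "0 < ord s" using ord_ge_1[OF finite_carrier s_closed] by simp
      have "mat (q ^ ord s) = (mat 1 :: complex^'n^'n)"
        using rep_power[OF q, of "ord s"] s_closed by (simp add: rep_one)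
      then show "q ^ ord s = 1" by (rule mat_inject)
    qed
    then have n: "0 < n" "q ^ n = 1" unfolding n_def by (metis (mono_tags, lifting) LeastI_ex)+
    have least: "q ^ m \<noteq> 1" if "0 < m" "m < n" for m
      using not_less_Least[of m "\<lambda>n. 0 < n \<and> q ^ n = 1"] that by (auto simp: n_def)
    \<comment> \<open>The representative of -(j + i) modulo the order \<open>n\<close> of
      \<open>q\<close> in the range 1 to n. The other two cases being excluded, it is neither
      \<open>n\<close> nor 1, and two letters suffice.\<close>
    define h where "h = n - (j + i) mod n"
    have "(j + i) + h = n * ((j + i) div n + 1)"
      unfolding h_def distrib_left
      using mult_div_mod_eq[of n "j + i"] mod_less_divisor[OF n(1), of "j + i"] by linarith
    then have qh: "q ^ (j + i + h) = 1" by (simp only: power_mult n(2) power_one)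
    have "h \<noteq> 0" using mod_less_divisor[OF n(1), of "j + i"] by (simp add: h_def)
    moreover have "h \<noteq> 1" using qh 3 by auto
    moreover have "h \<noteq> n" using qh n(2) 3 by (auto simp: power_add)
    moreover have "h \<le> n" by (simp add: h_def)
    ultimately have h: "2 \<le> h" "h < n" by auto
    from link(1)[OF qh] have "linked h t u" if "t \<in> {s, ?t}" "u \<in> {s, ?t}" "t \<noteq> u" for t u
      using that sym by blast
    then show ?thesis using s sj ne(1) least h by (intro conclude[of "{s, ?t}" h]) auto
  qed
qed

end

theorem lemma1p8:
  fixes G :: "('g, 'm) monoid_scheme"
    and s :: 'g
    and \<rho> :: "'g \<Rightarrow> complex^'n^'n"
    and g :: "'g \<Rightarrow> 'g"
  assumes "group G"
    and "finite (carrier G)"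
    and "s \<in> carrier G"
    and "irreducible_rep (G\<lparr>carrier := centralizer G s\<rparr>) \<rho>"
    and "conj_choice G s g"
    and "\<exists>j::int. s \<noteq> s [^]\<^bsub>G\<^esub> j \<and> s [^]\<^bsub>G\<^esub> j \<noteq> s [^]\<^bsub>G\<^esub> (j\<^sup>2) \<and> s \<noteq> s [^]\<^bsub>G\<^esub> (j\<^sup>2)
           \<and> s [^]\<^bsub>G\<^esub> j \<in> conj_class G s"
    and "nichols_finite_dim (yd_basis G s) (yd_braiding G \<rho> g)"
  shows "even (group.ord G s) \<and> q_scalar \<rho> s = -1"
proof -
  interpret yd_module G s \<rho> g
    using assms by (auto simp: yd_module_def yd_module_axioms_def irreducible_rep_def)
  obtain q where q: "\<rho> s = mat q" using rep_s_scalar[OF assms(4)] by blast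
  have q_scalar: "q_scalar \<rho> s = q"
    unfolding q_scalar_def q by (rule the_equality) (auto dest: mat_inject)
  have N: "0 < ord s" using ord_ge_1[OF finite_carrier s_closed] by simp
  obtain j :: int where j: "s \<noteq> s [^]\<^bsub>G\<^esub> j" "s [^]\<^bsub>G\<^esub> j \<noteq> s [^]\<^bsub>G\<^esub> (j\<^sup>2)" "s \<noteq> s [^]\<^bsub>G\<^esub> (j\<^sup>2)" "s [^]\<^bsub>G\<^esub> j \<in> conj_class G s"
    using assms(6) by blast
  \<comment> \<open>The exponent \<open>j\<close> may be negative; its residue modulo the order of
    \<open>s\<close> gives natural exponents.\<close>
  define k where "k = nat (j mod int (ord s))"
  have k: "int k = j mod int (ord s)" using N by (simp add: k_def)
  have sk: "s [^]\<^bsub>G\<^esub> j = s [^]\<^bsub>G\<^esub> k"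
  proof -
    have "s [^]\<^bsub>G\<^esub> j = s [^]\<^bsub>G\<^esub> int k"
      unfolding int_pow_eq[OF s_closed] by (simp add: k mod_eq_dvd_iff[symmetric])
    then show ?thesis by (simp add: int_pow_int)
  qed
  have skk: "s [^]\<^bsub>G\<^esub> (j\<^sup>2) = s [^]\<^bsub>G\<^esub> (k * k)"
  proof -
    have "s [^]\<^bsub>G\<^esub> (j\<^sup>2) = s [^]\<^bsub>G\<^esub> int (k * k)"
      unfolding int_pow_eq[OF s_closed]
      by (simp add: k mod_eq_dvd_iff[symmetric] power2_eq_square mod_mult_eq)
    then show ?thesis by (simp add: int_pow_int del: of_nat_mult)
  qed
  obtain x where x: "x \<in> carrier G" "s [^]\<^bsub>G\<^esub> k = x \<otimes>\<^bsub>G\<^esub> s \<otimes>\<^bsub>G\<^esub> inv\<^bsub>G\<^esub> x"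
    using j(4) sk by (auto simp: conj_class_def)
  have "q = - 1"
    using infinite_of_conj_powers[OF q _ x(1) x(2)[symmetric]] j assms(7) sk skk by auto
  moreover have "q ^ ord s = 1"
  proof -
    have "mat (q ^ ord s) = (mat 1 :: complex^'n^'n)"
      using rep_power[OF q, of "ord s"] s_closed by (simp add: rep_one)
    then show ?thesis by (rule mat_inject)
  qed
  ultimately show ?thesis using q_scalar by (auto simp: minus_one_power_iff split: if_splits)
qed

end
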